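(* We have \begin{align*} \sum_{\lambda} G_{\lambda /\!\!/ \mu}(\mathbf{x}; \boldsymbol{\alpha}, \boldsymbol{\beta}) g_{\lambda / \nu}(\mathbf{y}; \boldsymbol{\alpha}, \boldsymbol{\beta}) &= \prod_{i,j} \frac{1}{1 - x_i y_j} \sum_{\eta} G_{\nu /\!\!/ \eta}(\mathbf{x}; \boldsymbol{\alpha}, \boldsymbol{\beta})g_{\mu / \eta}(\mathbf{y}; \boldsymbol{\alpha}, \boldsymbol{\beta}), \\ \sum_{\lambda} G_{\lambda' /\!\!/ \mu'}(\mathbf{x}; \boldsymbol{\beta}, \boldsymbol{\alpha}) g_{\lambda / \nu}(\mathbf{y}; \boldsymbol{\alpha}, \boldsymbol{\beta}) &= \prod_{i,j} (1 + x_i y_j) \sum_{\eta} G_{\nu' /\!\!/ \eta'}(\mathbf{x}; \boldsymbol{\beta}, \boldsymbol{\alpha})g_{\mu / \eta}(\mathbf{y}; \boldsymbol{\alpha}, \boldsymbol{\beta}), \\ \sum_{\lambda} G_{\lambda /\!\!/ \mu}(\mathbf{x}; \boldsymbol{\alpha}, \boldsymbol{\beta}) g_{\lambda' / \nu'}(\mathbf{y}; \boldsymbol{\beta}, \boldsymbol{\alpha}) &= \prod_{i,j} (1 + x_i y_j) \sum_{\eta} G_{\nu /\!\!/ \eta}(\mathbf{x}; \boldsymbol{\alpha}, \boldsymbol{\beta})g_{\mu' / \eta'}(\mathbf{y}; \boldsymbol{\beta}, \boldsymbol{\alpha}), \\ \sum_{\lambda} G_{\lambda' /\!\!/ \mu'}(\mathbf{x};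 \boldsymbol{\beta}, \boldsymbol{\alpha}) g_{\lambda' / \nu'}(\mathbf{y}; \boldsymbol{\beta}, \boldsymbol{\alpha}) &= \prod_{i,j} \frac{1}{1 - x_i y_j} \sum_{\eta} G_{\nu' /\!\!/ \eta'}(\mathbf{x}; \boldsymbol{\beta}, \boldsymbol{\alpha})g_{\mu' / \eta'}(\mathbf{y}; \boldsymbol{\beta}, \boldsymbol{\alpha}). \end{align*}
   Context: Let $\boldsymbol{\alpha}=(\alpha_1,\alpha_2,\ldots)$, $\boldsymbol{\beta}=(\beta_1,\beta_2,\ldots)$ be parameters. Set $A_i=\{-\alpha_1,\dots,-\alpha_i\}$, $B_i=\{\beta_1,\dots,\beta_i\}$ for $i\ge1$ and $A_i=B_i=\emptyset$ for $i\le 0$; for $i\le j$ put $A_{[i,j]}=A_j\setminus A_{i-1}$, $A_{[i,j)}=A_{[i,j-1]}$, $A_{(i,j]}=A_{[i+1,j]}$, and for reversed intervals interpret $A_{[i,j)}$ as the formal negative alphabet $\emptyset/A_{[j,i)}$ and $A_{(i,j]}$ as $\emptyset/A_{(j,i]}$; similarly for $B$. Supersymmetric $h_m(\mathbf{x}/\mathbf{y})=\sum_k(-1)^{m-k}h_k(\mathbf{x})e_{m-k}(\mathbf{y})$, and $h_m(\mathbf{x}/\!\!/\mathbf{y}):=\sum_{a-b=m}h_a(\mathbf{x})h_b(\mathbf{y})$. The refined canonical Grothendieck functions are, for $\ell\ge\ell(\lambda)$, $\mathbf{x}_n=(x_1,\dots,x_n)$: $G_{\lambda/\!\!/\mu}(\mathbf{x}_n;\boldsymbol{\alpha},\boldsymbol{\beta})=\prod_{i=1}^\ell\prod_{j=1}^n(1-\beta_ix_j)\det[h_{\lambda_i-\mu_j-i+j}(\mathbf{x}_n/\!\!/(A_{[\mu_j,\lambda_i]}\sqcup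 B_{[i,j)}))]_{i,j=1}^\ell$, $g_{\lambda/\mu}(\mathbf{x}_n;\boldsymbol{\alpha},\boldsymbol{\beta})=\det[h_{\lambda_i-\mu_j-i+j}(\mathbf{x}_n\sqcup A_{[\lambda_i,\mu_j]}\sqcup B_{[j,i)})]_{i,j=1}^\ell$, extended to infinitely many variables. Here $\lambda'$ denotes the conjugate partition, and $G(\mathbf{x};\boldsymbol{\beta},\boldsymbol{\alpha})$ means the roles of the two parameter sequences are swapped.
   Formalization: The displayed formula for G depends on ℓ (for λ=μ=∅, ℓ=0 gives 1 but ℓ=1 gives ∏(1−β_1x_j)), so G_{λ//μ} is taken to be its coefficientwise limit as ℓ→∞, with x, y, α, β independent formal variables. *)

theory Defs
  imports "HOL-Analysis.Infinite_Sum" "HOL-Library.Multiset" "Jordan_Normal_Form.Determinant"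
begin

section \<open>Formal power series in arbitrarily many commuting variables\<close>

text \<open>A monomial is a finite multiset of variables (its size is the degree), a power series is an
  arbitrary family of coefficients.\<close>

typedef ('v, 'a) mps = "UNIV :: ('v multiset \<Rightarrow> 'a) set"
  morphisms mps_coeff Abs_mps by simp

setup_lifting type_definition_mps

lemma mps_eqI: "(\<And>M. mps_coeff f M = mps_coeff g M) \<Longrightarrow> f = g"
  by (simp add: ext mps_coeff_inject[symmetric])

lemma finite_mset_splits: "finite {(A, B). A + B = (M :: 'v multiset)}"
proof -
  have "{A. A \<subseteq># M} \<subseteq> mset ` {xs. set xs \<subseteq> set_mset M \<and> length xs \<le> size M}"
  proof
    fix A assume A: "A \<in> {A. A \<subseteq># M}"
    obtain xs where xs: "mset xs = A"
      using ex_mset by blast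
    have "set xs \<subseteq> set_mset M"
      using A xs by (auto dest: mset_subset_eqD)
    moreover have "length xs \<le> size M"
      using A xs size_mset_mono by fastforce
    ultimately show "A \<in> mset ` {xs. set xs \<subseteq> set_mset M \<and> length xs \<le> size M}"
      using xs by blast
  qed
  then have "finite {A. A \<subseteq># M}"
    by (rule finite_subset) (intro finite_imageI finite_lists_length_le finite_set_mset)
  then have "finite ({A. A \<subseteq># M} \<times> {A. A \<subseteq># M})"
    by simp
  then show ?thesis
    by (rule rev_finite_subset) auto
qed

instantiation mps :: (type, comm_ring_1) comm_ring_1
begin

lift_definition zero_mps :: "('a, 'b) mps" is "\<lambda>_. 0" .
lift_definition one_mps :: "('a, 'b) mps" is "\<lambda>M. if M = {#} then 1 else 0" .
lift_definition plus_mps :: "('a, 'b) mps \<Rightarrow> ('a, 'b) mps \<Rightarrow> ('a, 'b) mps"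
  is "\<lambda>f g M. f M + g M" .
lift_definition minus_mps :: "('a, 'b) mps \<Rightarrow> ('a, 'b) mps \<Rightarrow> ('a, 'b) mps"
  is "\<lambda>f g M. f M - g M" .
lift_definition uminus_mps :: "('a, 'b) mps \<Rightarrow> ('a, 'b) mps"
  is "\<lambda>f M. - f M" .
lift_definition times_mps :: "('a, 'b) mps \<Rightarrow> ('a, 'b) mps \<Rightarrow> ('a, 'b) mps"
  is "\<lambda>f g M. \<Sum>(A, B)\<in>{(A, B). A + B = M}. f A * g B" .

instance
proof
  fix a b c :: "('a, 'b) mps"
  show "a + b + c = a + (b + c)" "a + b = b + a" "0 + a = a" "- a + a = 0" "a - b = a + - b"
    by (transfer; simp add: fun_eq_iff algebra_simps)+
  show "(0 :: ('a, 'b) mps) \<noteq> 1"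
    by transfer (auto simp: fun_eq_iff)
  show "a * b = b * a"
  proof (transfer, rule ext)
    fix f g :: "'a multiset \<Rightarrow> 'b" and M
    show "(\<Sum>(A, B)\<in>{(A, B). A + B = M}. f A * g B) = (\<Sum>(A, B)\<in>{(A, B). A + B = M}. g A * f B)"
      by (rule sum.reindex_bij_witness[of _ prod.swap prod.swap])
        (auto simp: add.commute mult.commute)
  qed
  show "(a + b) * c = a * c + b * c"
    by transfer (simp add: fun_eq_iff sum.distrib[symmetric] case_prod_unfold distrib_right)
  show "1 * a = a"
  proof (transfer, rule ext)
    fix f :: "'a multiset \<Rightarrow> 'b" and M :: "'a multiset"
    have "(\<Sum>(A, B)\<in>{(A, B). A + B = M}. (if A = {#} then 1 else 0) * f B)
        = (\<Sum>(A, B)\<in>{({#} :: 'a multiset, M)}. (if A = {#} then 1 else 0) * f B)"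
      by (rule sum.mono_neutral_right[OF finite_mset_splits]) (auto split: if_splits)
    then show "(\<Sum>(A, B)\<in>{(A, B). A + B = M}. (if A = {#} then 1 else 0) * f B) = f M"
      by simp
  qed
  show "a * b * c = a * (b * c)"
  proof (transfer, rule ext)
    fix f g h :: "'a multiset \<Rightarrow> 'b" and M
    let ?S = "\<lambda>M. {(A, B). A + B = (M :: 'a multiset)}"
    have "(\<Sum>(A, B)\<in>?S M. (\<Sum>(C, D)\<in>?S A. f C * g D) * h B)
        = (\<Sum>(p, q)\<in>Sigma (?S M) (\<lambda>p. ?S (fst p)). f (fst q) * g (snd q) * h (snd p))"
      by (subst sum.Sigma[symmetric])
        (auto simp: finite_mset_splits[unfolded case_prod_unfold] sum_distrib_right case_prod_unfold)
    also have "\<dots> = (\<Sum>(p, q)\<in>Sigma (?S M) (\<lambda>p. ?S (snd p)). f (fst p) * (g (fst q) * h (snd q)))"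
      by (rule sum.reindex_bij_witness[of _
            "\<lambda>(p, q). ((fst p + fst q, snd q), (fst p, fst q))"
            "\<lambda>(p, q). ((fst q, snd q + snd p), (snd q, snd p))"])
        (auto simp: algebra_simps)
    also have "\<dots> = (\<Sum>(A, B)\<in>?S M. f A * (\<Sum>(C, D)\<in>?S B. g C * h D))"
      by (subst sum.Sigma[symmetric])
        (auto simp: finite_mset_splits[unfolded case_prod_unfold] sum_distrib_left case_prod_unfold)
    finally show "(\<Sum>(A, B)\<in>?S M. (\<Sum>(C, D)\<in>?S A. f C * g D) * h B)
        = (\<Sum>(A, B)\<in>?S M. f A * (\<Sum>(C, D)\<in>?S B. g C * h D))" .
  qed
qed

end

lift_definition mps_var :: "'v \<Rightarrow> ('v, 'a :: comm_ring_1) mps"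
  is "\<lambda>v M. if M = {#v#} then 1 else 0" .

text \<open>Topology of coefficientwise convergence (product topology, coefficients discrete): a sequence
  converges iff each of its coefficients is eventually constant.\<close>

instantiation mps :: (type, type) t2_space
begin

definition open_mps :: "('a, 'b) mps set \<Rightarrow> bool" where
  "open_mps U \<longleftrightarrow>
    (\<forall>f\<in>U. \<exists>S. finite S \<and> {g. \<forall>M\<in>S. mps_coeff g M = mps_coeff f M} \<subseteq> U)"

instance
proof
  show "open (UNIV :: ('a, 'b) mps set)"
    by (auto simp: open_mps_def)
next
  fix U V :: "('a, 'b) mps set"
  assume U: "open U" and V: "open V"
  show "open (U \<inter> V)"
    unfolding open_mps_def
  proof
    fix f assume "f \<in> U \<inter> V"
    then obtain S T where "finite S" "{g. \<forall>M\<in>S. mps_coeff g M = mps_coeff f M} \<subseteq> U"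
      "finite T" "{g. \<forall>M\<in>T. mps_coeff g M = mps_coeff f M} \<subseteq> V"
      using U V unfolding open_mps_def by (meson IntD1 IntD2)
    then show "\<exists>S. finite S \<and> {g. \<forall>M\<in>S. mps_coeff g M = mps_coeff f M} \<subseteq> U \<inter> V"
      by (intro exI[of _ "S \<union> T"]) auto
  qed
next
  fix K :: "('a, 'b) mps set set"
  assume "\<forall>U\<in>K. open U"
  then show "open (\<Union>K)"
    unfolding open_mps_def by (meson Sup_upper Union_iff subset_trans)
next
  fix f g :: "('a, 'b) mps"
  assume "f \<noteq> g"
  then obtain M where M: "mps_coeff f M \<noteq> mps_coeff g M"
    by (metis mps_coeff_inject ext)
  have "open {h. mps_coeff h M = c}" for c :: 'b
    unfolding open_mps_def by (auto intro!: exI[of _ "{M}"])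
  with M show "\<exists>U V. open U \<and> open V \<and> f \<in> U \<and> g \<in> V \<and> U \<inter> V = {}"
    by (intro exI[of _ "{h. mps_coeff h M = mps_coeff f M}"]
        exI[of _ "{h. mps_coeff h M = mps_coeff g M}"]) auto
qed

end


section \<open>Alphabets and supersymmetric complete homogeneous functions\<close>

definition hsym :: "'r::comm_ring_1 list \<Rightarrow> nat \<Rightarrow> 'r" where
  "hsym xs k = (\<Sum>M | set_mset M \<subseteq> {..<length xs} \<and> size M = k. \<Prod>i\<in>#M. xs ! i)"

definition esym :: "'r::comm_ring_1 list \<Rightarrow> nat \<Rightarrow> 'r" where
  "esym xs k = (\<Sum>I | I \<subseteq> {..<length xs} \<and> card I = k. \<Prod>i\<in>I. xs ! i)"

text \<open>The pair \<open>(xs, ys)\<close> stands for the alphabet \<open>xs/ys\<close>; in particular \<open>([], ys)\<close> is the formal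
  negative of \<open>ys\<close>.\<close>

type_synonym 'r alphabet = "'r list \<times> 'r list"

definition alph_union :: "'r alphabet \<Rightarrow> 'r alphabet \<Rightarrow> 'r alphabet" (infixl "\<squnion>\<^sub>a" 65) where
  "Z \<squnion>\<^sub>a W = (fst Z @ fst W, snd Z @ snd W)"

definition h_super :: "'r::comm_ring_1 alphabet \<Rightarrow> int \<Rightarrow> 'r" where
  "h_super Z m = (if m < 0 then 0
     else (\<Sum>k\<le>nat m. (-1) ^ (nat m - k) * hsym (fst Z) k * esym (snd Z) (nat m - k)))"

text \<open>\<open>h\<^sub>m(xs//Z)\<close>; an infinite sum already for finite alphabets.\<close>

definition h_dslash :: "'r::{comm_ring_1,t2_space} list \<Rightarrow> 'r alphabet \<Rightarrow> int \<Rightarrow> 'r" where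
  "h_dslash xs Z m =
    (\<Sum>\<^sub>\<infinity>(a, b)\<in>{(a, b). int a - int b = m}. hsym xs a * h_super Z (int b))"

text \<open>\<open>alph_cc a i j\<close> is the alphabet \<open>{a\<^sub>k | i \<le> k \<le> j, k \<ge> 1}\<close>, read as the formal negative of
  \<open>{a\<^sub>k | j < k < i, k \<ge> 1}\<close> for a reversed interval; \<open>alph_co\<close> is the half-open variant.
  Sequences of letters are indexed from 1.\<close>

definition alph_cc :: "(nat \<Rightarrow> 'r) \<Rightarrow> int \<Rightarrow> int \<Rightarrow> 'r alphabet" where
  "alph_cc a i j =
    (if i \<le> j + 1 then (map (\<lambda>k. a (nat k)) [max 1 i..j], [])
     else ([], map (\<lambda>k. a (nat k)) [max 1 (j + 1)..i - 1]))"

definition alph_co :: "(nat \<Rightarrow> 'r) \<Rightarrow> int \<Rightarrow> int \<Rightarrow> 'r alphabet" where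
  "alph_co a i j = alph_cc a i (j - 1)"

definition A_cc :: "(nat \<Rightarrow> 'r::comm_ring_1) \<Rightarrow> int \<Rightarrow> int \<Rightarrow> 'r alphabet" where
  "A_cc \<alpha> = alph_cc (\<lambda>k. - \<alpha> k)"

definition B_co :: "(nat \<Rightarrow> 'r::comm_ring_1) \<Rightarrow> int \<Rightarrow> int \<Rightarrow> 'r alphabet" where
  "B_co \<beta> = alph_co \<beta>"

definition letters :: "(nat \<Rightarrow> 'r) \<Rightarrow> nat \<Rightarrow> 'r list" where
  "letters x n = map x [1..<n + 1]"


section \<open>Partitions\<close>

text \<open>The partition \<open>(\<lambda>\<^sub>1, \<lambda>\<^sub>2, \<dots>)\<close> is the function with value \<open>\<lambda>\<^bsub>i+1\<^esub>\<close> at \<open>i\<close>.\<close>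

definition partitions :: "(nat \<Rightarrow> nat) set" where
  "partitions = {p. antimono p \<and> finite {i. p i \<noteq> 0}}"

definition plength :: "(nat \<Rightarrow> nat) \<Rightarrow> nat" where
  "plength p = card {i. p i \<noteq> 0}"

definition conj_part :: "(nat \<Rightarrow> nat) \<Rightarrow> nat \<Rightarrow> nat" where
  "conj_part p j = card {i. j < p i}"


section \<open>Refined canonical Grothendieck functions and their duals\<close>

text \<open>The matrices below are indexed from 0, so position \<open>(i, j)\<close> is the entry \<open>(i+1, j+1)\<close> of the
  usual formulas.\<close>

definition G_fin :: "nat \<Rightarrow> nat \<Rightarrow> (nat \<Rightarrow> 'r::{comm_ring_1,t2_space}) \<Rightarrow> (nat \<Rightarrow> 'r) \<Rightarrow> (nat \<Rightarrow> 'r) \<Rightarrow>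
    (nat \<Rightarrow> nat) \<Rightarrow> (nat \<Rightarrow> nat) \<Rightarrow> 'r" where
  "G_fin l n x \<alpha> \<beta> lam mu =
    (\<Prod>i=1..l. \<Prod>j=1..n. 1 - \<beta> i * x j) *
    det (mat l l (\<lambda>(i, j).
      h_dslash (letters x n)
        (A_cc \<alpha> (int (mu j)) (int (lam i)) \<squnion>\<^sub>a B_co \<beta> (int i + 1) (int j + 1))
        (int (lam i) - int (mu j) - int i + int j)))"

text \<open>\<open>G_fin l\<close> is not literally independent of \<open>l\<close>: once \<open>l\<close> exceeds the lengths of both
  partitions, it is \<open>\<Prod>\<^bsub>j\<le>n\<^esub> (1 - \<beta>\<^sub>l x\<^sub>j)\<close> times a series that no longer depends on \<open>l\<close>. For
  example \<open>G_fin 1\<close> of two empty partitions is \<open>\<Prod>\<^bsub>j\<le>n\<^esub> (1 - \<beta>\<^sub>1 x\<^sub>j)\<close>, not 1. As the \<open>\<beta>\<^sub>l\<close> are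
  distinct variables, the extra factor tends to 1 coefficientwise, so \<open>G\<^bsub>\<lambda>//\<mu>\<^esub>\<close> is taken to be the
  stable value for large \<open>l\<close>; afterwards the number \<open>n\<close> of variables tends to infinity.\<close>

definition G_fun :: "(nat \<Rightarrow> 'r::{comm_ring_1,t2_space}) \<Rightarrow> (nat \<Rightarrow> 'r) \<Rightarrow> (nat \<Rightarrow> 'r) \<Rightarrow>
    (nat \<Rightarrow> nat) \<Rightarrow> (nat \<Rightarrow> nat) \<Rightarrow> 'r" where
  "G_fun x \<alpha> \<beta> lam mu = lim (\<lambda>n. lim (\<lambda>l. G_fin l n x \<alpha> \<beta> lam mu))"

definition g_fin :: "nat \<Rightarrow> nat \<Rightarrow> (nat \<Rightarrow> 'r::comm_ring_1) \<Rightarrow> (nat \<Rightarrow> 'r) \<Rightarrow> (nat \<Rightarrow> 'r) \<Rightarrow>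
    (nat \<Rightarrow> nat) \<Rightarrow> (nat \<Rightarrow> nat) \<Rightarrow> 'r" where
  "g_fin l n x \<alpha> \<beta> lam mu =
    det (mat l l (\<lambda>(i, j).
      h_super ((letters x n, []) \<squnion>\<^sub>a A_cc \<alpha> (int (lam i)) (int (mu j))
          \<squnion>\<^sub>a B_co \<beta> (int j + 1) (int i + 1))
        (int (lam i) - int (mu j) - int i + int j)))"

text \<open>The maximum with the length of \<open>mu\<close> matters only if \<open>mu\<close> is not contained in \<open>lam\<close>; it makes
  the determinant vanish in that case.\<close>

definition g_fun :: "(nat \<Rightarrow> 'r::{comm_ring_1,t2_space}) \<Rightarrow> (nat \<Rightarrow> 'r) \<Rightarrow> (nat \<Rightarrow> 'r) \<Rightarrow>
    (nat \<Rightarrow> nat) \<Rightarrow> (nat \<Rightarrow> nat) \<Rightarrow> 'r" where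
  "g_fun x \<alpha> \<beta> lam mu = lim (\<lambda>n. g_fin (max (plength lam) (plength mu)) n x \<alpha> \<beta> lam mu)"

definition ring_inv :: "'r::comm_ring_1 \<Rightarrow> 'r" where
  "ring_inv a = (THE b. a * b = 1)"

definition cauchy_kernel :: "(nat \<Rightarrow> 'r::{comm_ring_1,t2_space}) \<Rightarrow> (nat \<Rightarrow> 'r) \<Rightarrow> 'r" where
  "cauchy_kernel x y = lim (\<lambda>n. \<Prod>i=1..n. \<Prod>j=1..n. ring_inv (1 - x i * y j))"

definition dual_cauchy_kernel :: "(nat \<Rightarrow> 'r::{comm_ring_1,t2_space}) \<Rightarrow> (nat \<Rightarrow> 'r) \<Rightarrow> 'r" where
  "dual_cauchy_kernel x y = lim (\<lambda>n. \<Prod>i=1..n. \<Prod>j=1..n. 1 + x i * y j)"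

datatype gvar = X nat | Y nat | Alpha nat | Beta nat

end

theory Submission
  imports Defs "HOL-Computational_Algebra.Formal_Power_Series"
begin

text \<open>A partition with at most \<open>l\<close> rows is placed on the line as the set of positions
  \<open>\<lambda>\<^sub>i + l - i\<close>. For the series \<open>Y\<close> of the alphabet \<open>y\<close>, with Toeplitz matrix \<open>T\<^sub>Y\<close>, the defining
  determinants factor as \<open>g\<^bsub>\<lambda>/\<mu>\<^esub> = det (R\<^sub>\<lambda> T\<^sub>Y C\<^sub>\<mu>)\<close> and, up to a scalar that does not depend on the
  partitions, \<open>G\<^bsub>\<lambda>//\<mu>\<^esub> = det (R\<^sub>\<mu> T\<^sub>X\<^sup>T C\<^sub>\<lambda>)\<close>, where \<open>det (R\<^sub>\<lambda> C\<^sub>\<mu>) = \<delta>\<^bsub>\<lambda>\<mu>\<^esub>\<close>. By the Cauchy--Binet formula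
  this orthogonality turns into \<open>\<Sum>\<^sub>\<lambda> det (U C\<^sub>\<lambda>) det (R\<^sub>\<lambda> V) = det (U V)\<close>, so the two sides of
  the first identity are \<open>det (R\<^sub>\<mu> T\<^sub>X\<^sup>T T\<^sub>Y C\<^sub>\<nu>)\<close> and \<open>det (R\<^sub>\<mu> T\<^sub>Y T\<^sub>X\<^sup>T C\<^sub>\<nu>)\<close>. The matrices \<open>T\<^sub>X\<^sup>T\<close> and
  \<open>T\<^sub>Y\<close> commute up to corrections of rank one, one for each variable \<open>y\<^sub>j\<close>, which only contribute the
  Cauchy kernel. Replacing \<open>\<lambda>\<close> by its conjugate replaces \<open>Y(t)\<close> by \<open>1/Y(-t)\<close> and exchanges the two
  parameter sequences (an instance of Jacobi's complementary minor formula); this gives the other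
  three identities. All limits are taken modulo the monomials that do not divide a fixed one.\<close>

section \<open>Determinants and the Cauchy--Binet formula\<close>

no_notation vec_index (infixl "$" 100)
unbundle fps_syntax

text \<open>All matrices are cut off at indices below \<open>N = l + m\<close>. Products of lower
  triangular Toeplitz matrices survive this exactly, but products with the transposed one do not:
  the lost terms vanish modulo a monomial only for partitions that stay away from the upper edge of
  the box. Larger partitions are discarded separately, because \<open>G\<close> of \<open>p\<close>
  and \<open>q\<close> has order at least the difference of their weights. The rank-one correction
  can be absorbed only if the lowest \<open>n\<close> unit vectors lie in the row span of
  \<open>R\<close>, which holds when the last \<open>n\<close> rows belong to zero parts. Hence the
  number \<open>l\<close> of rows must exceed the length of the partition by the number
  \<open>n\<close> of variables, and the stability of all functions in \<open>l\<close> and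
  \<open>n\<close> has to be controlled uniformly. Orthogonality and the complementary minor formula
  rest on degree counts that fall short by exactly one: for \<open>i \<le> j\<close> the series
  \<open>hfps a i * efps a j\<close> is a polynomial of degree at most \<open>j - i\<close>, and the
  products of such polynomials that occur never reach the distance of the two positions
  involved.\<close>

definition fdet :: "nat \<Rightarrow> (nat \<Rightarrow> nat \<Rightarrow> 'a::comm_ring_1) \<Rightarrow> 'a" where
  "fdet n f = det (mat n n (\<lambda>(i, j). f i j))"

lemma fdet_cong: "(\<And>i j. i < n \<Longrightarrow> j < n \<Longrightarrow> f i j = g i j) \<Longrightarrow> fdet n f = fdet n g"
  unfolding fdet_def by (intro arg_cong[of _ _ det] cong_mat) auto

lemma fdet_leibniz:
  "fdet n f = (\<Sum>p | p permutes {0..<n}. signof p * (\<Prod>i=0..<n. f i (p i)))"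
proof -
  have "(\<Prod>i=0..<n. mat n n (\<lambda>(i, j). f i j) $$ (i, p i)) = (\<Prod>i=0..<n. f i (p i))"
    if "p permutes {0..<n}" for p
    using that by (intro prod.cong) (auto dest: permutes_in_image)
  then show ?thesis
    unfolding fdet_def by (subst det_def'[of _ n]) auto
qed

lemma fdet_transpose: "fdet n (\<lambda>i j. f j i) = fdet n f"
proof -
  have "mat n n (\<lambda>(i, j). f j i) = transpose_mat (mat n n (\<lambda>(i, j). f i j))"
    by (rule eq_matI) auto
  then show ?thesis
    unfolding fdet_def by (simp add: det_transpose[of _ n])
qed

lemma fdet_mult: "fdet n (\<lambda>i j. \<Sum>k<n. f i k * g k j) = fdet n f * fdet n g"
proof -
  have "mat n n (\<lambda>(i, j). \<Sum>k<n. f i k * g k j) = mat n n (\<lambda>(i, j). f i j) * mat n n (\<lambda>(i, j). g i j)"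
    by (rule eq_matI) (auto simp: scalar_prod_def lessThan_atLeast0)
  then show ?thesis
    unfolding fdet_def by (simp add: det_mult[of _ n])
qed

lemma fdet_permute_rows:
  assumes "p permutes {0..<n}"
  shows "fdet n (\<lambda>i j. f (p i) j) = signof p * fdet n f"
proof -
  have "fdet n (\<lambda>i j. f (p i) j) = det (mat n n (\<lambda>(i, j). mat n n (\<lambda>(i, j). f i j) $$ (p i, j)))"
    unfolding fdet_def using permutes_in_image[OF assms]
    by (intro arg_cong[of _ _ det] cong_mat) auto
  also have "\<dots> = signof p * fdet n f"
    unfolding fdet_def by (rule det_permute_rows) (use assms in auto)
  finally show ?thesis .
qed

lemma fdet_identical_rows:
  assumes "i < n" "j < n" "i \<noteq> j" "\<And>k. k < n \<Longrightarrow> f i k = f j k"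
  shows "fdet n f = 0"
  unfolding fdet_def using assms by (intro det_identical_rows[of _ n i j]) (auto intro!: eq_vecI)

lemma fdet_upper_triangular:
  assumes "\<And>i j. j < i \<Longrightarrow> i < n \<Longrightarrow> f i j = 0"
  shows "fdet n f = (\<Prod>i<n. f i i)"
proof -
  have "fdet n f = prod_list (diag_mat (mat n n (\<lambda>(i, j). f i j)))"
    unfolding fdet_def using assms by (intro det_upper_triangular[of _ n]) auto
  also have "\<dots> = (\<Prod>i<n. f i i)"
    by (simp add: prod_list_diag_prod lessThan_atLeast0)
  finally show ?thesis .
qed

lemma fdet_lower_triangular:
  assumes "\<And>i j. i < j \<Longrightarrow> j < n \<Longrightarrow> f i j = 0"
  shows "fdet n f = (\<Prod>i<n. f i i)"
  using fdet_upper_triangular[of n "\<lambda>i j. f j i"] fdet_transpose[of n f] assms by simp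

lemma fdet_last_col:
  assumes "\<And>i. i < n \<Longrightarrow> f i n = 0"
  shows "fdet (Suc n) f = fdet n f * f n n"
proof -
  let ?A = "mat n n (\<lambda>(i, j). f i j)" and ?B = "mat 1 n (\<lambda>(i, j). f n j)"
    and ?C = "mat 1 1 (\<lambda>(i, j). f n n)"
  have "mat (Suc n) (Suc n) (\<lambda>(i, j). f i j) = four_block_mat ?A (0\<^sub>m n 1) ?B ?C"
    using assms by (intro eq_matI) (auto simp: less_Suc_eq)
  then show ?thesis
    unfolding fdet_def by (simp add: det_four_block_mat_upper_right_zero_col[of _ n] det_single)
qed

lemma fdet_last_row:
  assumes "\<And>j. j < n \<Longrightarrow> f n j = 0"
  shows "fdet (Suc n) f = fdet n f * f n n"
  using fdet_last_col[of n "\<lambda>i j. f j i"] fdet_transpose[of n f] fdet_transpose[of "Suc n" f] assms by simp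

lemma fdet_first_col:
  assumes "\<And>i. i < n \<Longrightarrow> f (Suc i) 0 = 0"
  shows "fdet (Suc n) f = f 0 0 * fdet n (\<lambda>i j. f (Suc i) (Suc j))"
proof -
  let ?A = "mat 1 1 (\<lambda>(i, j). f 0 0)" and ?B = "mat 1 n (\<lambda>(i, j). f 0 (Suc j))"
    and ?D = "mat n n (\<lambda>(i, j). f (Suc i) (Suc j))"
  have "mat (Suc n) (Suc n) (\<lambda>(i, j). f i j) = four_block_mat ?A ?B (0\<^sub>m n 1) ?D"
    using assms by (intro eq_matI) (auto simp: less_Suc_eq_0_disj)
  then show ?thesis
    unfolding fdet_def by (simp add: det_four_block_mat_lower_left_zero_col[of _ _ n] det_single)
qed

text \<open>The columns from \<open>l\<close> on are zero above the diagonal and 1 on it, so they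
  are expanded away one at a time, starting from the last.\<close>

lemma fdet_leading_block:
  assumes "\<And>i j. l \<le> j \<Longrightarrow> j < l + m \<Longrightarrow> i < j \<Longrightarrow> f i j = 0"
    and "\<And>j. l \<le> j \<Longrightarrow> j < l + m \<Longrightarrow> f j j = 1"
  shows "fdet (l + m) f = fdet l f"
  using assms
proof (induction m)
  case (Suc m)
  then have "fdet (Suc (l + m)) f = fdet (l + m) f * f (l + m) (l + m)"
    by (intro fdet_last_col) auto
  with Suc show ?case
    by simp
qed simp

text \<open>Mirror image of the previous situation: the first \<open>l\<close> columns are expanded
  away from the front, which leaves the lower right block.\<close>

lemma fdet_trailing_block:
  assumes "\<And>i j. j < l \<Longrightarrow> j < i \<Longrightarrow> i < l + m \<Longrightarrow> f i j = 0"
    and "\<And>j. j < l \<Longrightarrow> f j j = 1"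
  shows "fdet (l + m) f = fdet m (\<lambda>i j. f (l + i) (l + j))"
  using assms
proof (induction l arbitrary: f)
  case (Suc l)
  have "fdet (Suc (l + m)) f = f 0 0 * fdet (l + m) (\<lambda>i j. f (Suc i) (Suc j))"
    using Suc.prems by (intro fdet_first_col) auto
  also have "fdet (l + m) (\<lambda>i j. f (Suc i) (Suc j)) = fdet m (\<lambda>i j. f (Suc (l + i)) (Suc (l + j)))"
    using Suc.prems by (intro Suc.IH) auto
  finally show ?case
    using Suc.prems by simp
qed simp

text \<open>Pigeonhole: the \<open>k + 1\<close> rows \<open>0..k\<close> are supported on only
  \<open>k\<close> columns, so every Leibniz term meets a zero.\<close>

lemma fdet_zero_block:
  assumes "k < n" "\<And>i j. i \<le> k \<Longrightarrow> k \<le> j \<Longrightarrow> j < n \<Longrightarrow> f i j = 0"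
  shows "fdet n f = 0"
proof -
  have "(\<Prod>i=0..<n. f i (p i)) = 0" if p: "p permutes {0..<n}" for p
  proof -
    have "\<exists>i\<le>k. k \<le> p i"
    proof (rule ccontr)
      assume "\<not> ?thesis"
      then have "p ` {..k} \<subseteq> {..<k}"
        by force
      then have "card (p ` {..k}) \<le> card {..<k}"
        by (intro card_mono) auto
      moreover have "card (p ` {..k}) = Suc k"
        using permutes_inj_on[OF p] by (subst card_image) auto
      ultimately show False
        by simp
    qed
    then obtain i where "i \<le> k" "k \<le> p i"
      by blast
    then show ?thesis
      using assms permutes_in_image[OF p, of i] by (intro prod_zero) (auto intro!: bexI[of _ i])
  qed
  then show ?thesis
    unfolding fdet_leibniz by (intro sum.neutral) auto
qed

text \<open>The matrix determinant lemma, proved without division by bordering: in block form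
  \<open>P = (I - uv, u; 0, 1)\<close>, \<open>Q = (I, 0; v, 1)\<close> and
  \<open>R = (I, u; 0, 1 - vu)\<close> satisfy \<open>P Q = Q R\<close>, and \<open>Q\<close> has
  determinant 1.\<close>

lemma fdet_id_minus_rank_one:
  "fdet n (\<lambda>i j. of_bool (i = j) - u i * v j) = 1 - (\<Sum>i<n. v i * u i)"
proof -
  define P where "P i j = (if i < n then if j < n then of_bool (i = j) - u i * v j else u i else of_bool (j = n))" for i j
  define Q where "Q i j = (if i < n then of_bool (i = j) else if j < n then v j else 1)" for i j :: nat
  define R where "R i j = (if i < n then if j < n then of_bool (i = j) else u i
    else if j < n then 0 else 1 - (\<Sum>i<n. v i * u i))" for i j
  have "fdet (Suc n) P = fdet n (\<lambda>i j. of_bool (i = j) - u i * v j)"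
    by (subst fdet_last_row) (auto simp: P_def intro!: fdet_cong)
  moreover have "fdet (Suc n) Q = 1"
    by (subst fdet_lower_triangular) (auto simp: Q_def)
  moreover have "fdet (Suc n) R = 1 - (\<Sum>i<n. v i * u i)"
    by (subst fdet_upper_triangular) (auto simp: R_def)
  moreover have "fdet (Suc n) P * fdet (Suc n) Q = fdet (Suc n) Q * fdet (Suc n) R"
    unfolding fdet_mult[symmetric]
  proof (rule fdet_cong)
    fix i j assume "i < Suc n" "j < Suc n"
    then consider "i < n" "j < n" | "i < n" "j = n" | "i = n" "j < n" | "i = n" "j = n"
      by linarith
    then show "(\<Sum>k<Suc n. P i k * Q k j) = (\<Sum>k<Suc n. Q i k * R k j)"
    proof cases
      case 1
      have "(\<Sum>k<n. P i k * Q k j) = (\<Sum>k<n. if k = j then P i j else 0)"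
        by (intro sum.cong) (auto simp: Q_def)
      moreover have "(\<Sum>k<n. Q i k * R k j) = (\<Sum>k<n. if k = i then R i j else 0)"
        using 1 by (intro sum.cong) (auto simp: Q_def)
      ultimately show ?thesis using 1 by (simp add: P_def Q_def R_def)
    next
      case 2
      have "(\<Sum>k<n. P i k * Q k j) = 0"
        using 2 by (intro sum.neutral) (auto simp: Q_def)
      moreover have "(\<Sum>k<n. Q i k * R k j) = (\<Sum>k<n. if k = i then R i j else 0)"
        using 2 by (intro sum.cong) (auto simp: Q_def)
      ultimately show ?thesis using 2 by (simp add: P_def Q_def R_def)
    next
      case 3
      have "(\<Sum>k<n. P i k * Q k j) = 0"
        using 3 by (intro sum.neutral) (auto simp: P_def)
      moreover have "(\<Sum>k<n. Q i k * R k j) = (\<Sum>k<n. if k = j then v j else 0)"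
        using 3 by (intro sum.cong) (auto simp: Q_def R_def)
      ultimately show ?thesis using 3 by (simp add: P_def Q_def R_def)
    next
      case 4
      have "(\<Sum>k<n. P i k * Q k j) = 0"
        using 4 by (intro sum.neutral) (auto simp: P_def)
      moreover have "(\<Sum>k<n. Q i k * R k j) = (\<Sum>k<n. v k * u k)"
        using 4 by (intro sum.cong) (auto simp: Q_def R_def)
      ultimately show ?thesis using 4 by (simp add: P_def Q_def R_def)
    qed
  qed
  ultimately show ?thesis
    by simp
qed

text \<open>Since \<open>det A * det B = 1\<close>, the adjugate of \<open>A\<close> times
  \<open>det B\<close> is a left inverse of \<open>A\<close> and must equal \<open>B\<close>. The
  index type is arbitrary because partitions will serve as indices.\<close>

lemma left_inverse_imp_right_inverse:
  fixes P Q :: "'i \<Rightarrow> 'i \<Rightarrow> 'a::comm_ring_1"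
  assumes fin: "finite S"
    and PQ: "\<And>i j. i \<in> S \<Longrightarrow> j \<in> S \<Longrightarrow> (\<Sum>k\<in>S. P i k * Q k j) = of_bool (i = j)"
    and "i \<in> S" "j \<in> S"
  shows "(\<Sum>k\<in>S. Q i k * P k j) = of_bool (i = j)"
proof -
  define n where "n = card S"
  obtain e where e: "bij_betw e {0..<n} S"
    using ex_bij_betw_nat_finite[OF fin] by (auto simp: n_def)
  define A where "A = mat n n (\<lambda>(i, j). P (e i) (e j))"
  define B where "B = mat n n (\<lambda>(i, j). Q (e i) (e j))"
  have AB [simp]: "A \<in> carrier_mat n n" "B \<in> carrier_mat n n"
    by (auto simp: A_def B_def)
  have inj: "e a = e b \<longleftrightarrow> a = b" if "a < n" "b < n" for a b
    using that bij_betw_imp_inj_on[OF e] by (auto simp: inj_on_def)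
  have mem: "e a \<in> S" if "a < n" for a
    using that bij_betw_apply[OF e] by auto
  have prod1: "A * B = 1\<^sub>m n"
    using PQ[OF mem mem]
    by (intro eq_matI)
      (auto simp: A_def B_def scalar_prod_def sum.reindex_bij_betw[OF e, symmetric] inj)
  have "det A * det B = 1"
    using prod1 det_mult[of A n B] by simp
  define C where "C = det B \<cdot>\<^sub>m adj_mat A"
  have C: "C \<in> carrier_mat n n"
    using adj_mat[of A n] by (auto simp: C_def)
  have "C * A = det B \<cdot>\<^sub>m (adj_mat A * A)"
    unfolding C_def using adj_mat[of A n] by (intro mult_smult_assoc_mat[of _ n n _ n]) auto
  also have "\<dots> = (det B * det A) \<cdot>\<^sub>m 1\<^sub>m n"
    using adj_mat[of A n] by (auto intro!: eq_matI)
  finally have CA: "C * A = 1\<^sub>m n"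
    using \<open>det A * det B = 1\<close> by (auto simp: mult.commute intro!: eq_matI)
  have "C = C * (A * B)"
    using C by (simp add: prod1)
  also have "\<dots> = (C * A) * B"
    using C by (simp add: assoc_mult_mat[of C n n A n B n])
  finally have "C = B"
    using CA left_mult_one_mat[of B n n] by simp
  then have "B * A = 1\<^sub>m n"
    using CA by simp
  then have BA: "(B * A) $$ (a, b) = of_bool (a = b)" if "a < n" "b < n" for a b
    using that by simp
  obtain a b where ab: "a < n" "b < n" "i = e a" "j = e b"
    using assms(3,4) bij_betw_imp_surj_on[OF e] by (metis atLeastLessThan_iff imageE)
  have "(\<Sum>k\<in>S. Q i k * P k j) = (B * A) $$ (a, b)"
    using ab by (simp add: A_def B_def scalar_prod_def sum.reindex_bij_betw[OF e, symmetric])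
  with BA[of a b] ab show ?thesis
    by (simp add: inj)
qed

section \<open>Partitions in a rectangle as subsets of an interval, and the Cauchy--Binet
  formula\<close>

definition box :: "nat \<Rightarrow> nat \<Rightarrow> (nat \<Rightarrow> nat) set" where
  "box l m = {p. antimono p \<and> (\<forall>i\<ge>l. p i = 0) \<and> p 0 \<le> m}"

text \<open>The positions of the particles in the Maya diagram of a partition with at most \<open>l\<close> rows.\<close>

definition pos :: "nat \<Rightarrow> (nat \<Rightarrow> nat) \<Rightarrow> nat \<Rightarrow> nat" where
  "pos l p i = p i + (l - Suc i)"

lemma box_le: "p \<in> box l m \<Longrightarrow> p i \<le> m"
  unfolding box_def by (auto dest: antimonoD[of p 0 i])

lemma finite_box: "finite (box l m)"
proof -
  have "box l m \<subseteq> (\<lambda>f i. if i < l then f i else 0) ` ({..<l} \<rightarrow>\<^sub>E {..m})"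
  proof
    fix p assume p: "p \<in> box l m"
    then have "p = (\<lambda>i. if i < l then restrict p {..<l} i else 0)"
      by (auto simp: box_def)
    moreover have "restrict p {..<l} \<in> {..<l} \<rightarrow>\<^sub>E {..m}"
      using box_le[OF p] by auto
    ultimately show "p \<in> (\<lambda>f i. if i < l then f i else 0) ` ({..<l} \<rightarrow>\<^sub>E {..m})"
      by blast
  qed
  then show ?thesis
    by (rule finite_subset) (auto intro!: finite_PiE)
qed

lemma pos_less:
  assumes "p \<in> box l m" "i < l"
  shows "pos l p i < l + m"
  using box_le[OF assms(1), of i] assms(2) by (simp add: pos_def)

lemma pos_strict_antimono:
  assumes "antimono p" "i < j" "j < l"
  shows "pos l p j < pos l p i"
  using assms(2,3) antimonoD[OF assms(1), of i j] by (simp add: pos_def)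

lemma pos_inj_on:
  assumes "antimono p"
  shows "inj_on (pos l p) {0..<l}"
  by (rule linorder_inj_onI') (use pos_strict_antimono[OF assms] in fastforce)

text \<open>The positions are strictly decreasing in the row index, so their set determines
  them.\<close>

lemma pos_image_inj:
  assumes p: "p \<in> box l m" and q: "q \<in> box l m"
    and eq: "pos l p ` {0..<l} = pos l q ` {0..<l}"
  shows "p = q"
proof -
  have *: "sorted_wrt (<) (map (pos l p) (rev [0..<l]))" if "p \<in> box l m" for p
  proof -
    have "antimono p"
      using that by (auto simp: box_def)
    then show ?thesis
      by (auto simp: sorted_wrt_map sorted_wrt_rev sorted_wrt_iff_nth_less rev_nth pos_strict_antimono)
  qed
  have "map (pos l p) (rev [0..<l]) = map (pos l q) (rev [0..<l])"
    using *[OF p] *[OF q] eq by (intro strict_sorted_equal) auto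
  then have "pos l p i = pos l q i" if "i < l" for i
    using that by auto
  then have "p i = q i" if "i < l" for i
    using that unfolding pos_def by (metis add_right_cancel)
  moreover have "p i = q i" if "i \<ge> l" for i
    using that p q by (simp add: box_def)
  ultimately show ?thesis
    by (metis ext not_le)
qed

text \<open>Listing \<open>K\<close> increasingly and subtracting the staircase gives a weakly
  increasing sequence, the parts in reverse order. Together with injectivity this lets the
  partitions in the box name the maximal minors in Cauchy--Binet.\<close>

lemma ex_box_of_subset:
  assumes K: "K \<subseteq> {..<l + m}" and card: "card K = l"
  shows "\<exists>p\<in>box l m. pos l p ` {0..<l} = K"
proof -
  have fin: "finite K"
    using K finite_subset by blast
  define xs where "xs = sorted_list_of_set K"
  have xs: "sorted_wrt (<) xs" "set xs = K" "length xs = l"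
    using fin card by (auto simp: xs_def)
  have less: "xs ! i < xs ! j" if "i < j" "j < l" for i j
    using that xs sorted_wrt_nth_less by blast
  have ge: "xs ! i + (j - i) \<le> xs ! j" if "i \<le> j" "j < l" for i j
    using that
  proof (induction j rule: dec_induct)
    case (step j)
    then show ?case
      using less[of j "Suc j"] by fastforce
  qed auto
  have ub: "xs ! i < l + m" if "i < l" for i
    using that K xs nth_mem by blast
  define p where "p i = (if i < l then xs ! (l - Suc i) - (l - Suc i) else 0)" for i
  have lb: "i \<le> xs ! i" if "i < l" for i
    using ge[of 0 i] that by simp
  have pos: "pos l p i = xs ! (l - Suc i)" if "i < l" for i
    using that lb[of "l - Suc i"] by (simp add: pos_def p_def)
  have "antimono p"
  proof (rule antimonoI)
    fix i j :: nat assume "i \<le> j"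
    show "p j \<le> p i"
    proof (cases "j < l")
      case True
      then have "xs ! (l - Suc j) + (j - i) \<le> xs ! (l - Suc i)"
        using ge[of "l - Suc j" "l - Suc i"] \<open>i \<le> j\<close> by simp
      then show ?thesis
        using True \<open>i \<le> j\<close> lb[of "l - Suc j"] by (simp add: p_def)
    qed (simp add: p_def)
  qed
  moreover have "p 0 \<le> m"
    using ub[of "l - 1"] by (auto simp: p_def)
  ultimately have "p \<in> box l m"
    by (auto simp: box_def p_def)
  moreover have "pos l p ` {0..<l} = K"
  proof -
    have "(\<lambda>i. l - Suc i) ` {0..<l} = {0..<l}"
    proof (rule equalityI, force, rule subsetI)
      fix x assume "x \<in> {0..<l}"
      then show "x \<in> (\<lambda>i. l - Suc i) ` {0..<l}"
        by (intro image_eqI[of _ _ "l - Suc x"]) auto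
    qed
    then have "pos l p ` {0..<l} = (!) xs ` {0..<l}"
      using pos by (metis (no_types, lifting) atLeastLessThan_iff image_cong image_image)
    also have "\<dots> = K"
      using xs by (metis atLeastLessThan_upt list.set_map map_nth)
    finally show ?thesis .
  qed
  ultimately show ?thesis
    by blast
qed

lemma cauchy_binet:
  fixes a b :: "nat \<Rightarrow> nat \<Rightarrow> 'a::comm_ring_1"
  shows "fdet l (\<lambda>i j. \<Sum>p<l + m. a i p * b p j) =
    (\<Sum>q\<in>box l m. fdet l (\<lambda>i j. a i (pos l q j)) * fdet l (\<lambda>i j. b (pos l q i) j))"
proof -
  let ?P = "{\<pi>. \<pi> permutes {0..<l}}"
  let ?F = "{0..<l} \<rightarrow>\<^sub>E {..<l + m}"
  let ?t = "\<lambda>f. (\<Prod>i=0..<l. a i (f i)) * fdet l (\<lambda>i j. b (f i) j)"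
  have finF: "finite ?F"
    by (auto intro: finite_PiE)
  have "fdet l (\<lambda>i j. \<Sum>p<l + m. a i p * b p j) =
    (\<Sum>\<pi>\<in>?P. signof \<pi> * (\<Sum>f\<in>?F. \<Prod>i=0..<l. a i (f i) * b (f i) (\<pi> i)))"
    unfolding fdet_leibniz by (subst prod_sum_PiE) auto
  also have "\<dots> = (\<Sum>f\<in>?F. ?t f)"
    unfolding fdet_leibniz sum_distrib_left prod.distrib
    by (subst sum.swap) (simp add: mult_ac)
  \<comment> \<open>A function with a repeated value produces a determinant with two equal
    rows.\<close>
  also have "\<dots> = (\<Sum>f\<in>{f\<in>?F. inj_on f {0..<l}}. ?t f)"
  proof (rule sum.mono_neutral_right)
    show "\<forall>f\<in>?F - {f \<in> ?F. inj_on f {0..<l}}. ?t f = 0"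
    proof
      fix f assume "f \<in> ?F - {f \<in> ?F. inj_on f {0..<l}}"
      then obtain i j where "i < l" "j < l" "i \<noteq> j" "f i = f j"
        by (auto simp: inj_on_def)
      then show "?t f = 0"
        using fdet_identical_rows[of i l j "\<lambda>i j. b (f i) j"] by simp
    qed
  qed (use finF in auto)
  \<comment> \<open>An injective \<open>f\<close> is, in a unique way, a permutation followed by the
    decreasing enumeration of its image, and that enumeration is \<open>pos l q\<close> for a unique
    \<open>q\<close> in the box.\<close>
  also have "\<dots> = (\<Sum>(q, \<pi>)\<in>box l m \<times> ?P. ?t (restrict (pos l q \<circ> \<pi>) {0..<l}))"
  proof (rule sym, unfold case_prod_unfold, rule sum.reindex_bij_betw)
    let ?g = "\<lambda>x. restrict (pos l (fst x) \<circ> snd x) {0..<l}"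
    show "bij_betw ?g (box l m \<times> ?P) {f \<in> ?F. inj_on f {0..<l}}"
    proof (rule bij_betwI')
      fix x y assume x: "x \<in> box l m \<times> ?P" and y: "y \<in> box l m \<times> ?P"
      obtain q \<pi> q' \<pi>' where xy: "x = (q, \<pi>)" "y = (q', \<pi>')"
        by (metis surj_pair)
      have q: "q \<in> box l m" "q' \<in> box l m" and \<pi>: "\<pi> permutes {0..<l}" "\<pi>' permutes {0..<l}"
        using x y xy by auto
      show "?g x = ?g y \<longleftrightarrow> x = y"
      proof
        assume eq: "?g x = ?g y"
        have e: "pos l q (\<pi> i) = pos l q' (\<pi>' i)" if "i < l" for i
          using fun_cong[OF eq, of i] that xy by simp
        have "pos l q ` \<pi> ` {0..<l} = pos l q' ` \<pi>' ` {0..<l}"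
          unfolding image_image using e by (intro image_cong) auto
        then have "pos l q ` {0..<l} = pos l q' ` {0..<l}"
          using \<pi> by (simp add: permutes_image)
        then have qq: "q = q'"
          by (rule pos_image_inj[OF q])
        have "antimono q"
          using q by (simp add: box_def)
        have "\<pi> i = \<pi>' i" for i
        proof (cases "i < l")
          case True
          then show ?thesis
            using inj_onD[OF pos_inj_on[OF \<open>antimono q\<close>], of l "\<pi> i" "\<pi>' i"] e[of i] qq
              permutes_in_image[OF \<pi>(1), of i] permutes_in_image[OF \<pi>(2), of i] by auto
        next
          case False
          then show ?thesis
            using \<pi> by (simp add: permutes_def)
        qed
        then show "x = y"
          using qq xy by auto
      qed auto
    next
      fix x assume x: "x \<in> box l m \<times> ?P"
      obtain q \<pi> where xy: "x = (q, \<pi>)"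
        by (metis surj_pair)
      have q: "q \<in> box l m" and \<pi>: "\<pi> permutes {0..<l}"
        using x xy by auto
      have "antimono q"
        using q by (simp add: box_def)
      then have "inj_on (pos l q \<circ> \<pi>) {0..<l}"
        using \<pi> by (intro comp_inj_on) (auto simp: permutes_image permutes_inj_on pos_inj_on)
      moreover have "?g x \<in> ?F"
        using pos_less[OF q] permutes_in_image[OF \<pi>] xy by auto
      ultimately show "?g x \<in> {f \<in> ?F. inj_on f {0..<l}}"
        using xy by (auto simp: inj_on_def)
    next
      fix f assume f: "f \<in> {f \<in> ?F. inj_on f {0..<l}}"
      then have "f ` {0..<l} \<subseteq> {..<l + m}" "card (f ` {0..<l}) = l"
        by (auto simp: card_image)
      then obtain q where q: "q \<in> box l m" "pos l q ` {0..<l} = f ` {0..<l}"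
        using ex_box_of_subset by blast
      have "antimono q"
        using q by (simp add: box_def)
      define s where "s = the_inv_into {0..<l} (pos l q)"
      have s: "bij_betw s (f ` {0..<l}) {0..<l}" and s': "\<And>x. x \<in> f ` {0..<l} \<Longrightarrow> pos l q (s x) = x"
        unfolding s_def using pos_inj_on[OF \<open>antimono q\<close>, of l] q(2)
        by (metis bij_betw_imageI bij_betw_the_inv_into, metis f_the_inv_into_f)
      define \<pi> where "\<pi> i = (if i < l then s (f i) else i)" for i
      have "bij_betw (s \<circ> f) {0..<l} {0..<l}"
        using f by (intro bij_betw_trans[OF _ s]) (auto simp: bij_betw_def)
      then have "bij_betw \<pi> {0..<l} {0..<l}"
        by (rule iffD1[OF bij_betw_cong, rotated]) (auto simp: \<pi>_def)
      then have "\<pi> permutes {0..<l}"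
        by (rule bij_imp_permutes) (auto simp: \<pi>_def)
      moreover have "f = ?g (q, \<pi>)"
        using f s' by (auto simp: \<pi>_def PiE_def extensional_def restrict_def)
      ultimately show "\<exists>x\<in>box l m \<times> ?P. f = ?g x"
        using q by blast
    qed
  qed
  also have "\<dots> = (\<Sum>(q, \<pi>)\<in>box l m \<times> ?P. (signof \<pi> * (\<Prod>i=0..<l. a i (pos l q (\<pi> i)))) *
      fdet l (\<lambda>i j. b (pos l q i) j))"
  proof (intro sum.cong refl, clarify)
    fix q \<pi> assume "\<pi> permutes {0..<l}"
    then have "fdet l (\<lambda>i j. b (pos l q (\<pi> i)) j) = signof \<pi> * fdet l (\<lambda>i j. b (pos l q i) j)"
      by (rule fdet_permute_rows)
    moreover have "fdet l (\<lambda>i. b (restrict (pos l q \<circ> \<pi>) {0..<l} i)) = fdet l (\<lambda>i j. b (pos l q (\<pi> i)) j)"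
      by (rule fdet_cong) auto
    ultimately show "?t (restrict (pos l q \<circ> \<pi>) {0..<l}) =
        (signof \<pi> * (\<Prod>i=0..<l. a i (pos l q (\<pi> i)))) * fdet l (\<lambda>i j. b (pos l q i) j)"
      by (simp add: mult_ac)
  qed
  also have "\<dots> = (\<Sum>q\<in>box l m. fdet l (\<lambda>i j. a i (pos l q j)) * fdet l (\<lambda>i j. b (pos l q i) j))"
    by (subst sum.cartesian_product[symmetric])
      (simp add: fdet_leibniz[of l "\<lambda>i j. a i (pos l _ j)"] sum_distrib_right)
  finally show ?thesis .
qed

section \<open>Congruences of power series\<close>

text \<open>Comparing the coefficients of all divisors of \<open>M\<close>, not only that of \<open>M\<close> itself, makes this
  a congruence of rings.\<close>

definition mcong :: "'v multiset \<Rightarrow> ('v, 'a::comm_ring_1) mps \<Rightarrow> ('v, 'a) mps \<Rightarrow> bool" where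
  "mcong M f g \<longleftrightarrow> (\<forall>A. A \<subseteq># M \<longrightarrow> mps_coeff f A = mps_coeff g A)"

text \<open>Order of vanishing at least \<open>k\<close> in total degree. Bounds of this kind make
  infinite sums finite modulo a monomial.\<close>

definition mord :: "nat \<Rightarrow> ('v, 'a::comm_ring_1) mps \<Rightarrow> bool" where
  "mord k f \<longleftrightarrow> (\<forall>A. size A < k \<longrightarrow> mps_coeff f A = 0)"

lemma mcong_refl [simp]: "mcong M f f"
  and mcong_sym: "mcong M f g \<Longrightarrow> mcong M g f"
  and mcong_trans [trans]: "mcong M f g \<Longrightarrow> mcong M g h \<Longrightarrow> mcong M f h"
  and mcong_subset: "mcong M f g \<Longrightarrow> A \<subseteq># M \<Longrightarrow> mcong A f g"
  by (auto simp: mcong_def intro: subset_mset.trans)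

lemma mcong_eqI: "(\<And>M. mcong M f g) \<Longrightarrow> f = g"
  by (rule mps_eqI) (auto simp: mcong_def)

lemma mcong_add: "mcong M f g \<Longrightarrow> mcong M f' g' \<Longrightarrow> mcong M (f + f') (g + g')"
  and mcong_diff: "mcong M f g \<Longrightarrow> mcong M f' g' \<Longrightarrow> mcong M (f - f') (g - g')"
  and mcong_uminus: "mcong M f g \<Longrightarrow> mcong M (- f) (- g)"
  by (auto simp: mcong_def plus_mps.rep_eq minus_mps.rep_eq uminus_mps.rep_eq)

lemma mcong_mult: 
  assumes "mcong M f g" "mcong M f' g'"
  shows "mcong M (f * f') (g * g')"
  unfolding mcong_def times_mps.rep_eq
proof (intro allI impI sum.cong refl, clarify)
  fix A B assume "A + B \<subseteq># M"
  then have "A \<subseteq># M" "B \<subseteq># M"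
    by (metis mset_subset_eq_add_left subset_mset.trans, metis mset_subset_eq_add_right subset_mset.trans)
  with assms show "mps_coeff f A * mps_coeff f' B = mps_coeff g A * mps_coeff g' B"
    by (simp add: mcong_def)
qed

lemma mcong_sum: "(\<And>i. i \<in> I \<Longrightarrow> mcong M (f i) (g i)) \<Longrightarrow> mcong M (sum f I) (sum g I)"
  by (induction I rule: infinite_finite_induct) (auto intro: mcong_add)

lemma mcong_prod: "(\<And>i. i \<in> I \<Longrightarrow> mcong M (f i) (g i)) \<Longrightarrow> mcong M (prod f I) (prod g I)"
  by (induction I rule: infinite_finite_induct) (auto intro: mcong_mult)

lemma mcong_sum_mono_neutral:
  assumes "finite T" "S \<subseteq> T" "\<And>i. i \<in> T - S \<Longrightarrow> mcong M (f i) 0"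
  shows "mcong M (sum f T) (sum f S)"
proof -
  have "mcong M (sum f (T - S)) (\<Sum>i\<in>T - S. 0)"
    using assms by (intro mcong_sum) auto
  then have "mcong M (sum f (T - S) + sum f S) (0 + sum f S)"
    by (intro mcong_add) auto
  then show ?thesis
    using assms by (simp add: sum.subset_diff[OF assms(2,1)])
qed

lemma mcong_mult_zero: "mcong M f 0 \<Longrightarrow> mcong M (f * g) 0" "mcong M g 0 \<Longrightarrow> mcong M (f * g) 0"
  using mcong_mult[of M f 0 g g] mcong_mult[of M f f g 0] by auto

lemma mcong_fdet:
  "(\<And>i j. i < n \<Longrightarrow> j < n \<Longrightarrow> mcong M (f i j) (g i j)) \<Longrightarrow> mcong M (fdet n f) (fdet n g)"
  unfolding fdet_leibniz
  by (intro mcong_sum mcong_mult mcong_prod) (auto dest: permutes_in_image)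

lemma mord_0 [simp]: "mord 0 f" "mord k 0"
  by (auto simp: mord_def zero_mps.rep_eq)

lemma mord_mono: "mord k f \<Longrightarrow> j \<le> k \<Longrightarrow> mord j f"
  by (auto simp: mord_def)

lemma mord_add: "mord k f \<Longrightarrow> mord k g \<Longrightarrow> mord k (f + g)"
  and mord_uminus: "mord k f \<Longrightarrow> mord k (- f)"
  by (auto simp: mord_def plus_mps.rep_eq minus_mps.rep_eq uminus_mps.rep_eq)

lemma mord_mult:
  assumes "mord j f" "mord k g"
  shows "mord (j + k) (f * g)"
  unfolding mord_def times_mps.rep_eq
proof (intro allI impI sum.neutral, clarify)
  fix A B :: "'a multiset" assume "size (A + B) < j + k"
  then have "size A < j \<or> size B < k"
    by auto
  with assms show "mps_coeff f A * mps_coeff g B = 0"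
    by (auto simp: mord_def)
qed

lemma mord_sum: "(\<And>i. i \<in> I \<Longrightarrow> mord k (f i)) \<Longrightarrow> mord k (sum f I)"
  by (induction I rule: infinite_finite_induct) (auto intro: mord_add)

lemma mord_prod: "(\<And>i. i \<in> I \<Longrightarrow> mord (d i) (f i)) \<Longrightarrow> mord (sum d I) (prod f I)"
  by (induction I rule: infinite_finite_induct) (auto intro: mord_mult)

lemma mord_power: "mord 1 f \<Longrightarrow> mord k (f ^ k)"
  using mord_prod[of "{..<k}" "\<lambda>_. 1" "\<lambda>_. f"] by simp

lemma mcong_zero_of_mord: "mord k f \<Longrightarrow> size M < k \<Longrightarrow> mcong M f 0"
  unfolding mord_def mcong_def zero_mps.rep_eq by (meson le_less_trans size_mset_mono)

section \<open>Limits, infinite sums and inverses modulo a monomial\<close>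

lemma mps_tendsto_iff:
  "(f \<longlongrightarrow> L) F \<longleftrightarrow> (\<forall>M. \<forall>\<^sub>F i in F. mps_coeff (f i) M = mps_coeff L M)"
proof
  assume lim: "(f \<longlongrightarrow> L) F"
  show "\<forall>M. \<forall>\<^sub>F i in F. mps_coeff (f i) M = mps_coeff L M"
  proof
    fix M
    have "open {g. mps_coeff g M = mps_coeff L M}"
      unfolding open_mps_def by (auto intro!: exI[of _ "{M}"])
    from topological_tendstoD[OF lim this] show "\<forall>\<^sub>F i in F. mps_coeff (f i) M = mps_coeff L M"
      by simp
  qed
next
  assume ev: "\<forall>M. \<forall>\<^sub>F i in F. mps_coeff (f i) M = mps_coeff L M"
  show "(f \<longlongrightarrow> L) F"
  proof (rule topological_tendstoI)
    fix U assume "open U" "L \<in> U"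
    then obtain S where S: "finite S" "{g. \<forall>M\<in>S. mps_coeff g M = mps_coeff L M} \<subseteq> U"
      unfolding open_mps_def by blast
    have "\<forall>\<^sub>F i in F. \<forall>M\<in>S. mps_coeff (f i) M = mps_coeff L M"
      using S(1) ev by (intro eventually_ball_finite) auto
    then show "\<forall>\<^sub>F i in F. f i \<in> U"
      by eventually_elim (use S(2) in auto)
  qed
qed

lemma mps_coeff_Abs [simp]: "mps_coeff (Abs_mps c) M = c M"
  by (simp add: Abs_mps_inverse)

text \<open>The finite set may depend on the monomial; every larger finite partial sum has the same
  coefficients at all divisors of \<open>M\<close>.\<close>

lemma has_sum_mcongI:
  assumes "\<And>M. \<exists>F. finite F \<and> F \<subseteq> S \<and> (\<forall>i\<in>S - F. mcong M (f i) 0) \<and> mcong M (sum f F) s"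
  shows "(f has_sum s) S"
  unfolding has_sum_def mps_tendsto_iff
proof
  fix M
  obtain F where F: "finite F" "F \<subseteq> S" "\<forall>i\<in>S - F. mcong M (f i) 0" "mcong M (sum f F) s"
    using assms by blast
  show "\<forall>\<^sub>F X in finite_subsets_at_top S. mps_coeff (sum f X) M = mps_coeff s M"
    unfolding eventually_finite_subsets_at_top
  proof (intro exI[of _ F] conjI allI impI)
    fix X assume X: "finite X \<and> F \<subseteq> X \<and> X \<subseteq> S"
    then have "mcong M (sum f X) (sum f F)"
      using F by (intro mcong_sum_mono_neutral) auto
    then have "mcong M (sum f X) s"
      using F mcong_trans by blast
    then show "mps_coeff (sum f X) M = mps_coeff s M"
      by (simp add: mcong_def)
  qed (use F in auto)
qed

text \<open>The first assumption yields convergence to a series whose coefficient at each monomial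
  is read off from a finite set adapted to it. Any other admissible finite set gives the same
  coefficients, as comparison with the union shows.\<close>

lemma infsum_mcong:
  assumes ex: "\<And>M. \<exists>F. finite F \<and> F \<subseteq> S \<and> (\<forall>i\<in>S - F. mcong M (f i) 0)"
    and F: "finite F" "F \<subseteq> S" "\<And>i. i \<in> S - F \<Longrightarrow> mcong M (f i) 0"
  shows "mcong M (infsum f S) (sum f F)"
proof -
  obtain E where E: "finite (E M)" "E M \<subseteq> S" "\<And>i. i \<in> S - E M \<Longrightarrow> mcong M (f i) 0" for M
    using ex by metis
  define s where "s = Abs_mps (\<lambda>M. mps_coeff (sum f (E M)) M)"
  have s: "mcong M s (sum f F)" if F: "finite F" "F \<subseteq> S" "\<And>i. i \<in> S - F \<Longrightarrow> mcong M (f i) 0" for M F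
    unfolding mcong_def
  proof (intro allI impI)
    fix A assume A: "A \<subseteq># M"
    have "mcong A (sum f (F \<union> E A)) (sum f (E A))"
      using F E by (intro mcong_sum_mono_neutral) auto
    moreover have "mcong M (sum f (F \<union> E A)) (sum f F)"
      using F E(1) by (intro mcong_sum_mono_neutral) (auto dest: subsetD[OF E(2)])
    then have "mcong A (sum f (F \<union> E A)) (sum f F)"
      using A by (rule mcong_subset)
    ultimately show "mps_coeff s A = mps_coeff (sum f F) A"
      by (simp add: mcong_def s_def)
  qed
  have "(f has_sum s) S"
    by (rule has_sum_mcongI) (meson E mcong_sym s)
  then have "infsum f S = s"
    by (rule infsumI)
  with s[OF F] show ?thesis
    by simp
qed

text \<open>Convergence enters as stabilization modulo every monomial; the threshold
  \<open>n0\<close> for one \<open>M\<close> then tells from where on the sequence may stand for its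
  limit.\<close>

lemma lim_mcong:
  fixes f :: "nat \<Rightarrow> ('v, 'a::comm_ring_1) mps"
  assumes ex: "\<And>M. \<exists>n0. \<forall>n\<ge>n0. mcong M (f n) (f n0)"
    and n0: "\<And>n. n \<ge> n0 \<Longrightarrow> mcong M (f n) (f n0)" and "n \<ge> n0"
  shows "mcong M (lim f) (f n)"
proof -
  obtain k where k: "n \<ge> k M \<Longrightarrow> mcong M (f n) (f (k M))" for M n
    using ex by metis
  define L where "L = Abs_mps (\<lambda>M. mps_coeff (f (k M)) M)"
  have "f \<longlonglongrightarrow> L"
    unfolding mps_tendsto_iff eventually_sequentially L_def
    using k by (auto simp: mcong_def)
  then have "lim f = L"
    by (rule limI)
  moreover have "mcong M L (f n)"
    unfolding mcong_def
  proof (intro allI impI)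
    fix A assume A: "A \<subseteq># M"
    define n' where "n' = max n (k A)"
    have "mcong A (f n') (f (k A))"
      by (rule k) (simp add: n'_def)
    moreover have "mcong M (f n') (f n0)" "mcong M (f n) (f n0)"
      using assms(3) by (auto intro: n0 simp: n'_def)
    ultimately show "mps_coeff L A = mps_coeff (f n) A"
      using A by (simp add: mcong_def L_def)
  qed
  ultimately show ?thesis
    by simp
qed

lemma ring_inv_eqI:
  fixes a :: "'r::comm_ring_1"
  assumes "a * b = 1"
  shows "ring_inv a = b"
  unfolding ring_inv_def
proof (rule the_equality)
  fix c assume "a * c = 1"
  then have "b = b * (a * c)"
    by simp
  also have "\<dots> = c"
    using assms by (simp add: mult_ac flip: mult.assoc)
  finally show "c = b" ..
qed (fact assms)

lemma mult_ring_inv: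
  fixes v :: "('v, 'a::comm_ring_1) mps"
  assumes v: "mord 1 v"
  shows "(1 - v) * ring_inv (1 - v) = 1"
proof -
  \<comment> \<open>The geometric series, coefficient by coefficient: \<open>v ^ k\<close> has order
    at least \<open>k\<close>, so higher powers do not reach the coefficient at
    \<open>M\<close>.\<close>
  define b where "b = Abs_mps (\<lambda>M. mps_coeff (\<Sum>k<Suc (size M). v ^ k) M)"
  have "(1 - v) * b = 1"
  proof (rule mcong_eqI)
    fix M :: "'v multiset"
    have "mcong M b (\<Sum>k<Suc (size M). v ^ k)"
      unfolding mcong_def
    proof (intro allI impI)
      fix A assume A: "A \<subseteq># M"
      have "mcong A (\<Sum>k<Suc (size M). v ^ k) (\<Sum>k<Suc (size A). v ^ k)"
        using A v by (intro mcong_sum_mono_neutral)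
          (auto intro!: mcong_zero_of_mord mord_power dest: size_mset_mono)
      then show "mps_coeff b A = mps_coeff (\<Sum>k<Suc (size M). v ^ k) A"
        by (simp add: mcong_def b_def)
    qed
    then have "mcong M ((1 - v) * b) ((1 - v) * (\<Sum>k<Suc (size M). v ^ k))"
      by (intro mcong_mult) auto
    also have "(1 - v) * (\<Sum>k<Suc (size M). v ^ k) = 1 - v ^ Suc (size M)"
      by (rule one_diff_power_eq[symmetric])
    also have "mcong M (1 - v ^ Suc (size M)) (1 - 0)"
      using v by (intro mcong_diff mcong_zero_of_mord[OF mord_power]) auto
    finally show "mcong M ((1 - v) * b) 1"
      by simp
  qed
  then show ?thesis
    using ring_inv_eqI by metis
qed

text \<open>The coefficient of \<open>t^n\<close> has order at least \<open>n\<close> in the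
  underlying variables, as in generating series of letters without constant term. High powers of
  \<open>t\<close> are thus negligible modulo a monomial.\<close>

definition graded :: "('v, 'a::comm_ring_1) mps fps \<Rightarrow> bool" where
  "graded F \<longleftrightarrow> (\<forall>n. mord n (F $ n))"

definition fcong :: "'v multiset \<Rightarrow> ('v, 'a::comm_ring_1) mps fps \<Rightarrow> ('v, 'a) mps fps \<Rightarrow> bool" where
  "fcong M F G \<longleftrightarrow> (\<forall>n. mcong M (F $ n) (G $ n))"

text \<open>The series \<open>1/(1 - v t)\<close>; its inverse \<open>lin v\<close> is
  \<open>1 - v t\<close>.\<close>

definition geo :: "'r::comm_ring_1 \<Rightarrow> 'r fps" where
  "geo v = Abs_fps (\<lambda>n. v ^ n)"

definition lin :: "'r::comm_ring_1 \<Rightarrow> 'r fps" where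
  "lin v = Abs_fps (\<lambda>n. if n = 0 then 1 else if n = 1 then - v else 0)"

lemma geo_nth [simp]: "geo v $ n = v ^ n"
  and lin_nth: "lin v $ n = (if n = 0 then 1 else if n = 1 then - v else 0)"
  by (simp_all add: geo_def lin_def)

lemma lin_mult_nth: "(lin v * F) $ n = F $ n - (if n = 0 then 0 else v * F $ (n - 1))"
proof (cases n)
  case (Suc m)
  have "(\<Sum>i\<in>{0..n} - {0, 1}. lin v $ i * F $ (n - i)) = 0"
    by (intro sum.neutral) (auto simp: lin_nth)
  moreover have "(lin v * F) $ n =
      (\<Sum>i\<in>{0..n} - {0, 1}. lin v $ i * F $ (n - i)) + (\<Sum>i\<in>{0, 1}. lin v $ i * F $ (n - i))"
    unfolding fps_mult_nth using Suc by (intro sum.subset_diff) auto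
  ultimately show ?thesis
    using Suc by (simp add: lin_nth)
qed (simp add: fps_mult_nth lin_nth)

lemma lin_geo: "lin v * geo v = 1" "geo v * lin v = 1"
proof -
  show "lin v * geo v = 1"
  proof (rule fps_ext)
    show "(lin v * geo v) $ n = 1 $ n" for n
      by (cases n) (auto simp: lin_mult_nth lin_nth)
  qed
  then show "geo v * lin v = 1"
    by (simp add: mult.commute)
qed

lemma graded_one [simp]: "graded 1"
  by (auto simp: graded_def mord_def one_mps.rep_eq zero_mps.rep_eq fps_one_nth)

lemma graded_mult: 
  assumes "graded F" "graded G"
  shows "graded (F * G)"
  unfolding graded_def fps_mult_nth
proof (intro allI mord_sum)
  fix n i :: nat assume "i \<in> {0..n}"
  then show "mord n (F $ i * G $ (n - i))"
    using assms mord_mult[of i "F $ i" "n - i" "G $ (n - i)"] by (simp add: graded_def)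
qed

lemma graded_prod: "(\<And>i. i \<in> I \<Longrightarrow> graded (F i)) \<Longrightarrow> graded (prod F I)"
  by (induction I rule: infinite_finite_induct) (auto intro: graded_mult)

lemma graded_geo: "mord 1 v \<Longrightarrow> graded (geo v)"
  by (auto simp: graded_def intro: mord_power)

lemma graded_lin: "mord 1 v \<Longrightarrow> graded (lin v)"
  by (auto simp: graded_def lin_nth intro: mord_uminus)

lemma fcong_refl [simp]: "fcong M F F"
  and fcong_sym: "fcong M F G \<Longrightarrow> fcong M G F"
  and fcong_trans [trans]: "fcong M F G \<Longrightarrow> fcong M G H \<Longrightarrow> fcong M F H"
  by (auto simp: fcong_def intro: mcong_sym mcong_trans)

lemma fcong_mult: "fcong M F G \<Longrightarrow> fcong M F' G' \<Longrightarrow> fcong M (F * F') (G * G')"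
  unfolding fcong_def fps_mult_nth by (auto intro!: mcong_sum mcong_mult)

lemma mcong_power: "mcong M f g \<Longrightarrow> mcong M (f ^ k) (g ^ k)"
  by (induction k) (auto intro: mcong_mult)

lemma fcong_geo: "mcong M v 0 \<Longrightarrow> fcong M (geo v) 1"
  unfolding fcong_def
proof
  fix n assume "mcong M v 0"
  then show "mcong M (geo v $ n) (1 $ n)"
    using mcong_power[of M v 0 n] by (cases n) auto
qed

lemma fcong_lin: "mcong M v 0 \<Longrightarrow> fcong M (lin v) 1"
  using mcong_uminus[of M v 0] by (auto simp: fcong_def lin_nth)

text \<open>Captures what is used of a sequence of letters. Sequences of distinct variables qualify,
  and so do their negatives, which occur in the conjugated identities.\<close>

definition null_seq :: "(nat \<Rightarrow> ('v, 'a::comm_ring_1) mps) \<Rightarrow> bool" where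
  "null_seq v \<longleftrightarrow> (\<forall>k. mord 1 (v k)) \<and> (\<forall>M. \<exists>k0. \<forall>k\<ge>k0. mcong M (v k) 0)"

lemma null_seq_uminus: "null_seq v \<Longrightarrow> null_seq (\<lambda>k. - v k)"
  unfolding null_seq_def using mcong_uminus mord_uminus by (metis add.inverse_neutral)

lemma null_seq_mps_var:
  assumes "inj c"
  shows "null_seq (\<lambda>k. mps_var (c k) :: ('v, 'a::comm_ring_1) mps)"
  unfolding null_seq_def
proof (intro conjI allI)
  fix M :: "'v multiset"
  have "finite {k. c k \<in># M}"
    using finite_vimageI[OF finite_set_mset assms, of M] by (simp add: vimage_def)
  then obtain k0 where k0: "\<forall>k\<in>{k. c k \<in># M}. k < k0"
    using finite_nat_set_iff_bounded by blast
  have "mcong M (mps_var (c k)) (0 :: ('v, 'a) mps)" if "k \<ge> k0" for k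
    using that k0 by (force simp: mcong_def mps_var.rep_eq zero_mps.rep_eq)
  then show "\<exists>k0. \<forall>k\<ge>k0. mcong M (mps_var (c k)) (0 :: ('v, 'a) mps)"
    by blast
qed (auto simp: mord_def mps_var.rep_eq)

section \<open>Alphabets as power series\<close>

lemma finite_multisets_of_size: 
  assumes "finite A"
  shows "finite {M. set_mset M \<subseteq> A \<and> size M = k}"
proof (rule finite_subset)
  show "{M. set_mset M \<subseteq> A \<and> size M = k} \<subseteq> mset ` {xs. set xs \<subseteq> A \<and> length xs = k}"
  proof
    fix M assume M: "M \<in> {M. set_mset M \<subseteq> A \<and> size M = k}"
    obtain xs where "mset xs = M"
      using ex_mset by blast
    with M show "M \<in> mset ` {xs. set xs \<subseteq> A \<and> length xs = k}"
      by (intro image_eqI[of _ _ xs]) auto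
  qed
qed (use assms finite_lists_length_eq in auto)

text \<open>A multiset of indices is split into the multiplicity \<open>j\<close> of the new index
  and the rest, of size \<open>k - j\<close>.\<close>

lemma hsym_snoc: "hsym (xs @ [x]) k = (\<Sum>j\<le>k. hsym xs (k - j) * x ^ j)"
proof -
  define n where "n = length xs"
  define S where "S k = {M. set_mset M \<subseteq> {..<n} \<and> size M = k}" for k
  have fin: "finite (S k)" for k
    by (auto simp: S_def intro: finite_multisets_of_size)
  have "hsym (xs @ [x]) k =
    (\<Sum>M | set_mset M \<subseteq> {..<Suc n} \<and> size M = k. \<Prod>i\<in>#M. (xs @ [x]) ! i)"
    by (simp add: hsym_def n_def)
  also have "\<dots> = (\<Sum>(j, M)\<in>Sigma {..k} (\<lambda>j. S (k - j)). (\<Prod>i\<in>#M. xs ! i) * x ^ j)"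
  proof (rule sum.reindex_bij_witness[of _ "\<lambda>(j, M). M + replicate_mset j n"
        "\<lambda>M. (count M n, filter_mset (\<lambda>i. i \<noteq> n) M)"])
    fix M assume "M \<in> {M. set_mset M \<subseteq> {..<Suc n} \<and> size M = k}"
    then have M: "set_mset M \<subseteq> {..<Suc n}" "size M = k"
      by auto
    have split: "filter_mset (\<lambda>i. i \<noteq> n) M + replicate_mset (count M n) n = M"
      by (rule multiset_eqI) auto
    then show "(case (count M n, filter_mset (\<lambda>i. i \<noteq> n) M) of (j, M) \<Rightarrow> M + replicate_mset j n) = M"
      by simp
    have "size (filter_mset (\<lambda>i. i \<noteq> n) M) + count M n = k"
      using M(2) split by (metis size_replicate_mset size_union)
    then show "(count M n, filter_mset (\<lambda>i. i \<noteq> n) M) \<in> Sigma {..k} (\<lambda>j. S (k - j))"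
      using M(1) by (auto simp: S_def less_Suc_eq)
    have "(\<Prod>i\<in>#M. (xs @ [x]) ! i) =
        (\<Prod>i\<in>#filter_mset (\<lambda>i. i \<noteq> n) M + replicate_mset (count M n) n. (xs @ [x]) ! i)"
      by (simp only: split)
    also have "\<dots> = (\<Prod>i\<in>#filter_mset (\<lambda>i. i \<noteq> n) M. (xs @ [x]) ! i) * x ^ count M n"
      by (simp add: n_def)
    also have "(\<Prod>i\<in>#filter_mset (\<lambda>i. i \<noteq> n) M. (xs @ [x]) ! i) =
        (\<Prod>i\<in>#filter_mset (\<lambda>i. i \<noteq> n) M. xs ! i)"
      using M(1) by (intro arg_cong[of _ _ prod_mset] image_mset_cong)
        (auto simp: nth_append n_def less_Suc_eq)
    finally show "(case (count M n, filter_mset (\<lambda>i. i \<noteq> n) M) of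
        (j, M) \<Rightarrow> (\<Prod>i\<in>#M. xs ! i) * x ^ j) = (\<Prod>i\<in>#M. (xs @ [x]) ! i)"
      by simp
  next
    fix p assume "p \<in> Sigma {..k} (\<lambda>j. S (k - j))"
    then obtain j M where p: "p = (j, M)" and jM: "j \<le> k" "set_mset M \<subseteq> {..<n}" "size M = k - j"
      by (auto simp: S_def)
    have "n \<notin># M"
      using jM by auto
    then have "count M n = 0"
      by (simp add: not_in_iff)
    moreover have "filter_mset (\<lambda>i. i \<noteq> n) M = M"
      using \<open>n \<notin># M\<close> by (auto simp: filter_mset_eq_conv)
    moreover have "filter_mset (\<lambda>i. i \<noteq> n) (replicate_mset j n) = {#}"
      by (induction j) auto
    ultimately show "(count (case p of (j, M) \<Rightarrow> M + replicate_mset j n) n,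
        filter_mset (\<lambda>i. i \<noteq> n) (case p of (j, M) \<Rightarrow> M + replicate_mset j n)) = p"
      using p by simp
    show "(case p of (j, M) \<Rightarrow> M + replicate_mset j n) \<in> {M. set_mset M \<subseteq> {..<Suc n} \<and> size M = k}"
      using p jM by (auto split: if_splits)
  qed
  also have "\<dots> = (\<Sum>j\<le>k. \<Sum>M\<in>S (k - j). (\<Prod>i\<in>#M. xs ! i) * x ^ j)"
    using fin by (subst sum.Sigma) auto
  finally show ?thesis
    by (simp add: hsym_def S_def n_def sum_distrib_right)
qed

lemma esym_snoc: "esym (xs @ [x]) k = esym xs k + (if k = 0 then 0 else x * esym xs (k - 1))"
proof -
  define n where "n = length xs"
  define S where "S k = {I. I \<subseteq> {..<n} \<and> card I = k}" for k
  have fin: "finite (S k)" for k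
    by (auto simp: S_def intro: finite_subset[of _ "Pow {..<n}"])
  have nmem: "n \<notin> I" "finite I" if "I \<in> S k" for I k
    using that by (auto simp: S_def intro: finite_subset)
  have set: "{I. I \<subseteq> {..<Suc n} \<and> card I = k} =
      S k \<union> (if k = 0 then {} else insert n ` S (k - 1))"
  proof (rule equalityI; rule subsetI)
    fix I assume "I \<in> {I. I \<subseteq> {..<Suc n} \<and> card I = k}"
    then have I: "I \<subseteq> {..<Suc n}" "card I = k"
      by auto
    have "finite I"
      using I(1) finite_subset by blast
    show "I \<in> S k \<union> (if k = 0 then {} else insert n ` S (k - 1))"
    proof (cases "n \<in> I")
      case True
      then have "k > 0" "I - {n} \<in> S (k - 1)" "I = insert n (I - {n})"
        using I \<open>finite I\<close> by (auto simp: S_def less_Suc_eq card_gt_0_iff)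
      then have "k > 0" "I \<in> insert n ` S (k - 1)"
        by blast+
      then show ?thesis
        by simp
    next
      case False
      then show ?thesis
        using I by (auto simp: S_def less_Suc_eq subset_iff)
    qed
  next
    fix I assume I: "I \<in> S k \<union> (if k = 0 then {} else insert n ` S (k - 1))"
    show "I \<in> {I. I \<subseteq> {..<Suc n} \<and> card I = k}"
    proof (cases "I \<in> S k")
      case True
      then show ?thesis
        by (auto simp: S_def)
    next
      case False
      then obtain J where J: "J \<in> S (k - 1)" "I = insert n J" "k \<noteq> 0"
        using I by (auto split: if_splits)
      then show ?thesis
        using nmem[OF J(1)] by (auto simp: S_def)
    qed
  qed
  have inj: "inj_on (insert n) (S (k - 1))"
    using nmem(1) by (intro inj_onI) (metis insert_ident)
  have *: "(\<Prod>i\<in>I. (xs @ [x]) ! i) = (\<Prod>i\<in>I. xs ! i)" if "I \<in> S k" for I k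
    using that by (intro prod.cong) (auto simp: S_def n_def nth_append)
  have "esym (xs @ [x]) k = (\<Sum>I\<in>S k \<union> (if k = 0 then {} else insert n ` S (k - 1)). \<Prod>i\<in>I. (xs @ [x]) ! i)"
    by (simp add: esym_def set[symmetric] n_def)
  also have "\<dots> = (\<Sum>I\<in>S k. \<Prod>i\<in>I. (xs @ [x]) ! i) +
      (\<Sum>I\<in>(if k = 0 then {} else insert n ` S (k - 1)). \<Prod>i\<in>I. (xs @ [x]) ! i)"
    using fin nmem(1) by (intro sum.union_disjoint) auto
  also have "(\<Sum>I\<in>S k. \<Prod>i\<in>I. (xs @ [x]) ! i) = esym xs k"
    unfolding esym_def using * by (auto simp: S_def n_def intro: sum.cong)
  also have "(\<Sum>I\<in>(if k = 0 then {} else insert n ` S (k - 1)). \<Prod>i\<in>I. (xs @ [x]) ! i) =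
      (if k = 0 then 0 else \<Sum>I\<in>S (k - 1). x * (\<Prod>i\<in>I. xs ! i))"
  proof (cases "k = 0")
    case False
    have "(\<Prod>i\<in>insert n I. (xs @ [x]) ! i) = x * (\<Prod>i\<in>I. xs ! i)" if "I \<in> S (k - 1)" for I
      using nmem[OF that] *[OF that] by (simp add: n_def)
    then show ?thesis
      using False sum.reindex[OF inj, of "\<lambda>I. \<Prod>i\<in>I. (xs @ [x]) ! i"] by simp
  qed simp
  also have "\<dots> = (if k = 0 then 0 else x * esym xs (k - 1))"
    by (simp add: esym_def S_def n_def sum_distrib_left)
  finally show ?thesis .
qed

lemma hsym_Nil: "hsym [] k = (if k = 0 then 1 else 0)"
proof -
  have "{M :: nat multiset. set_mset M \<subseteq> {..<length []} \<and> size M = k} = (if k = 0 then {{#}} else {})"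
    by auto
  then show ?thesis
    by (simp only: hsym_def) auto
qed

lemma esym_Nil: "esym [] k = (if k = 0 then 1 else 0)"
proof -
  have "{I :: nat set. I \<subseteq> {..<length []} \<and> card I = k} = (if k = 0 then {{}} else {})"
    by auto
  then show ?thesis
    by (simp only: esym_def) auto
qed

lemma hsym_eq_fps: "hsym xs k = prod_list (map geo xs) $ k"
proof (induction xs arbitrary: k rule: rev_induct)
  case (snoc x xs)
  have "(prod_list (map geo xs) * geo x) $ k = (\<Sum>j=0..k. hsym xs j * x ^ (k - j))"
    by (simp add: fps_mult_nth snoc)
  also have "\<dots> = (\<Sum>j\<le>k. hsym xs (k - j) * x ^ j)"
    by (rule sum.reindex_bij_witness[of _ "\<lambda>j. k - j" "\<lambda>j. k - j"]) auto
  finally show ?case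
    by (simp add: hsym_snoc)
qed (simp add: hsym_Nil)

text \<open>The sign turns the factors \<open>1 + x t\<close> of the elementary generating function
  into \<open>lin x\<close>.\<close>

lemma esym_eq_fps: "(-1) ^ k * esym xs k = prod_list (map lin xs) $ k"
proof (induction xs arbitrary: k rule: rev_induct)
  case (snoc x xs)
  have "prod_list (map lin (xs @ [x])) $ k = (lin x * prod_list (map lin xs)) $ k"
    by (simp add: mult.commute)
  also have "\<dots> = (-1) ^ k * esym xs k - (if k = 0 then 0 else x * ((-1) ^ (k - 1) * esym xs (k - 1)))"
    by (simp add: lin_mult_nth snoc)
  also have "\<dots> = (-1) ^ k * esym (xs @ [x]) k"
    by (cases k) (auto simp: esym_snoc algebra_simps)
  finally show ?case ..
qed (simp add: esym_Nil)

text \<open>Generating series of the functions \<open>h_super Z\<close>: unions of alphabets become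
  products, formal negatives become inverses.\<close>

definition afps :: "'r::comm_ring_1 alphabet \<Rightarrow> 'r fps" where
  "afps Z = prod_list (map geo (fst Z)) * prod_list (map lin (snd Z))"

lemma afps_union: "afps (Z \<squnion>\<^sub>a W) = afps Z * afps W"
  by (simp add: afps_def alph_union_def mult_ac)

lemma h_super_eq_fps: "h_super Z m = (if m < 0 then 0 else afps Z $ nat m)"
proof -
  have "(\<Sum>k\<le>n. (-1) ^ (n - k) * hsym (fst Z) k * esym (snd Z) (n - k)) = afps Z $ n" for n
    by (simp add: afps_def fps_mult_nth hsym_eq_fps[symmetric] esym_eq_fps[symmetric]
        atLeast0AtMost mult_ac)
  then show ?thesis
    by (simp add: h_super_def)
qed

section \<open>Initial segments and intervals of letters as series\<close>

definition hfps :: "(nat \<Rightarrow> 'r::comm_ring_1) \<Rightarrow> nat \<Rightarrow> 'r fps" where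
  "hfps a k = (\<Prod>t=1..k. geo (a t))"

definition efps :: "(nat \<Rightarrow> 'r::comm_ring_1) \<Rightarrow> nat \<Rightarrow> 'r fps" where
  "efps a k = (\<Prod>t=1..k. lin (a t))"

lemma hfps_efps: "hfps a k * efps a k = 1"
  by (simp add: hfps_def efps_def prod.distrib[symmetric] lin_geo)

lemma hfps_0 [simp]: "hfps a 0 = 1" and efps_0 [simp]: "efps a 0 = 1"
  by (simp_all add: hfps_def efps_def)

lemma hfps_Suc: "hfps a (Suc k) = hfps a k * geo (a (Suc k))"
  and efps_Suc: "efps a (Suc k) = efps a k * lin (a (Suc k))"
  by (simp_all add: hfps_def efps_def)

lemma prod_list_upto:
  assumes "1 \<le> i"
  shows "prod_list (map (\<lambda>k. f (nat k)) [i..j]) = (\<Prod>t=nat i..nat j. f t)"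
proof -
  have "prod_list (map (\<lambda>k. f (nat k)) [i..j]) = (\<Prod>k\<in>{i..j}. f (nat k))"
    by (simp add: prod.distinct_set_conv_list[symmetric])
  also have "\<dots> = (\<Prod>t=nat i..nat j. f t)"
    using assms by (intro prod.reindex_bij_witness[of _ int nat]) auto
  finally show ?thesis .
qed

lemma hfps_split:
  assumes "i \<le> j"
  shows "hfps a j * efps a i = (\<Prod>t=Suc i..j. geo (a t))"
    and "hfps a i * efps a j = (\<Prod>t=Suc i..j. lin (a t))"
proof -
  have U: "{1..j} = {1..i} \<union> {Suc i..j}"
    using assms by auto
  have "hfps a j = hfps a i * (\<Prod>t=Suc i..j. geo (a t))"
    unfolding hfps_def U by (rule prod.union_disjoint) auto
  then have "hfps a j * efps a i = (hfps a i * efps a i) * (\<Prod>t=Suc i..j. geo (a t))"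
    by (simp only: mult_ac)
  then show "hfps a j * efps a i = (\<Prod>t=Suc i..j. geo (a t))"
    by (simp add: hfps_efps)
  have "efps a j = efps a i * (\<Prod>t=Suc i..j. lin (a t))"
    unfolding efps_def U by (rule prod.union_disjoint) auto
  then have "hfps a i * efps a j = (hfps a i * efps a i) * (\<Prod>t=Suc i..j. lin (a t))"
    by (simp only: mult_ac)
  then show "hfps a i * efps a j = (\<Prod>t=Suc i..j. lin (a t))"
    by (simp add: hfps_efps)
qed

text \<open>One formula for both orientations: since \<open>efps\<close> inverts
  \<open>hfps\<close>, an interval is a quotient of two initial segments, and the formal negative of
  a reversed interval is the same quotient. Truncation by \<open>nat\<close> drops the letters of
  nonpositive index.\<close>

lemma afps_alph_cc: "afps (alph_cc a i j) = hfps a (nat j) * efps a (nat (i - 1))"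
proof (cases "i \<le> j + 1")
  case True
  have "afps (alph_cc a i j) = prod_list (map (\<lambda>k. geo (a (nat k))) [max 1 i..j])"
    using True by (simp add: afps_def alph_cc_def comp_def)
  also have "\<dots> = (\<Prod>t=nat (max 1 i)..nat j. geo (a t))"
    by (rule prod_list_upto[of _ "\<lambda>t. geo (a t)"]) simp
  also have "nat (max 1 i) = Suc (nat (i - 1))"
    by simp
  also have "(\<Prod>t=Suc (nat (i - 1))..nat j. geo (a t)) = hfps a (nat j) * efps a (nat (i - 1))"
    using True by (intro hfps_split(1)[symmetric]) simp
  finally show ?thesis .
next
  case False
  have "afps (alph_cc a i j) = prod_list (map (\<lambda>k. lin (a (nat k))) [max 1 (j + 1)..i - 1])"
    using False by (simp add: afps_def alph_cc_def comp_def)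
  also have "\<dots> = (\<Prod>t=nat (max 1 (j + 1))..nat (i - 1). lin (a t))"
    by (rule prod_list_upto[of _ "\<lambda>t. lin (a t)"]) simp
  also have "nat (max 1 (j + 1)) = Suc (nat j)"
    by simp
  also have "(\<Prod>t=Suc (nat j)..nat (i - 1). lin (a t)) = hfps a (nat j) * efps a (nat (i - 1))"
    using False by (intro hfps_split(2)[symmetric]) simp
  finally show ?thesis .
qed

lemma prod_list_letters: "prod_list (map geo (letters x n)) = hfps x n"
proof (induction n)
  case (Suc n)
  have "letters x (Suc n) = letters x n @ [x (Suc n)]"
    by (simp add: letters_def)
  with Suc show ?case
    by (simp add: hfps_Suc)
qed (simp add: letters_def)

text \<open>Entry \<open>(p, q)\<close> of the infinite lower triangular Toeplitz matrix of
  \<open>F\<close>.\<close>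

definition cf :: "'r::comm_ring_1 fps \<Rightarrow> nat \<Rightarrow> nat \<Rightarrow> 'r" where
  "cf F p q = (if q \<le> p then F $ (p - q) else 0)"

text \<open>The cut-off is exact because row \<open>p\<close> of the first factor ends at column
  \<open>p < N\<close>.\<close>

lemma cf_mult:
  assumes "p < N"
  shows "(\<Sum>q<N. cf F p q * cf G q r) = cf (F * G) p r"
proof (cases "r \<le> p")
  case True
  have "(\<Sum>q<N. cf F p q * cf G q r) = (\<Sum>q\<in>{r..p}. F $ (p - q) * G $ (q - r))"
    using assms by (intro sum.mono_neutral_cong_right) (auto simp: cf_def)
  also have "\<dots> = (\<Sum>i=0..p - r. F $ i * G $ (p - r - i))"
    using True by (intro sum.reindex_bij_witness[of _ "\<lambda>i. p - i" "\<lambda>q. p - q"]) auto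
  finally show ?thesis
    using True by (simp add: cf_def fps_mult_nth)
next
  case False
  then show ?thesis
    by (auto simp: cf_def intro!: sum.neutral)
qed

lemma cf_one: "cf 1 p q = of_bool (p = q)"
  by (auto simp: cf_def)

lemma cf_diag: "cf F p p = F $ 0"
  by (simp add: cf_def)

lemma mord_cf: "graded F \<Longrightarrow> mord (p - q) (cf F p q)"
  by (auto simp: cf_def graded_def)

lemma mcong_cf: "fcong M F G \<Longrightarrow> mcong M (cf F p q) (cf G p q)"
  by (auto simp: cf_def fcong_def)

text \<open>For \<open>g_fin\<close>, \<open>K\<close> is the series of the variables,
  \<open>a\<close> the sequence of negated \<alpha> and \<open>b\<close> that of \<beta>. The series
  is kept general for the sake of \<open>K = 1\<close>, which gives orthogonality, and of
  \<open>K = efps\<close>, which arises from conjugation. The closed lower end of the interval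
  starting at \<open>p i\<close> becomes the index \<open>p i - 1\<close>, which is 0 for a zero
  part.\<close>

definition gdet :: "'r::comm_ring_1 fps \<Rightarrow> (nat \<Rightarrow> 'r) \<Rightarrow> (nat \<Rightarrow> 'r) \<Rightarrow> nat \<Rightarrow> (nat \<Rightarrow> nat) \<Rightarrow> (nat \<Rightarrow> nat) \<Rightarrow> 'r" where
  "gdet K a b l p q = fdet l (\<lambda>i j.
    cf (K * (hfps a (q j) * efps a (p i - 1)) * (hfps b i * efps b j)) (pos l p i) (pos l q j))"

lemma nat_int_minus_one: "nat (int k - 1) = k - 1"
  by simp

lemma g_fin_eq_gdet: "g_fin l n y \<alpha> \<beta> p q = gdet (hfps y n) (\<lambda>k. - \<alpha> k) \<beta> l p q"
  unfolding g_fin_def gdet_def fdet_def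
proof (intro arg_cong[of _ _ det] cong_mat refl, clarify)
  fix i j assume "i < l" "j < l"
  then have eq: "int (p i) - int (q j) - int i + int j = int (pos l p i) - int (pos l q j)"
    by (simp add: pos_def of_nat_diff)
  have [simp]: "nat (int (pos l p i) - int (pos l q j)) = pos l p i - pos l q j"
    by linarith
  show "h_super ((letters y n, []) \<squnion>\<^sub>a A_cc \<alpha> (int (p i)) (int (q j)) \<squnion>\<^sub>a B_co \<beta> (int j + 1) (int i + 1))
          (int (p i) - int (q j) - int i + int j) =
        cf (hfps y n * (hfps (\<lambda>k. - \<alpha> k) (q j) * efps (\<lambda>k. - \<alpha> k) (p i - 1)) * (hfps \<beta> i * efps \<beta> j))
          (pos l p i) (pos l q j)"
    unfolding eq h_super_eq_fps afps_union A_cc_def B_co_def alph_co_def afps_alph_cc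
    by (auto simp: cf_def nat_int_minus_one afps_def prod_list_letters)
qed

text \<open>The double-slash function as an entry between two positions, with \<open>H\<close> the
  series of the variables and \<open>F\<close> that of the alphabet. The condition is
  \<open>a - b = p - q\<close>, written without subtraction.\<close>

definition dsl :: "('v, 'a::comm_ring_1) mps fps \<Rightarrow> ('v, 'a) mps fps \<Rightarrow> nat \<Rightarrow> nat \<Rightarrow> ('v, 'a) mps" where
  "dsl H F p q = (\<Sum>\<^sub>\<infinity>(a, b)\<in>{(a, b). a + q = b + p}. H $ a * F $ b)"

lemma G_fin_eq: 
  "G_fin l n x \<alpha> \<beta> p q = (\<Prod>i=1..l. \<Prod>j=1..n. 1 - \<beta> i * x j) *
    fdet l (\<lambda>i j. dsl (hfps x n) (hfps (\<lambda>k. - \<alpha> k) (p i) * efps (\<lambda>k. - \<alpha> k) (q j - 1) *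
      (hfps \<beta> j * efps \<beta> i)) (pos l p i) (pos l q j))"
  unfolding G_fin_def fdet_def
proof (intro arg_cong2[of _ _ _ _ "(*)"] refl arg_cong[of _ _ det] cong_mat, clarify)
  fix i j assume "i < l" "j < l"
  then have eq: "int (p i) - int (q j) - int i + int j = int (pos l p i) - int (pos l q j)"
    by (simp add: pos_def of_nat_diff)
  show "h_dslash (letters x n)
        (A_cc \<alpha> (int (q j)) (int (p i)) \<squnion>\<^sub>a B_co \<beta> (int i + 1) (int j + 1))
        (int (p i) - int (q j) - int i + int j) =
      dsl (hfps x n) (hfps (\<lambda>k. - \<alpha> k) (p i) * efps (\<lambda>k. - \<alpha> k) (q j - 1) *
      (hfps \<beta> j * efps \<beta> i)) (pos l p i) (pos l q j)"
    unfolding eq h_dslash_def dsl_def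
    by (intro infsum_cong_neutral)
      (auto simp: h_super_eq_fps afps_union A_cc_def B_co_def alph_co_def afps_alph_cc
        nat_int_minus_one hsym_eq_fps prod_list_letters)
qed

text \<open>A term has order at least \<open>a + b\<close>, so only \<open>b \<le> size M\<close>
  matters. The factor \<open>cf H (b + p) q\<close> is zero if no \<open>a\<close> belongs to
  \<open>b\<close>.\<close>

lemma dsl_mcong_finite:
  fixes H F :: "('v, 'a::comm_ring_1) mps fps"
  assumes "graded H" "graded F" "size M < B"
  shows "mcong M (dsl H F p q) (\<Sum>b<B. cf H (b + p) q * F $ b)"
proof -
  let ?S = "{(a, b). a + q = b + p}" and ?f = "\<lambda>(a, b). H $ a * F $ b"
  define E where "E B = {(a, b). a + q = b + p \<and> b < B}" for B
  have fin: "finite (E B)" for B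
    by (rule finite_subset[of _ "{..B + p} \<times> {..B}"]) (auto simp: E_def)
  have small: "mcong M (?f i) 0" if "i \<in> ?S - E B" "size M < B" for i M B
  proof -
    obtain a b where i: "i = (a, b)"
      by (cases i)
    with that have "B \<le> b"
      by (auto simp: E_def)
    then have "size M < a + b"
      using that by simp
    moreover have "mord (a + b) (H $ a * F $ b)"
      using assms by (intro mord_mult) (auto simp: graded_def)
    ultimately show ?thesis
      using i by (auto intro: mcong_zero_of_mord)
  qed
  have "mcong M (infsum ?f ?S) (sum ?f (E B))"
  proof (rule infsum_mcong)
    fix M :: "'v multiset"
    show "\<exists>F. finite F \<and> F \<subseteq> ?S \<and> (\<forall>i\<in>?S - F. mcong M (?f i) 0)"
      using fin small[of _ "Suc (size M)" M] by (intro exI[of _ "E (Suc (size M))"]) (auto simp: E_def)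
    show "E B \<subseteq> ?S"
      by (auto simp: E_def)
  qed (use fin small assms(3) in blast)+
  also have "sum ?f (E B) = (\<Sum>b\<in>{b. b < B \<and> q \<le> b + p}. cf H (b + p) q * F $ b)"
    by (rule sum.reindex_bij_witness[of _ "\<lambda>b. (b + p - q, b)" snd])
      (auto simp: E_def cf_def, metis add_diff_cancel_right')
  also have "\<dots> = (\<Sum>b<B. cf H (b + p) q * F $ b)"
    by (rule sum.mono_neutral_left) (auto simp: cf_def)
  finally show ?thesis
    by (simp add: dsl_def)
qed

lemma dsl_mcong:
  assumes "graded H" "graded F" "graded H'" "graded F'" "fcong M H H'" "fcong M F F'"
  shows "mcong M (dsl H F p q) (dsl H' F' p q)"
proof -
  let ?s = "\<lambda>H F. \<Sum>b<Suc (size M). cf H (b + p) q * F $ b"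
  have "mcong M (dsl H F p q) (?s H F)" "mcong M (dsl H' F' p q) (?s H' F')"
    by (intro dsl_mcong_finite assms lessI)+
  moreover have "mcong M (?s H F) (?s H' F')"
    using assms by (intro mcong_sum mcong_mult mcong_cf) (auto simp: fcong_def)
  ultimately show ?thesis
    by (meson mcong_sym mcong_trans)
qed

text \<open>Each term contains a coefficient \<open>H $ a\<close> with
  \<open>a \<ge> p - q\<close>.\<close>

lemma mord_dsl:
  fixes H F :: "('v, 'a::comm_ring_1) mps fps"
  assumes "graded H" "graded F"
  shows "mord (p - q) (dsl H F p q)"
  unfolding mord_def
proof (intro allI impI)
  fix A :: "'v multiset" assume A: "size A < p - q"
  have "mcong A (dsl H F p q) (\<Sum>b<Suc (size A). cf H (b + p) q * F $ b)"
    using assms by (intro dsl_mcong_finite) auto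
  also have "mcong A (\<Sum>b<Suc (size A). cf H (b + p) q * F $ b) (\<Sum>b<Suc (size A). 0)"
  proof (rule mcong_sum)
    fix b
    have "mord (b + p - q + b) (cf H (b + p) q * F $ b)"
      using assms by (intro mord_mult mord_cf) (auto simp: graded_def)
    then show "mcong A (cf H (b + p) q * F $ b) 0"
      by (rule mcong_zero_of_mord) (use A in auto)
  qed
  finally show "mps_coeff (dsl H F p q) A = 0"
    by (simp add: mcong_def zero_mps.rep_eq)
qed

text \<open>The entry becomes a triple product with the transposed Toeplitz matrix of
  \<open>H\<close> in the middle. The term of \<open>R $ i\<close> and \<open>C $ k\<close> passes
  through the indices \<open>e = q - i\<close> and \<open>f = p + k\<close>: the degree bound on
  \<open>R\<close> keeps \<open>e\<close> nonnegative, and cutting at \<open>f < N\<close> loses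
  only terms with \<open>k > size M\<close>.\<close>

lemma dsl_mcong_matrix:
  assumes gr: "graded H" "graded R" "graded C" and R: "\<And>k. k > q \<Longrightarrow> R $ k = 0"
    and N: "q < N" "p + size M < N"
  shows "mcong M (dsl H (R * C) p q) (\<Sum>e<N. \<Sum>f<N. cf R q e * cf H f e * cf C f p)"
proof -
  \<comment> \<open>Large enough for the triangle \<open>i + k < B\<close> to contain the rectangle
    that is kept.\<close>
  define B where "B = N + q"
  let ?t = "\<lambda>(i, k). R $ i * cf H (i + k + p) q * C $ k"
  have "mcong M (dsl H (R * C) p q) (\<Sum>b<B. cf H (b + p) q * (R * C) $ b)"
    using gr N by (intro dsl_mcong_finite graded_mult) (auto simp: B_def)
  also have "(\<Sum>b<B. cf H (b + p) q * (R * C) $ b) = (\<Sum>(b, i)\<in>Sigma {..<B} (\<lambda>b. {0..b}). R $ i * cf H (b + p) q * C $ (b - i))"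
    unfolding fps_mult_nth sum_distrib_left
    by (subst sum.Sigma[symmetric]) (auto simp: mult_ac)
  also have "\<dots> = sum ?t {(i, k). i + k < B}"
    by (rule sum.reindex_bij_witness[of _ "\<lambda>(i, k). (i + k, i)" "\<lambda>(b, i). (i, b - i)"]) auto
  also have "mcong M \<dots> (sum ?t {(i, k). i \<le> q \<and> k < N - p})"
  proof (rule mcong_sum_mono_neutral)
    show "finite {(i, k). i + k < B}"
      by (rule finite_subset[of _ "{..B} \<times> {..B}"]) auto
    show "{(i, k). i \<le> q \<and> k < N - p} \<subseteq> {(i, k). i + k < B}"
      by (auto simp: B_def)
    fix x assume "x \<in> {(i, k). i + k < B} - {(i, k). i \<le> q \<and> k < N - p}"
    moreover obtain i k where x: "x = (i, k)"
      by (cases x)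
    ultimately have ik: "i > q \<or> k \<ge> N - p"
      by auto
    show "mcong M (?t x) 0"
    proof (cases "i > q")
      case True
      then show ?thesis
        using R x by simp
    next
      case False
      then have "size M < k"
        using ik N by auto
      moreover have "mord k (C $ k)"
        using gr by (simp add: graded_def)
      ultimately have "mcong M (C $ k) 0"
        by (intro mcong_zero_of_mord)
      then show ?thesis
        using x by (simp add: mcong_mult_zero)
    qed
  qed
  also have "sum ?t {(i, k). i \<le> q \<and> k < N - p} =
      (\<Sum>(e, f)\<in>{..q} \<times> {p..<N}. cf R q e * cf H f e * cf C f p)"
    by (rule sum.reindex_bij_witness[of _ "\<lambda>(e, f). (q - e, f - p)" "\<lambda>(i, k). (q - i, p + k)"])
      (use N in \<open>auto simp: cf_def add_ac\<close>)
  also have "\<dots> = (\<Sum>(e, f)\<in>{..<N} \<times> {..<N}. cf R q e * cf H f e * cf C f p)"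
    using N by (intro sum.mono_neutral_left) (auto simp: cf_def split: if_splits)
  also have "\<dots> = (\<Sum>e<N. \<Sum>f<N. cf R q e * cf H f e * cf C f p)"
    by (simp add: sum.cartesian_product)
  finally show ?thesis .
qed

section \<open>Completeness and the exchange relation\<close>

text \<open>Only the range of the summation index is recorded, so factors with unrelated outer index
  ranges can be composed.\<close>

definition mprod :: "nat \<Rightarrow> (nat \<Rightarrow> nat \<Rightarrow> 'r::comm_ring_1) \<Rightarrow> (nat \<Rightarrow> nat \<Rightarrow> 'r) \<Rightarrow> nat \<Rightarrow> nat \<Rightarrow> 'r" where
  "mprod N f g = (\<lambda>i j. \<Sum>k<N. f i k * g k j)"

lemma mprod_assoc: "mprod N (mprod N' f g) h = mprod N' f (mprod N g h)"
proof (intro ext)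
  fix i j
  have "mprod N (mprod N' f g) h i j = (\<Sum>k<N. \<Sum>k'<N'. f i k' * g k' k * h k j)"
    by (simp add: mprod_def sum_distrib_right)
  also have "\<dots> = (\<Sum>k'<N'. \<Sum>k<N. f i k' * g k' k * h k j)"
    by (rule sum.swap)
  also have "\<dots> = mprod N' f (mprod N g h) i j"
    by (simp add: mprod_def sum_distrib_left mult.assoc)
  finally show "mprod N (mprod N' f g) h i j = mprod N' f (mprod N g h) i j" .
qed

lemma mprod_cong:
  "(\<And>k. k < N \<Longrightarrow> f i k = f' i' k) \<Longrightarrow> (\<And>k. k < N \<Longrightarrow> g k j = g' k j') \<Longrightarrow>
    mprod N f g i j = mprod N f' g' i' j'"
  by (auto simp: mprod_def)

lemma mcong_mprod:
  "(\<And>k. k < N \<Longrightarrow> mcong M (f i k) (f' i k)) \<Longrightarrow> (\<And>k. k < N \<Longrightarrow> mcong M (g k j) (g' k j)) \<Longrightarrow>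
    mcong M (mprod N f g i j) (mprod N f' g' i j)"
  by (auto simp: mprod_def intro!: mcong_sum mcong_mult)

lemma mprod_cf: "p < N \<Longrightarrow> mprod N (cf F) (cf G) p r = cf (F * G) p r"
  by (simp add: mprod_def cf_mult)

lemma mprod_cf_one: 
  assumes "i < N"
  shows "mprod N (cf 1) f i j = f i j"
proof -
  have "mprod N (cf 1) f i j = (\<Sum>k<N. if k = i then f i j else 0)"
    unfolding mprod_def by (intro sum.cong) (auto simp: cf_one)
  then show ?thesis
    using assms by simp
qed

lemma mprod_cf_one_right: "mprod N f (mprod N (cf 1) g) = mprod N f g"
  by (intro ext, rule mprod_cong) (auto simp: mprod_cf_one)

lemma mprod_cf_mult_right:
  "mprod N f (mprod N (cf (F * G)) g) = mprod N f (mprod N (cf F) (mprod N (cf G) g))"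
proof (intro ext, rule mprod_cong)
  fix k j assume "k < N"
  then have "mprod N (cf (F * G)) g k j = mprod N (mprod N (cf F) (cf G)) g k j"
    by (intro mprod_cong) (auto simp: mprod_cf)
  then show "mprod N (cf (F * G)) g k j = mprod N (cf F) (mprod N (cf G) g) k j"
    by (simp only: mprod_assoc)
qed simp

lemma fdet_mprod: "fdet n (mprod n f g) = fdet n f * fdet n g"
  by (simp add: mprod_def fdet_mult)

section \<open>Degree bounds, factorization of the determinants and orthogonality\<close>

definition fdeg :: "'r::comm_ring_1 fps \<Rightarrow> nat \<Rightarrow> bool" where
  "fdeg F d \<longleftrightarrow> (\<forall>n>d. F $ n = 0)"

lemma fdeg_one [simp]: "fdeg 1 0"
  by (auto simp: fdeg_def)

lemma fdeg_mult:
  assumes "fdeg F d" "fdeg G e"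
  shows "fdeg (F * G) (d + e)"
  unfolding fdeg_def fps_mult_nth
proof (intro allI impI sum.neutral ballI)
  fix n i assume "d + e < n" "i \<in> {0..n}"
  then have "d < i \<or> e < n - i"
    by auto
  then show "F $ i * G $ (n - i) = 0"
    using assms by (auto simp: fdeg_def)
qed

lemma fdeg_mono: "fdeg F d \<Longrightarrow> d \<le> e \<Longrightarrow> fdeg F e"
  by (auto simp: fdeg_def)

lemma fdeg_prod_lin: "fdeg (\<Prod>t\<in>I. lin (a t)) (card I)"
proof (induction I rule: infinite_finite_induct)
  case (insert t I)
  have "fdeg (lin (a t)) 1"
    by (auto simp: fdeg_def lin_nth)
  from fdeg_mult[OF this insert.IH] insert show ?case
    by simp
qed auto

lemma fdeg_efps: "fdeg (efps a k) k"
  using fdeg_prod_lin[of a "{1..k}"] by (simp add: efps_def)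

text \<open>The letters up to \<open>i\<close> cancel and \<open>j - i\<close> linear factors
  remain. The degree counts behind the vanishing entries below start here.\<close>

lemma fdeg_hfps_efps: "i \<le> j \<Longrightarrow> fdeg (hfps a i * efps a j) (j - i)"
  using fdeg_prod_lin[of a "{Suc i..j}"] by (simp add: hfps_split(2))

lemma hfps_nth_0 [simp]: "hfps a k $ 0 = 1"
  by (induction k) (auto simp: hfps_Suc)

lemma efps_nth_0 [simp]: "efps a k $ 0 = 1"
  by (induction k) (auto simp: efps_Suc lin_nth)

lemma graded_hfps: "(\<And>t. mord 1 (a t)) \<Longrightarrow> graded (hfps a k)"
  unfolding hfps_def by (intro graded_prod graded_geo)

lemma graded_efps: "(\<And>t. mord 1 (a t)) \<Longrightarrow> graded (efps a k)"
  unfolding efps_def by (intro graded_prod graded_lin)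

text \<open>The factors depending on \<open>l\<close> cancel in \<open>rser * cser\<close>. They are there to make \<open>rser\<close> a
  polynomial of degree at most \<open>pos l p i\<close>, so that no position below 0 is needed.\<close>

definition rser :: "(nat \<Rightarrow> 'r::comm_ring_1) \<Rightarrow> (nat \<Rightarrow> 'r) \<Rightarrow> nat \<Rightarrow> (nat \<Rightarrow> nat) \<Rightarrow> nat \<Rightarrow> 'r fps" where
  "rser a b l p i = efps a (p i - 1) * (hfps b i * efps b (l - 1))"

definition cser :: "(nat \<Rightarrow> 'r::comm_ring_1) \<Rightarrow> (nat \<Rightarrow> 'r) \<Rightarrow> nat \<Rightarrow> (nat \<Rightarrow> nat) \<Rightarrow> nat \<Rightarrow> 'r fps" where
  "cser a b l q j = hfps a (q j) * (hfps b (l - 1) * efps b j)"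

definition rmat :: "(nat \<Rightarrow> 'r::comm_ring_1) \<Rightarrow> (nat \<Rightarrow> 'r) \<Rightarrow> nat \<Rightarrow> (nat \<Rightarrow> nat) \<Rightarrow> nat \<Rightarrow> nat \<Rightarrow> 'r" where
  "rmat a b l p i e = cf (rser a b l p i) (pos l p i) e"

definition cmat :: "(nat \<Rightarrow> 'r::comm_ring_1) \<Rightarrow> (nat \<Rightarrow> 'r) \<Rightarrow> nat \<Rightarrow> (nat \<Rightarrow> nat) \<Rightarrow> nat \<Rightarrow> nat \<Rightarrow> 'r" where
  "cmat a b l q e j = cf (cser a b l q j) e (pos l q j)"

lemma rser_cser:
  "rser a b l p i * cser a b l q j = hfps a (q j) * efps a (p i - 1) * (hfps b i * efps b j)"
proof -
  have "rser a b l p i * cser a b l q j =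
      hfps a (q j) * efps a (p i - 1) * (hfps b i * efps b j) * (hfps b (l - 1) * efps b (l - 1))"
    unfolding rser_def cser_def by (simp only: mult_ac)
  then show ?thesis
    by (simp add: hfps_efps)
qed

lemma rser_nth_0 [simp]: "rser a b l p i $ 0 = 1"
  by (simp add: rser_def)

lemma fdeg_rser: "i < l \<Longrightarrow> fdeg (rser a b l p i) (pos l p i)"
  unfolding rser_def pos_def
  by (rule fdeg_mono[OF fdeg_mult[OF fdeg_efps fdeg_hfps_efps]]) auto

text \<open>Membership of \<open>p\<close> in the box puts all row positions below the cut-off,
  where Toeplitz products are exact.\<close>

lemma gdet_eq_mprod:
  assumes "p \<in> box l m"
  shows "gdet K a b l p q =
    fdet l (mprod (l + m) (rmat a b l p) (mprod (l + m) (cf K) (cmat a b l q)))"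
  unfolding gdet_def
proof (rule fdet_cong)
  fix i j assume "i < l" "j < l"
  then have lt: "pos l p i < l + m"
    using assms by (intro pos_less)
  have "cf (rser a b l p i * (K * cser a b l q j)) (pos l p i) (pos l q j) =
      mprod (l + m) (cf (rser a b l p i)) (cf (K * cser a b l q j)) (pos l p i) (pos l q j)"
    by (simp add: mprod_cf[OF lt])
  also have "\<dots> =
      mprod (l + m) (cf (rser a b l p i)) (mprod (l + m) (cf K) (cf (cser a b l q j))) (pos l p i) (pos l q j)"
    by (rule mprod_cong) (auto simp: mprod_cf)
  also have "\<dots> = mprod (l + m) (rmat a b l p) (mprod (l + m) (cf K) (cmat a b l q)) i j"
    by (intro mprod_cong) (auto simp: rmat_def cmat_def mprod_def)
  also have "rser a b l p i * (K * cser a b l q j) =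
      K * (hfps a (q j) * efps a (p i - 1)) * (hfps b i * efps b j)"
    by (simp only: mult.left_commute[of "rser a b l p i" K] rser_cser mult.assoc)
  finally show "cf (K * (hfps a (q j) * efps a (p i - 1)) * (hfps b i * efps b j)) (pos l p i) (pos l q j) =
      mprod (l + m) (rmat a b l p) (mprod (l + m) (cf K) (cmat a b l q)) i j" .
qed

text \<open>Below the diagonal blocks the series is a polynomial of too small degree, so only
  \<open>p = q\<close> survives.\<close>

lemma gdet_one:
  assumes p: "p \<in> box l m" and q: "q \<in> box l m"
  shows "gdet 1 a b l p q = of_bool (p = q)"
proof -
  define e where "e i j =
    cf (1 * (hfps a (q j) * efps a (p i - 1)) * (hfps b i * efps b j)) (pos l p i) (pos l q j)" for i j
  have gdet: "gdet 1 a b l p q = fdet l e"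
    unfolding gdet_def e_def ..
  have anti: "antimono p" "antimono q"
    using p q by (auto simp: box_def)
  show ?thesis
  proof (cases "\<exists>k<l. q k < p k")
    case True
    then obtain k where k: "k < l" "q k < p k"
      by blast
    have "fdet l e = 0"
    proof (rule fdet_zero_block[OF k(1)])
      fix i j assume ij: "i \<le> k" "k \<le> j" "j < l"
      then have "q j < p i"
        using k antimonoD[OF anti(1) ij(1)] antimonoD[OF anti(2) ij(2)] by linarith
      then have "fdeg ((hfps a (q j) * efps a (p i - 1)) * (hfps b i * efps b j)) ((p i - 1 - q j) + (j - i))"
        using ij by (intro fdeg_mult fdeg_hfps_efps) auto
      \<comment> \<open>The right side is \<open>p i - q j + (j - i)\<close>: the degree is short by
        exactly one, owing to the index \<open>p i - 1\<close>.\<close>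
      moreover have "p i - 1 - q j + (j - i) < pos l p i - pos l q j"
        using ij \<open>q j < p i\<close> by (auto simp: pos_def)
      ultimately show "e i j = 0"
        by (simp add: e_def cf_def fdeg_def)
    qed
    then show ?thesis
      using k gdet by auto
  next
    case False
    then have le: "p k \<le> q k" if "k < l" for k
      using that by force
    have "fdet l e = (\<Prod>i<l. e i i)"
    proof (rule fdet_upper_triangular)
      fix i j assume ij: "j < i" "i < l"
      then have "p i \<le> q j"
        using antimonoD[OF anti(1), of j i] le[of j] by auto
      then have "pos l p i < pos l q j"
        using ij by (auto simp: pos_def)
      then show "e i j = 0"
        by (simp add: e_def cf_def)
    qed
    also have "\<dots> = of_bool (p = q)"
    proof (cases "p = q")
      case True
      then show ?thesis
        by (simp add: e_def cf_diag)
    next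
      case False
      then obtain i where "p i \<noteq> q i"
        by auto
      then have "i < l"
        using p q by (cases "i < l") (auto simp: box_def)
      then have "p i < q i"
        using le[of i] \<open>p i \<noteq> q i\<close> by auto
      then have "e i i = 0"
        by (simp add: e_def cf_def pos_def)
      then have "(\<Prod>i<l. e i i) = 0"
        using \<open>i < l\<close> by (intro prod_zero) auto
      then show ?thesis
        using False by simp
    qed
    finally show ?thesis
      using gdet by simp
  qed
qed

text \<open>The maximal minors of all \<open>rmat\<close> and all \<open>cmat\<close> form two
  square matrices \<open>P\<close> and \<open>Q\<close> over the same finite box. Orthogonality says
  that \<open>P Q\<close> is the identity; hence so is \<open>Q P\<close>, and this is what stands
  between the minors of \<open>u\<close> and of \<open>v\<close>.\<close>

lemma completeness:
  "(\<Sum>p\<in>box l m. fdet l (mprod (l + m) u (cmat a b l p)) * fdet l (mprod (l + m) (rmat a b l p) v)) =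
    fdet l (mprod (l + m) u v)"
proof -
  let ?B = "box l m"
  define P where "P p r = fdet l (\<lambda>i j. rmat a b l p i (pos l r j))" for p r
  define Q where "Q r p = fdet l (\<lambda>i j. cmat a b l p (pos l r i) j)" for r p
  define U where "U r = fdet l (\<lambda>i j. u i (pos l r j))" for r
  define V where "V r = fdet l (\<lambda>i j. v (pos l r i) j)" for r
  have PQ: "(\<Sum>r\<in>?B. P p r * Q r q) = of_bool (p = q)" if "p \<in> ?B" "q \<in> ?B" for p q
  proof -
    have "(\<Sum>r\<in>?B. P p r * Q r q) = fdet l (mprod (l + m) (rmat a b l p) (cmat a b l q))"
      unfolding P_def Q_def mprod_def by (rule cauchy_binet[symmetric])
    also have "\<dots> = gdet 1 a b l p q"
      unfolding gdet_eq_mprod[OF that(1)]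
      by (intro fdet_cong mprod_cong) (auto simp: mprod_cf_one)
    finally show ?thesis
      by (simp add: gdet_one[OF that])
  qed
  have QP: "(\<Sum>p\<in>?B. Q r p * P p s) = of_bool (r = s)" if "r \<in> ?B" "s \<in> ?B" for r s
    by (rule left_inverse_imp_right_inverse[OF finite_box PQ that])
  have "(\<Sum>p\<in>?B. fdet l (mprod (l + m) u (cmat a b l p)) * fdet l (mprod (l + m) (rmat a b l p) v)) =
      (\<Sum>p\<in>?B. (\<Sum>r\<in>?B. U r * Q r p) * (\<Sum>s\<in>?B. P p s * V s))"
    unfolding mprod_def cauchy_binet by (simp add: P_def Q_def U_def V_def)
  also have "\<dots> = (\<Sum>p\<in>?B. \<Sum>r\<in>?B. \<Sum>s\<in>?B. U r * V s * (Q r p * P p s))"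
    by (simp add: sum_product mult_ac)
  also have "\<dots> = (\<Sum>r\<in>?B. \<Sum>p\<in>?B. \<Sum>s\<in>?B. U r * V s * (Q r p * P p s))"
    by (rule sum.swap)
  also have "\<dots> = (\<Sum>r\<in>?B. \<Sum>s\<in>?B. \<Sum>p\<in>?B. U r * V s * (Q r p * P p s))"
    by (intro sum.cong refl sum.swap)
  also have "\<dots> = (\<Sum>r\<in>?B. \<Sum>s\<in>?B. U r * V s * of_bool (r = s))"
    by (intro sum.cong refl) (simp add: sum_distrib_left[symmetric] QP)
  also have "\<dots> = (\<Sum>r\<in>?B. \<Sum>s\<in>?B. if r = s then U r * V r else 0)"
    by (intro sum.cong refl) auto
  also have "\<dots> = (\<Sum>r\<in>?B. U r * V r)"
    by (simp add: finite_box)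
  also have "\<dots> = fdet l (mprod (l + m) u v)"
    unfolding mprod_def cauchy_binet by (simp add: U_def V_def)
  finally show ?thesis .
qed

text \<open>Evaluation of the polynomial \<open>efps x n\<close> at \<open>t = z\<close>. This value
  is the scalar that appears when one letter \<open>z\<close> is moved across.\<close>

lemma poly_efps: "(\<Sum>k\<le>n. efps x n $ k * z ^ k) = (\<Prod>t=1..n. 1 - x t * z)"
proof (induction n)
  case (Suc n)
  let ?E = "efps x n"
  have top: "?E $ Suc n = 0"
    using fdeg_efps[of x n] by (simp add: fdeg_def)
  have "efps x (Suc n) = lin (x (Suc n)) * ?E"
    by (simp add: efps_Suc mult.commute)
  then have "(\<Sum>k\<le>Suc n. efps x (Suc n) $ k * z ^ k) =
      (\<Sum>k\<le>Suc n. ?E $ k * z ^ k) - (\<Sum>k\<le>Suc n. (if k = 0 then 0 else x (Suc n) * ?E $ (k - 1)) * z ^ k)"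
    by (simp add: lin_mult_nth left_diff_distrib sum_subtractf)
  also have "(\<Sum>k\<le>Suc n. ?E $ k * z ^ k) = (\<Sum>k\<le>n. ?E $ k * z ^ k)"
    by (simp add: top)
  also have "(\<Sum>k\<le>Suc n. (if k = 0 then 0 else x (Suc n) * ?E $ (k - 1)) * z ^ k) =
      x (Suc n) * z * (\<Sum>k\<le>n. ?E $ k * z ^ k)"
    by (subst sum.atMost_Suc_shift) (simp add: sum_distrib_left mult_ac)
  finally show ?case
    unfolding Suc.IH by (simp add: left_diff_distrib mult.commute)
qed simp

text \<open>The last \<open>n\<close> rows of \<open>Q\<close> span the first \<open>n\<close> unit vectors.\<close>

definition ut_low :: "nat \<Rightarrow> nat \<Rightarrow> (nat \<Rightarrow> nat \<Rightarrow> 'r::comm_ring_1) \<Rightarrow> bool" where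
  "ut_low n l Q \<longleftrightarrow> n \<le> l \<and> (\<forall>r<n. Q (l - Suc r) r = 1 \<and> (\<forall>e>r. Q (l - Suc r) e = 0))"

text \<open>Elimination from the top: the entry of \<open>w\<close> at \<open>k\<close> is removed
  by row \<open>l - Suc k\<close>, which has 1 there and nothing beyond.\<close>

lemma ut_low_span:
  assumes Q: "ut_low n l Q" and "\<And>e. e \<ge> n \<Longrightarrow> w e = 0"
  shows "\<exists>c. \<forall>e. (\<Sum>i<l. c i * Q i e) = w e"
proof -
  have "\<exists>c. \<forall>e. (\<Sum>i<l. c i * Q i e) = w e" if "k \<le> n" "\<And>e. e \<ge> k \<Longrightarrow> w e = 0" for k w
    using that
  proof (induction k arbitrary: w)
    case 0
    then show ?case
      by (intro exI[of _ "\<lambda>_. 0"]) auto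
  next
    case (Suc k)
    define i where "i = l - Suc k"
    have i: "i < l" "Q i k = 1" "\<And>e. e > k \<Longrightarrow> Q i e = 0"
      using Q Suc.prems by (auto simp: ut_low_def i_def)
    have w': "w e - w k * Q i e = 0" if "e \<ge> k" for e
      using that i Suc.prems(2)[of e] by (cases "e = k") auto
    have "k \<le> n"
      using Suc.prems(1) by simp
    from Suc.IH[of "\<lambda>e. w e - w k * Q i e", OF this w'] obtain c where c: "\<forall>e. (\<Sum>t<l. c t * Q t e) = w e - w k * Q i e"
      by blast
    have "(\<Sum>t<l. (c t + (if t = i then w k else 0)) * Q t e) = w e" for e
    proof -
      have "(\<Sum>t<l. (c t + (if t = i then w k else 0)) * Q t e) =
          (\<Sum>t<l. c t * Q t e) + (\<Sum>t<l. if t = i then w k * Q i e else 0)"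
        unfolding sum.distrib[symmetric] by (intro sum.cong) (auto simp: distrib_right)
      then show ?thesis
        using i(1) c by simp
    qed
    then show ?case
      by (intro exI[of _ "\<lambda>t. c t + (if t = i then w k else 0)"] allI)
  qed
  then show ?thesis
    using assms(2) by blast
qed

text \<open>A lower triangular factor with unit diagonal keeps the shape, so letters can be moved
  across one by one.\<close>

lemma ut_low_mprod:
  assumes "ut_low n l Q" "n \<le> N" "F $ 0 = 1"
  shows "ut_low n l (mprod N Q (cf F))"
proof -
  have "mprod N Q (cf F) (l - Suc r) e = (if e = r then 1 else 0)" if "r < n" "e \<ge> r" for r e
  proof -
    have "mprod N Q (cf F) (l - Suc r) e = (\<Sum>k<N. if k = r then if e = r then 1 else 0 else 0)"
      unfolding mprod_def
    proof (intro sum.cong refl)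
      fix k assume "k \<in> {..<N}"
      consider "k < r" | "k = r" | "k > r"
        by linarith
      then show "Q (l - Suc r) k * cf F k e = (if k = r then if e = r then 1 else 0 else 0)"
        using assms that by cases (auto simp: ut_low_def cf_def)
    qed
    then show ?thesis
      using assms that by simp
  qed
  then show ?thesis
    using assms by (auto simp: ut_low_def)
qed

text \<open>Both products have the entry \<open>H $ (d - c)\<close> minus
  \<open>z * H $ (d + 1 - c)\<close>, except that the second lacks the subtracted term in row 0. The
  cut-off affects the first product only at \<open>d + 1 = N\<close>, where the lost term has order
  above \<open>size M\<close>.\<close>

lemma toeplitz_commutator:
  assumes H: "graded H" and N: "c + size M < N" and d: "d < N"
  shows "mcong M (mprod N (\<lambda>p q. cf H q p) (cf (lin z)) c d)
    (mprod N (cf (lin z)) (\<lambda>p q. cf H q p) c d - (if c = 0 then z * H $ Suc d else 0))"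
    (is "mcong M ?l ?r")
proof -
  have l: "?l = cf H d c - (if Suc d < N then z * cf H (Suc d) c else 0)"
  proof -
    have "?l = (\<Sum>k<N. (if k = d then cf H d c else 0) - (if k = Suc d then z * cf H (Suc d) c else 0))"
      unfolding mprod_def by (intro sum.cong) (auto simp: cf_def lin_nth)
    then show ?thesis
      using d by (simp add: sum_subtractf)
  qed
  have r: "mprod N (cf (lin z)) (\<lambda>p q. cf H q p) c d = cf H d c - (if c = 0 then 0 else z * cf H d (c - 1))"
  proof -
    have "mprod N (cf (lin z)) (\<lambda>p q. cf H q p) c d =
        (\<Sum>k<N. (if k = c then cf H d c else 0) - (if Suc k = c then z * cf H d (c - 1) else 0))"
      unfolding mprod_def by (intro sum.cong) (auto simp: cf_def lin_nth)
    also have "\<dots> = (\<Sum>k<N. if k = c then cf H d c else 0) - (\<Sum>k<N. if Suc k = c then z * cf H d (c - 1) else 0)"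
      by (rule sum_subtractf)
    also have "(\<Sum>k<N. if Suc k = c then z * cf H d (c - 1) else 0) =
        (if c = 0 then 0 else z * cf H d (c - 1))"
      using N by (cases c) auto
    finally show ?thesis
      using N by simp
  qed
  have r': "?r = cf H d c - z * cf H (Suc d) c"
    unfolding r by (cases c) (auto simp: cf_def)
  show ?thesis
  proof (cases "Suc d < N")
    case True
    then show ?thesis
      by (simp only: l r' if_True mcong_refl)
  next
    case False
    have "mord (Suc d - c) (cf H (Suc d) c)"
      using H by (rule mord_cf)
    moreover have "size M < Suc d - c"
      using False d N by auto
    ultimately have "mcong M (cf H (Suc d) c) 0"
      by (rule mcong_zero_of_mord)
    then have "mcong M (cf H d c - z * cf H (Suc d) c) (cf H d c - 0)"
      by (intro mcong_diff mcong_mult_zero) auto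
    then show ?thesis
      using False by (simp add: l r' mcong_sym)
  qed
qed

text \<open>The correction in the commutator of the two Toeplitz matrices is \<open>z\<close> times the matrix whose
  only nonzero row is \<open>(H $ 1, H $ 2, \<dots>)\<close>, at index 0. This row is a combination of the rows of \<open>W\<close>,
  hence the correction amounts to multiplying by a rank-one perturbation of the identity.\<close>

lemma exchange_lin:
  fixes x :: "nat \<Rightarrow> ('v, 'a::comm_ring_1) mps"
  assumes gr: "graded (hfps x n)" and Q: "ut_low n l Q" "n \<le> N"
    and low: "\<And>i e. i < l \<Longrightarrow> e > A \<Longrightarrow> Q i e = 0" and N: "A + size M < N"
  defines "Lt \<equiv> (\<lambda>p q. cf (hfps x n) q p)"
  shows "mcong M (fdet l (mprod N Q (mprod N Lt (mprod N (cf (lin z)) V))))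
    ((\<Prod>t=1..n. 1 - x t * z) * fdet l (mprod N Q (mprod N (cf (lin z)) (mprod N Lt V))))"
proof -
  define H where "H = hfps x n"
  define E where "E = efps x n"
  define W where "W = mprod N Q (mprod N (cf (lin z)) Lt)"
  \<comment> \<open>Because \<open>E * H = 1\<close>, this row times the transposed Toeplitz matrix
    of \<open>H\<close> is \<open>(H $ 1, H $ 2, ...)\<close>. The row \<open>f\<close> is
    \<open>f'\<close> times the inverse of the Toeplitz matrix of \<open>lin z\<close>.\<close>
  define f' where "f' c = - E $ Suc c" for c
  define f where "f d = (\<Sum>c<n. f' c * cf (geo z) c d)" for d
  have Etop: "E $ k = 0" if "k > n" for k
    using that fdeg_efps[of x n] by (simp add: E_def fdeg_def)
  have f_zero: "f d = 0" if "d \<ge> n" for d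
    using that by (auto simp: f_def cf_def intro!: sum.neutral)
  have f'_H: "(\<Sum>c<N. f' c * cf H d c) = H $ Suc d" if "d < N" for d
  proof -
    have "(E * H) $ Suc d = 0"
      using hfps_efps[of x n] by (simp add: E_def H_def mult.commute)
    then have "0 = (\<Sum>k=0..Suc d. E $ k * H $ (Suc d - k))"
      by (simp add: fps_mult_nth)
    also have "\<dots> = E $ 0 * H $ Suc d + (\<Sum>c=0..d. E $ Suc c * H $ (d - c))"
      by (subst sum.atLeast0_atMost_Suc_shift) simp
    also have "(\<Sum>c=0..d. E $ Suc c * H $ (d - c)) = - (\<Sum>c=0..d. f' c * cf H d c)"
      by (simp add: f'_def cf_def sum_negf)
    also have "(\<Sum>c=0..d. f' c * cf H d c) = (\<Sum>c<N. f' c * cf H d c)"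
      using that by (intro sum.mono_neutral_left) (auto simp: cf_def)
    finally show ?thesis
      by (simp add: E_def)
  qed
  have f_lin: "(\<Sum>d<N. f d * cf (lin z) d c) = f' c" if "c < N" for c
  proof -
    have "(\<Sum>d<N. f d * cf (lin z) d c) = (\<Sum>d<N. \<Sum>k<n. f' k * (cf (geo z) k d * cf (lin z) d c))"
      by (simp add: f_def sum_distrib_right mult.assoc)
    also have "\<dots> = (\<Sum>k<n. \<Sum>d<N. f' k * (cf (geo z) k d * cf (lin z) d c))"
      by (rule sum.swap)
    also have "\<dots> = (\<Sum>k<n. if k = c then f' c else 0)"
      using Q(2) by (intro sum.cong) (auto simp: sum_distrib_left[symmetric] cf_mult lin_geo cf_one)
    also have "\<dots> = f' c"
      using Etop[of "Suc c"] by (auto simp: f'_def)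
    finally show ?thesis .
  qed
  \<comment> \<open>\<open>f 0\<close> is the sum of the terms \<open>- E $ Suc c * z ^ c\<close>,
    so this is \<open>E\<close> evaluated at \<open>z\<close>.\<close>
  have f_0: "1 - z * f 0 = (\<Prod>t=1..n. 1 - x t * z)"
  proof -
    have "(\<Prod>t=1..n. 1 - x t * z) = (\<Sum>k\<le>n. E $ k * z ^ k)"
      by (simp add: E_def poly_efps)
    also have "\<dots> = (\<Sum>k<Suc n. E $ k * z ^ k)"
      by (simp add: lessThan_Suc_atMost)
    also have "\<dots> = 1 - z * f 0"
      by (subst sum.lessThan_Suc_shift)
        (simp add: f_def f'_def cf_def E_def sum_distrib_left sum_negf mult_ac)
    finally show ?thesis ..
  qed
  \<comment> \<open>\<open>E\<close> has degree at most \<open>n\<close>, so \<open>f\<close> lives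
    on the first \<open>n\<close> indices and is a combination of rows of \<open>Q\<close>.\<close>
  obtain c where c: "(\<Sum>i<l. c i * Q i e) = f e" for e
    using ut_low_span[OF Q(1), of f] f_zero by metis
  have cW: "(\<Sum>k<l. c k * W k d) = H $ Suc d" if "d < N" for d
  proof -
    have "(\<Sum>k<l. c k * W k d) = mprod l (\<lambda>i. c) (mprod N Q (mprod N (cf (lin z)) Lt)) 0 d"
      by (simp add: W_def mprod_def)
    also have "\<dots> = mprod N (mprod N (mprod l (\<lambda>i. c) Q) (cf (lin z))) Lt 0 d"
      by (simp only: mprod_assoc)
    also have "\<dots> = mprod N (\<lambda>i. f') Lt 0 d"
    proof (rule mprod_cong)
      fix k assume "k < N"
      then show "mprod N (mprod l (\<lambda>i. c) Q) (cf (lin z)) 0 k = f' k"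
        using f_lin c by (simp add: mprod_def)
    qed simp
    also have "\<dots> = H $ Suc d"
      using f'_H[OF that] by (simp add: mprod_def Lt_def H_def)
    finally show ?thesis .
  qed
  \<comment> \<open>The correction in row 0 enters row \<open>i\<close> of the product with weight
    \<open>Q i 0\<close>; by \<open>cW\<close> it is \<open>u i\<close> times the combination
    \<open>c\<close> of the rows of \<open>W\<close>.\<close>
  define u where "u i = z * Q i 0" for i
  have ent: "mcong M (mprod N Q (mprod N Lt (cf (lin z))) i d)
      (mprod l (\<lambda>i j. of_bool (i = j) - u i * c j) W i d)" if "i < l" "d < N" for i d
  proof -
    have "mcong M (mprod N Q (mprod N Lt (cf (lin z))) i d)
      (\<Sum>k<N. Q i k * (mprod N (cf (lin z)) Lt k d - (if k = 0 then z * H $ Suc d else 0)))"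
      unfolding mprod_def[of N Q]
    proof (rule mcong_sum)
      fix k assume "k \<in> {..<N}"
      show "mcong M (Q i k * mprod N Lt (cf (lin z)) k d)
        (Q i k * (mprod N (cf (lin z)) Lt k d - (if k = 0 then z * H $ Suc d else 0)))"
      proof (cases "k \<le> A")
        case True
        then show ?thesis
          unfolding Lt_def H_def using gr N that
          by (intro mcong_mult toeplitz_commutator) auto
      next
        case False
        then show ?thesis
          using low[OF that(1)] by simp
      qed
    qed
    also have "\<dots> = W i d - (\<Sum>k<N. if k = 0 then u i * H $ Suc d else 0)"
      unfolding W_def mprod_def[of N Q] right_diff_distrib sum_subtractf
      by (intro arg_cong2[of _ _ _ _ "(-)"] sum.cong refl) (auto simp: u_def mult_ac)
    also have "(\<Sum>k<N. if k = 0 then u i * H $ Suc d else 0) = u i * (\<Sum>k<l. c k * W k d)"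
      using N cW[OF that(2)] by auto
    also have "W i d - u i * (\<Sum>k<l. c k * W k d) =
        (\<Sum>k<l. if k = i then W i d else 0) - (\<Sum>k<l. u i * c k * W k d)"
      using that by (simp add: sum_distrib_left mult_ac)
    also have "\<dots> = mprod l (\<lambda>i j. of_bool (i = j) - u i * c j) W i d"
      unfolding mprod_def sum_subtractf[symmetric]
      by (intro sum.cong refl) (auto simp: left_diff_distrib)
    finally show ?thesis .
  qed
  have "mcong M (fdet l (mprod N (mprod N Q (mprod N Lt (cf (lin z)))) V))
      (fdet l (mprod N (mprod l (\<lambda>i j. of_bool (i = j) - u i * c j) W) V))"
    using ent by (intro mcong_fdet mcong_mprod) auto
  also have "fdet l (mprod N (mprod l (\<lambda>i j. of_bool (i = j) - u i * c j) W) V) =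
      fdet l (\<lambda>i j. of_bool (i = j) - u i * c j) * fdet l (mprod N W V)"
    by (simp add: mprod_assoc fdet_mprod)
  also have "fdet l (\<lambda>i j. of_bool (i = j) - u i * c j) = (\<Prod>t=1..n. 1 - x t * z)"
  proof -
    have "(\<Sum>i<l. c i * u i) = z * (\<Sum>i<l. c i * Q i 0)"
      by (simp add: u_def sum_distrib_left mult_ac)
    then show ?thesis
      by (simp add: fdet_id_minus_rank_one c f_0)
  qed
  finally show ?thesis
    by (simp add: W_def mprod_assoc)
qed

text \<open>Induction on the letters of \<open>y\<close>: each one passes by
  \<open>exchange_lin\<close>, and the Toeplitz factor of those that have passed is absorbed into
  \<open>Q\<close>. This is why \<open>Q\<close> is any matrix of the right shape and
  \<open>V\<close> is arbitrary.\<close>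

lemma exchange_efps:
  fixes x y :: "nat \<Rightarrow> ('v, 'a::comm_ring_1) mps"
  assumes gr: "graded (hfps x n)" and Q: "ut_low n l Q" "n \<le> N"
    and low: "\<And>i e. i < l \<Longrightarrow> e > A \<Longrightarrow> Q i e = 0" and N: "A + size M < N"
  defines "Lt \<equiv> (\<lambda>p q. cf (hfps x n) q p)"
  shows "mcong M (fdet l (mprod N Q (mprod N Lt (mprod N (cf (efps y k)) V))))
    ((\<Prod>t=1..n. \<Prod>s=1..k. 1 - x t * y s) * fdet l (mprod N Q (mprod N (cf (efps y k)) (mprod N Lt V))))"
proof (induction k arbitrary: V)
  case 0
  show ?case
    by (simp add: mprod_cf_one_right)
next
  case (Suc k)
  let ?z = "y (Suc k)"
  let ?c = "\<lambda>k. \<Prod>t=1..n. \<Prod>s=1..k. 1 - x t * y s"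
  let ?Q = "mprod N Q (cf (efps y k))"
  have low': "?Q i e = 0" if "i < l" "e > A" for i e
    unfolding mprod_def
  proof (intro sum.neutral ballI)
    fix k' show "Q i k' * cf (efps y k) k' e = 0"
      using low[OF that(1), of k'] that by (cases "k' > A") (auto simp: cf_def)
  qed
  have e1: "fdet l (mprod N Q (mprod N Lt (mprod N (cf (efps y (Suc k))) V))) =
      fdet l (mprod N Q (mprod N Lt (mprod N (cf (efps y k)) (mprod N (cf (lin ?z)) V))))"
    by (simp only: efps_Suc mprod_cf_mult_right)
  have e2: "mprod N Q (mprod N (cf (efps y k)) (mprod N Lt (mprod N (cf (lin ?z)) V))) =
      mprod N ?Q (mprod N Lt (mprod N (cf (lin ?z)) V))"
    by (rule mprod_assoc[symmetric])
  have e3: "mprod N ?Q (mprod N (cf (lin ?z)) (mprod N Lt V)) =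
      mprod N Q (mprod N (cf (efps y (Suc k))) (mprod N Lt V))"
    by (simp only: mprod_assoc[of N N Q] efps_Suc mprod_cf_mult_right)
  have e4: "?c (Suc k) = ?c k * (\<Prod>t=1..n. 1 - x t * ?z)"
    by (simp add: prod.distrib)
  have i1: "mcong M (fdet l (mprod N Q (mprod N Lt (mprod N (cf (efps y k)) (mprod N (cf (lin ?z)) V)))))
      (?c k * fdet l (mprod N ?Q (mprod N Lt (mprod N (cf (lin ?z)) V))))"
    unfolding e2[symmetric] by (rule Suc.IH)
  have i2: "mcong M (fdet l (mprod N ?Q (mprod N Lt (mprod N (cf (lin ?z)) V))))
      ((\<Prod>t=1..n. 1 - x t * ?z) * fdet l (mprod N Q (mprod N (cf (efps y (Suc k))) (mprod N Lt V))))"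
    unfolding Lt_def e3[unfolded Lt_def, symmetric]
    by (rule exchange_lin[OF gr ut_low_mprod[OF Q efps_nth_0] Q(2) low' N])
  show ?case
    unfolding e1 e4 mult.assoc by (rule mcong_trans[OF i1 mcong_mult[OF mcong_refl i2]])
qed

text \<open>This is \<open>exchange_efps\<close> with the Toeplitz matrix of \<open>hfps y k\<close>
  multiplied into both \<open>Q\<close> and \<open>V\<close>: it cancels \<open>efps y k\<close> on
  either side.\<close>

lemma exchange_hfps:
  fixes x y :: "nat \<Rightarrow> ('v, 'a::comm_ring_1) mps"
  assumes gr: "graded (hfps x n)" and Q: "ut_low n l Q" "n \<le> N"
    and low: "\<And>i e. i < l \<Longrightarrow> e > A \<Longrightarrow> Q i e = 0" and N: "A + size M < N"
  defines "Lt \<equiv> (\<lambda>p q. cf (hfps x n) q p)"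
  shows "mcong M ((\<Prod>t=1..n. \<Prod>s=1..k. 1 - x t * y s) * fdet l (mprod N Q (mprod N Lt (mprod N (cf (hfps y k)) V))))
    (fdet l (mprod N Q (mprod N (cf (hfps y k)) (mprod N Lt V))))"
proof -
  let ?c = "\<Prod>t=1..n. \<Prod>s=1..k. 1 - x t * y s"
  let ?h = "cf (hfps y k)" and ?e = "cf (efps y k)"
  have eh: "efps y k * hfps y k = 1" "hfps y k * efps y k = 1"
    using hfps_efps[of y k] by (simp_all add: mult.commute)
  have low': "mprod N Q ?h i e = 0" if "i < l" "e > A" for i e
    unfolding mprod_def
  proof (intro sum.neutral ballI)
    fix k' show "Q i k' * ?h k' e = 0"
      using low[OF that(1), of k'] that by (cases "k' > A") (auto simp: cf_def)
  qed
  have "mcong M (fdet l (mprod N (mprod N Q ?h) (mprod N Lt (mprod N ?e (mprod N ?h V)))))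
      (?c * fdet l (mprod N (mprod N Q ?h) (mprod N ?e (mprod N Lt (mprod N ?h V)))))"
    unfolding Lt_def
    by (rule exchange_efps[OF gr ut_low_mprod[OF Q hfps_nth_0] Q(2) low' N])
  moreover have "fdet l (mprod N (mprod N Q ?h) (mprod N Lt (mprod N ?e (mprod N ?h V)))) =
      fdet l (mprod N Q (mprod N ?h (mprod N Lt V)))"
    by (simp only: mprod_assoc mprod_cf_mult_right[symmetric] eh mprod_cf_one_right)
  moreover have "fdet l (mprod N (mprod N Q ?h) (mprod N ?e (mprod N Lt (mprod N ?h V)))) =
      fdet l (mprod N Q (mprod N Lt (mprod N ?h V)))"
    by (simp only: mprod_assoc mprod_cf_mult_right[symmetric] eh mprod_cf_one_right)
  ultimately show ?thesis
    by (simp add: mcong_sym)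
qed

text \<open>Zero parts occupy the lowest positions: row \<open>l - Suc r\<close> sits at position
  \<open>r\<close>, with the constant term 1 of \<open>rser\<close> on the diagonal.\<close>

lemma ut_low_rmat:
  assumes "n \<le> l" "\<And>i. i \<ge> l - n \<Longrightarrow> p i = 0"
  shows "ut_low n l (rmat a b l p)"
  using assms by (auto simp: ut_low_def rmat_def pos_def cf_def)

lemma rmat_low:
  assumes "p \<in> box l m" "i < l" "e > l + m"
  shows "rmat a b l p i e = 0"
  using pos_less[OF assms(1,2)] assms(3) by (simp add: rmat_def cf_def)

section \<open>Conjugation of partitions\<close>

text \<open>Both sides say that the cell \<open>(i, j)\<close> lies in the diagram: the rows longer
  than \<open>j\<close> form an initial segment, as \<open>p\<close> decreases, and its length is
  \<open>conj_part p j\<close>.\<close>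

lemma less_conj_part:
  assumes "antimono p" "finite {i. p i \<noteq> 0}"
  shows "i < conj_part p j \<longleftrightarrow> j < p i"
proof -
  have fin: "finite {i. j < p i}" for j
    by (rule finite_subset[OF _ assms(2)]) auto
  have down: "{i. j < p i} = {..<conj_part p j}"
  proof -
    have "i' \<in> {i. j < p i}" if "i \<in> {i. j < p i}" "i' \<le> i" for i i'
      using that antimonoD[OF assms(1), of i' i] by auto
    then have "\<exists>c. {i. j < p i} = {..<c}"
    proof (intro exI[of _ "LEAST c. c \<notin> {i. j < p i}"])
      let ?S = "{i. j < p i}"
      assume *: "\<And>i i'. i \<in> ?S \<Longrightarrow> i' \<le> i \<Longrightarrow> i' \<in> ?S"
      have ex: "\<exists>c. c \<notin> ?S"
        using fin ex_new_if_finite infinite_UNIV_nat by blast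
      show "?S = {..<LEAST c. c \<notin> ?S}"
      proof (rule equalityI; rule subsetI)
        fix i assume "i \<in> ?S"
        with * LeastI_ex[OF ex] have "\<not> (LEAST c. c \<notin> ?S) \<le> i"
          by blast
        then show "i \<in> {..<LEAST c. c \<notin> ?S}"
          by simp
      next
        fix i assume "i \<in> {..<LEAST c. c \<notin> ?S}"
        then show "i \<in> ?S"
          using not_less_Least by blast
      qed
    qed
    then obtain c where c: "{i. j < p i} = {..<c}"
      by blast
    then have "conj_part p j = c"
      unfolding conj_part_def by simp
    with c show ?thesis
      by simp
  qed
  then have "i \<in> {i. j < p i} \<longleftrightarrow> i \<in> {..<conj_part p j}"
    by (rule arg_cong)
  then show ?thesis
    by simp
qed

lemma box_antimonoD: "p \<in> box l m \<Longrightarrow> i \<le> j \<Longrightarrow> p j \<le> p i"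
  unfolding box_def by (auto elim!: antimonoD)

lemma box_finite_support:
  assumes "p \<in> box l m"
  shows "finite {i. p i \<noteq> 0}"
proof (rule finite_subset)
  show "{i. p i \<noteq> 0} \<subseteq> {..<l}"
  proof
    fix i assume "i \<in> {i. p i \<noteq> 0}"
    then show "i \<in> {..<l}"
      using assms by (cases "i < l") (auto simp: box_def)
  qed
qed simp

lemma less_conj_part_box: "p \<in> box l m \<Longrightarrow> i < conj_part p j \<longleftrightarrow> j < p i"
  by (rule less_conj_part[OF _ box_finite_support]) (auto simp: box_def)

lemma conj_part_box:
  assumes p: "p \<in> box l m"
  shows "conj_part p \<in> box m l"
  unfolding box_def
proof (intro CollectI conjI allI impI)
  show "antimono (conj_part p)"
  proof (rule antimonoI)
    fix i j :: nat assume "i \<le> j"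
    show "conj_part p j \<le> conj_part p i"
    proof (rule ccontr)
      assume "\<not> conj_part p j \<le> conj_part p i"
      then have "conj_part p i < conj_part p j"
        by simp
      then have "j < p (conj_part p i)"
        by (simp add: less_conj_part_box[OF p])
      then have "i < p (conj_part p i)"
        using \<open>i \<le> j\<close> by simp
      then show False
        by (simp add: less_conj_part_box[OF p, symmetric])
    qed
  qed
  have "\<not> 0 < conj_part p j" if "j \<ge> m" for j
    using that box_le[OF p, of 0] by (simp add: less_conj_part_box[OF p])
  then show "conj_part p j = 0" if "j \<ge> m" for j
    using that by auto
  have "\<not> l < conj_part p 0"
    using p by (simp add: less_conj_part_box[OF p] box_def)
  then show "conj_part p 0 \<le> l"
    by simp
qed

lemma nat_eqI_less: "(\<And>k. k < a \<longleftrightarrow> k < b) \<Longrightarrow> a = (b :: nat)"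
  by (metis less_irrefl nat_neq_iff)

lemma conj_conj_part_box:
  assumes p: "p \<in> box l m"
  shows "conj_part (conj_part p) = p"
proof
  fix i
  show "conj_part (conj_part p) i = p i"
    by (rule nat_eqI_less)
      (simp add: less_conj_part_box[OF p] less_conj_part_box[OF conj_part_box[OF p]])
qed

section \<open>Particles, holes and complementary minors\<close>

text \<open>The unoccupied positions of the Maya diagram of \<open>p\<close>.\<close>

definition hole :: "nat \<Rightarrow> (nat \<Rightarrow> nat) \<Rightarrow> nat \<Rightarrow> nat" where
  "hole l p j = l + j - conj_part p j"

lemma hole_plus_conj:
  assumes "p \<in> box l m"
  shows "hole l p j + conj_part p j = l + j"
  using box_le[OF conj_part_box[OF assms], of j] by (simp add: hole_def)

lemma hole_less:
  assumes "p \<in> box l m" "j < m"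
  shows "hole l p j < l + m"
  using assms(2) by (simp add: hole_def)

lemma hole_strict_mono:
  assumes p: "p \<in> box l m" and "j < k"
  shows "hole l p j < hole l p k"
proof -
  have "conj_part p k \<le> conj_part p j"
    using box_antimonoD[OF conj_part_box[OF p]] \<open>j < k\<close> by simp
  then show ?thesis
    using hole_plus_conj[OF p, of j] hole_plus_conj[OF p, of k] \<open>j < k\<close> by linarith
qed

text \<open>The signed difference of particle and hole is
  \<open>(p i - j) + (conj_part p j - i) - 1\<close>: the hook length if \<open>(i, j)\<close> is a
  cell of the diagram, and negative otherwise.\<close>

lemma hole_less_pos:
  assumes p: "p \<in> box l m" and "i < l"
  shows "j < p i \<Longrightarrow> hole l p j < pos l p i" and "p i \<le> j \<Longrightarrow> pos l p i < hole l p j"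
proof -
  note h = hole_plus_conj[OF p, of j]
  show "hole l p j < pos l p i" if "j < p i"
  proof -
    have "i < conj_part p j"
      using that by (simp add: less_conj_part_box[OF p])
    then show ?thesis
      using that h \<open>i < l\<close> by (simp add: pos_def)
  qed
  show "pos l p i < hole l p j" if "p i \<le> j"
  proof -
    have "\<not> i < conj_part p j"
      using that by (simp add: less_conj_part_box[OF p])
    then show ?thesis
      using that h \<open>i < l\<close> by (simp add: pos_def)
  qed
qed

text \<open>Particles first, in decreasing order, then holes in increasing order; the identity
  beyond the interval is what \<open>permutes\<close> demands.\<close>

definition maya :: "nat \<Rightarrow> nat \<Rightarrow> (nat \<Rightarrow> nat) \<Rightarrow> nat \<Rightarrow> nat" where
  "maya l m p r = (if r < l then pos l p r else if r < l + m then hole l p (r - l) else r)"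

lemma maya_permutes:
  assumes p: "p \<in> box l m"
  shows "maya l m p permutes {0..<l + m}"
proof (rule bij_imp_permutes)
  have anti: "antimono p"
    using p by (simp add: box_def)
  have "maya l m p r \<noteq> maya l m p s" if "r < s" "s < l + m" for r s
  proof -
    consider "s < l" | "r < l" "l \<le> s" | "l \<le> r"
      by linarith
    then show ?thesis
    proof cases
      case 1
      then show ?thesis
        using pos_strict_antimono[OF anti that(1), of l] that by (simp add: maya_def)
    next
      case 2
      then show ?thesis
        using hole_less_pos[OF p, of r "s - l"] that by (cases "s - l < p r") (auto simp: maya_def)
    next
      case 3
      then have "hole l p (r - l) < hole l p (s - l)"
        using that by (intro hole_strict_mono[OF p]) auto
      then show ?thesis
        using 3 that by (simp add: maya_def)
    qed
  qed
  then have inj: "inj_on (maya l m p) {0..<l + m}"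
    by (intro linorder_inj_onI') auto
  moreover have "maya l m p ` {0..<l + m} \<subseteq> {0..<l + m}"
    using pos_less[OF p] hole_less[OF p] by (auto simp: maya_def)
  ultimately have "maya l m p ` {0..<l + m} = {0..<l + m}"
    by (intro endo_inj_surj) auto
  with inj show "bij_betw (maya l m p) {0..<l + m} {0..<l + m}"
    by (simp add: bij_betw_def)
qed (auto simp: maya_def)

lemma zero_box [simp]: "(\<lambda>_. 0) \<in> box l m"
  by (auto simp: box_def antimono_def)

lemma conj_part_zero: "conj_part (\<lambda>_. 0) j = 0"
  by (simp add: conj_part_def)

text \<open>The last cell of the last nonzero row is always a removable corner.\<close>

lemma ex_remove_box:
  assumes p: "p \<in> box l m" and nz: "p \<noteq> (\<lambda>_. 0)"
  shows "\<exists>i<l. 0 < p i \<and> p(i := p i - 1) \<in> box l m"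
proof -
  have fin: "finite {i. p i \<noteq> 0}"
    using p by (rule box_finite_support)
  have ne: "{i. p i \<noteq> 0} \<noteq> {}"
    using nz by auto
  define i where "i = Max {i. p i \<noteq> 0}"
  have i: "p i \<noteq> 0" "\<And>k. k > i \<Longrightarrow> p k = 0"
    using Max_in[OF fin ne] Max_ge[OF fin] unfolding i_def by force+
  have "i < l"
    using i(1) p by (cases "i < l") (auto simp: box_def)
  moreover have "antimono (p(i := p i - 1))"
  proof (rule antimonoI)
    fix a b :: nat assume "a \<le> b"
    then have "p b \<le> p a"
      by (rule box_antimonoD[OF p])
    then show "(p(i := p i - 1)) b \<le> (p(i := p i - 1)) a"
      using \<open>a \<le> b\<close> i(2)[of b] by (cases "a = i"; cases "b = i") auto
  qed
  ultimately show ?thesis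
    using p i(1) by (intro exI[of _ i]) (auto simp: box_def)
qed

text \<open>Removing a corner exchanges a particle with the hole just below it, which composes the
  permutation with an adjacent transposition; induction on the number of cells. The sign for the
  empty partition stays unevaluated: it will occur twice and cancel.\<close>

lemma sign_maya:
  assumes "p \<in> box l m"
  shows "sign (maya l m p) = (-1) ^ (\<Sum>j<m. conj_part p j) * sign (maya l m (\<lambda>_. 0))"
  using assms
proof (induction "\<Sum>i<l. p i" arbitrary: p rule: less_induct)
  case (less p)
  show ?case
  proof (cases "p = (\<lambda>_. 0)")
    case True
    then show ?thesis
      by (simp add: conj_part_zero)
  next
    case False
    note p = less.prems
    obtain i where i: "i < l" "0 < p i" "p(i := p i - 1) \<in> box l m"
      using ex_remove_box[OF p False] by blast
    define p' where "p' = p(i := p i - 1)"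
    have p': "p' \<in> box l m"
      using i by (simp add: p'_def)
    \<comment> \<open>The column of the removed cell: among the holes only the one with this index
      moves.\<close>
    define j where "j = p i - 1"
    have "j < m"
      using box_le[OF p, of i] i by (simp add: j_def)
    have conj': "conj_part p t = (if t = j then Suc (conj_part p' t) else conj_part p' t)" for t
    proof (cases "t = j")
      case True
      have "conj_part p j = Suc i"
      proof (rule nat_eqI_less)
        fix k
        have "j < p k \<longleftrightarrow> k \<le> i"
        proof
          assume "j < p k"
          show "k \<le> i"
          proof (rule ccontr)
            assume "\<not> k \<le> i"
            then have "p' k \<le> p' i" "p' k = p k" "p' i = j"
              using box_antimonoD[OF p', of i k] by (auto simp: p'_def j_def)
            then show False
              using \<open>j < p k\<close> by simp
          qed
        next
          assume "k \<le> i"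
          then have "p i \<le> p k"
            using box_antimonoD[OF p, of k i] by simp
          then show "j < p k"
            using i(2) by (simp add: j_def)
        qed
        then show "k < conj_part p j \<longleftrightarrow> k < Suc i"
          by (simp add: less_conj_part_box[OF p] less_Suc_eq_le)
      qed
      moreover have "conj_part p' j = i"
      proof (rule nat_eqI_less)
        fix k
        have "j < p' k \<longleftrightarrow> k < i"
        proof
          assume "j < p' k"
          show "k < i"
          proof (rule ccontr)
            assume "\<not> k < i"
            then have "p' k \<le> p' i" "p' i = j"
              using box_antimonoD[OF p', of i k] by (auto simp: p'_def j_def)
            then show False
              using \<open>j < p' k\<close> by simp
          qed
        next
          assume "k < i"
          then have "p i \<le> p k"
            using box_antimonoD[OF p, of k i] by simp
          then show "j < p' k"
            using i(2) \<open>k < i\<close> by (simp add: j_def p'_def)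
        qed
        then show "k < conj_part p' j \<longleftrightarrow> k < i"
          by (simp add: less_conj_part_box[OF p'])
      qed
      ultimately show ?thesis
        using True by simp
    next
      case False
      have "conj_part p t = conj_part p' t"
      proof (rule nat_eqI_less)
        fix k
        have "t < p k \<longleftrightarrow> t < p' k"
          using False i(2) by (auto simp: p'_def j_def)
        then show "k < conj_part p t \<longleftrightarrow> k < conj_part p' t"
          by (simp add: less_conj_part_box[OF p] less_conj_part_box[OF p'])
      qed
      then show ?thesis
        using False by simp
    qed
    define c where "c = pos l p' i"
    have pc: "pos l p i = Suc c"
      using i by (simp add: c_def pos_def p'_def)
    have "hole l p j = c" "hole l p' j = Suc c"
    proof -
      have "hole l p j + Suc (conj_part p' j) = l + j" "hole l p' j + conj_part p' j = l + j"
        using hole_plus_conj[OF p, of j] hole_plus_conj[OF p', of j] conj'[of j] by simp_all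
      then have *: "hole l p' j = Suc (hole l p j)"
        by simp
      have "hole l p j < pos l p i" "pos l p' i < hole l p' j"
        using hole_less_pos(1)[OF p i(1), of j] hole_less_pos(2)[OF p' i(1), of j] i(2)
        by (simp_all add: j_def p'_def)
      then show "hole l p j = c" "hole l p' j = Suc c"
        using * pc c_def by simp_all
    qed
    note holes = this
    have perm': "maya l m p' permutes {0..<l + m}"
      by (rule maya_permutes[OF p'])
    have inj': "r = s" if "maya l m p' r = maya l m p' s" for r s
      using permutes_inj[OF perm'] that by (auto dest: injD)
    have at: "maya l m p' i = c" "maya l m p' (l + j) = Suc c" "maya l m p i = Suc c" "maya l m p (l + j) = c"
      using i(1) \<open>j < m\<close> holes pc by (auto simp: maya_def c_def)
    have "maya l m p = transpose c (Suc c) \<circ> maya l m p'"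
    proof
      fix r
      consider "r = i" | "r = l + j" | "r \<noteq> i" "r \<noteq> l + j"
        by blast
      then show "maya l m p r = (transpose c (Suc c) \<circ> maya l m p') r"
      proof cases
        case 3
        then have "maya l m p' r \<noteq> c" "maya l m p' r \<noteq> Suc c"
          using inj'[of r i] inj'[of r "l + j"] at by auto
        moreover have "maya l m p r = maya l m p' r"
          using 3 conj'[of "r - l"] by (auto simp: maya_def pos_def hole_def p'_def)
        ultimately show ?thesis
          by simp
      qed (use at in auto)
    qed
    then have "sign (maya l m p) = - sign (maya l m p')"
      using permutes_imp_permutation[OF _ perm']
      by (simp add: sign_compose permutation_swap_id sign_swap_id)
    moreover have "(\<Sum>t<l. p' t) < (\<Sum>t<l. p t)"
      using i by (intro sum_strict_mono_ex1) (auto simp: p'_def intro!: bexI[of _ i])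
    then have "sign (maya l m p') = (-1) ^ (\<Sum>j<m. conj_part p' j) * sign (maya l m (\<lambda>_. 0))"
      by (rule less.hyps[OF _ p'])
    moreover have "(\<Sum>t<m. conj_part p t) = Suc (\<Sum>t<m. conj_part p' t)"
    proof -
      have "(\<Sum>t<m. conj_part p t) = (\<Sum>t<m. conj_part p' t + (if t = j then 1 else 0))"
        by (intro sum.cong) (auto simp: conj')
      then show ?thesis
        using \<open>j < m\<close> by (simp add: sum.distrib)
    qed
    ultimately show ?thesis
      by simp
  qed
qed

text \<open>Sorting the rows by the column of their pivot gives a lower unitriangular
  matrix.\<close>

lemma fdet_permuted_unitriangular:
  assumes perm: "\<pi> permutes {0..<n}"
    and "\<And>r. r < n \<Longrightarrow> f r (\<pi> r) = 1" "\<And>r e. r < n \<Longrightarrow> \<pi> r < e \<Longrightarrow> e < n \<Longrightarrow> f r e = 0"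
  shows "fdet n f = of_int (sign \<pi>)"
proof -
  define g where "g s = f (inv_into UNIV \<pi> s)" for s
  have inv_less: "inv_into UNIV \<pi> s < n" if "s < n" for s
    using permutes_in_image[OF permutes_inv[OF perm], of s] that by simp
  have "fdet n f = fdet n (\<lambda>i j. g (\<pi> i) j)"
    by (simp add: g_def permutes_inverses[OF perm])
  also have "\<dots> = of_int (sign \<pi>) * fdet n g"
    by (rule fdet_permute_rows[OF perm])
  also have "fdet n g = (\<Prod>s<n. g s s)"
    using assms(3)[OF inv_less] by (intro fdet_lower_triangular) (auto simp: g_def permutes_inverses[OF perm])
  also have "\<dots> = 1"
    using assms(2)[OF inv_less] by (intro prod.neutral) (auto simp: g_def permutes_inverses[OF perm])
  finally show ?thesis
    by simp
qed

text \<open>Jacobi's complementary minor identity in disguise: both determinants are, up to sign, the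
  determinant of the square matrix \<open>Z\<close> formed by the columns of \<open>q\<close> and of the holes of \<open>p\<close>.\<close>

lemma gdet_complement:
  assumes p: "p \<in> box l m" and q: "q \<in> box l m" and K: "K' * K = 1" "K' $ 0 = 1"
  shows "gdet K a b l p q = of_int (sign (maya l m p)) * of_int (sign (maya l m q)) *
    fdet m (\<lambda>j k. cf (hfps b (conj_part q j) * efps a j * K' * (hfps a k * efps b (conj_part p k - 1)))
      (hole l q j) (hole l p k))"
proof -
  define N where "N = l + m"
  define r where "r i = efps a (p i - 1) * hfps b i" for i
  define c where "c i = hfps a (q i) * efps b i" for i
  define d where "d k = hfps a k * efps b (conj_part p k - 1)" for k
  define e where "e j = hfps b (conj_part q j) * efps a j" for j
  define Z where "Z f t = (if t < l then cf (K * c t) f (pos l q t) else cf (d (t - l)) f (hole l p (t - l)))" for f t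
  \<comment> \<open>\<open>P\<close> and \<open>Q\<close> are permuted unitriangular, so their
    determinants are the signs of the Maya permutations of \<open>p\<close> and \<open>q\<close>.
    The products \<open>P Z\<close> and \<open>Q Z\<close> are block triangular, and each leaves one
    of the two determinants.\<close>
  define P where "P s f = (if s < l then cf (r s) (pos l p s) f else cf 1 (hole l p (s - l)) f)" for s f
  define Q where "Q s f = (if s < l then cf K' (pos l q s) f else cf (e (s - l) * K') (hole l q (s - l)) f)" for s f
  have posN: "pos l p s < N" "pos l q s < N" if "s < l" for s
    using pos_less[OF p that] pos_less[OF q that] by (simp_all add: N_def)
  have holeN: "hole l p k < N" "hole l q k < N" if "k < m" for k
    using hole_less[OF p that] hole_less[OF q that] by (simp_all add: N_def)
  \<comment> \<open>On a cell of the diagram the degree is the hook length minus one, so the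
    coefficient at the hook length is zero; elsewhere the entry lies above the diagonal.\<close>
  have orth1: "cf (r i * d k) (pos l p i) (hole l p k) = 0" if "i < l" "k < m" for i k
  proof (cases "k < p i")
    case True
    then have ik: "i < conj_part p k"
      by (simp add: less_conj_part_box[OF p])
    have "r i * d k = (hfps a k * efps a (p i - 1)) * (hfps b i * efps b (conj_part p k - 1))"
      by (simp add: r_def d_def mult_ac)
    moreover have "fdeg \<dots> ((p i - 1 - k) + (conj_part p k - 1 - i))"
      using True ik by (intro fdeg_mult fdeg_hfps_efps) auto
    moreover have "(p i - 1 - k) + (conj_part p k - 1 - i) < pos l p i - hole l p k"
      using True ik that hole_plus_conj[OF p, of k] by (simp add: pos_def)
    ultimately show ?thesis
      by (simp add: cf_def fdeg_def)
  next
    case False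
    then have "pos l p i < hole l p k"
      by (intro hole_less_pos[OF p that(1)]) simp
    then show ?thesis
      by (simp add: cf_def)
  qed
  \<comment> \<open>Outside the diagram of \<open>q\<close> the distance from particle to hole again
    exceeds the degree by one.\<close>
  have orth2: "cf (e j * c i) (hole l q j) (pos l q i) = 0" if "i < l" "j < m" for i j
  proof (cases "j < q i")
    case True
    then have "hole l q j < pos l q i"
      by (intro hole_less_pos[OF q that(1)])
    then show ?thesis
      by (simp add: cf_def)
  next
    case False
    then have ik: "\<not> i < conj_part q j"
      by (simp add: less_conj_part_box[OF q])
    have "e j * c i = (hfps a (q i) * efps a j) * (hfps b (conj_part q j) * efps b i)"
      by (simp add: e_def c_def mult_ac)
    moreover have "fdeg \<dots> ((j - q i) + (i - conj_part q j))"
      using False ik by (intro fdeg_mult fdeg_hfps_efps) auto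
    moreover have "(j - q i) + (i - conj_part q j) < hole l q j - pos l q i"
      using False ik that hole_plus_conj[OF q, of j] by (simp add: pos_def)
    ultimately show ?thesis
      by (simp add: cf_def fdeg_def)
  qed
  have Zcol: "mprod N (\<lambda>s. cf F u) Z s t = (if t < l then cf (F * (K * c t)) u (pos l q t)
      else cf (F * d (t - l)) u (hole l p (t - l)))" if "u < N" for F u s t
    unfolding mprod_def Z_def by (simp add: cf_mult[OF that])
  have "fdet N P = of_int (sign (maya l m p))"
    unfolding N_def by (rule fdet_permuted_unitriangular[OF maya_permutes[OF p]])
      (auto simp: P_def maya_def cf_diag r_def, auto simp: cf_def)
  moreover have "fdet N Q = of_int (sign (maya l m q))"
    unfolding N_def by (rule fdet_permuted_unitriangular[OF maya_permutes[OF q]])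
      (auto simp: Q_def maya_def cf_diag e_def K(2), auto simp: cf_def)
  moreover have "fdet N (mprod N P Z) = gdet K a b l p q"
  proof -
    have PZ: "mprod N P Z s t = (if s < l then mprod N (\<lambda>s'. cf (r s) (pos l p s)) Z 0 t
        else mprod N (\<lambda>s'. cf 1 (hole l p (s - l))) Z 0 t)" for s t
      by (simp add: P_def mprod_def)
    have "fdet N (mprod N P Z) = fdet l (mprod N P Z)"
      unfolding N_def
    proof (rule fdet_leading_block)
      fix i j assume ij: "l \<le> j" "j < l + m" "i < j"
      then have lm: "i - l < m" "j - l < m"
        by linarith+
      show "mprod (l + m) P Z i j = 0"
      proof (cases "i < l")
        case True
        then show ?thesis
          using ij lm posN orth1[of i "j - l"] unfolding N_def[symmetric] by (simp add: PZ Zcol)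
      next
        case False
        then have "hole l p (i - l) < hole l p (j - l)"
          using ij by (intro hole_strict_mono[OF p]) auto
        then show ?thesis
          using ij lm holeN False unfolding N_def[symmetric] by (simp add: PZ Zcol cf_def)
      qed
    next
      fix j assume j: "l \<le> j" "j < l + m"
      then have "j - l < m"
        by linarith
      then show "mprod (l + m) P Z j j = 1"
        using j holeN unfolding N_def[symmetric] by (simp add: PZ Zcol cf_diag d_def)
    qed
    also have "\<dots> = gdet K a b l p q"
      unfolding gdet_def
    proof (rule fdet_cong)
      fix i j assume ij: "i < l" "j < l"
      have "r i * (K * c j) = K * (hfps a (q j) * efps a (p i - 1)) * (hfps b i * efps b j)"
        by (simp add: r_def c_def mult_ac)
      then show "mprod N P Z i j = cf (K * (hfps a (q j) * efps a (p i - 1)) * (hfps b i * efps b j)) (pos l p i) (pos l q j)"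
        using ij posN by (simp add: PZ Zcol)
    qed
    finally show ?thesis .
  qed
  moreover have "fdet N (mprod N Q Z) = fdet m (\<lambda>j k. cf (e j * K' * d k) (hole l q j) (hole l p k))"
  proof -
    have QZ: "mprod N Q Z s t = (if s < l then mprod N (\<lambda>s'. cf K' (pos l q s)) Z 0 t
        else mprod N (\<lambda>s'. cf (e (s - l) * K') (hole l q (s - l))) Z 0 t)" for s t
      by (simp add: Q_def mprod_def)
    have canc: "K' * (K * c t) = c t" "e j * K' * (K * c t) = e j * c t" for t j
      using K(1) by (simp_all flip: mult.assoc) (simp add: mult.assoc)
    have "fdet N (mprod N Q Z) = fdet m (\<lambda>i j. mprod N Q Z (l + i) (l + j))"
      unfolding N_def
    proof (rule fdet_trailing_block)
      fix i j assume ij: "j < l" "j < i" "i < l + m"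
      then have lm: "i \<ge> l \<Longrightarrow> i - l < m"
        by linarith
      show "mprod (l + m) Q Z i j = 0"
      proof (cases "i < l")
        case True
        have "antimono q"
          using q by (simp add: box_def)
        then have "pos l q i < pos l q j"
          using ij True by (intro pos_strict_antimono)
        then show ?thesis
          using ij posN True unfolding N_def[symmetric] by (simp add: QZ Zcol canc cf_def)
      next
        case False
        then show ?thesis
          using ij lm holeN orth2[of j "i - l"] unfolding N_def[symmetric] by (simp add: QZ Zcol canc)
      qed
    next
      fix j assume "j < l"
      then show "mprod (l + m) Q Z j j = 1"
        using posN unfolding N_def[symmetric] by (simp add: QZ Zcol canc) (simp add: cf_diag c_def)
    qed
    also have "\<dots> = fdet m (\<lambda>j k. cf (e j * K' * d k) (hole l q j) (hole l p k))"
      using holeN by (intro fdet_cong) (simp add: QZ Zcol)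
    finally show ?thesis .
  qed
  ultimately have 1: "gdet K a b l p q = of_int (sign (maya l m p)) * fdet N Z"
    and 2: "fdet m (\<lambda>j k. cf (e j * K' * d k) (hole l q j) (hole l p k)) = of_int (sign (maya l m q)) * fdet N Z"
    by (simp_all add: fdet_mprod)
  have "of_int (sign (maya l m q)) * (of_int (sign (maya l m q)) * fdet N Z) = fdet N Z"
    by (simp add: sign_def)
  then show ?thesis
    using 1 2 by (simp add: e_def d_def mult.assoc)
qed

text \<open>The substitution of \<open>-t\<close> for \<open>t\<close>, which negates all letters of
  an alphabet.\<close>

definition fneg :: "'r::comm_ring_1 fps \<Rightarrow> 'r fps" where
  "fneg F = Abs_fps (\<lambda>n. (-1) ^ n * F $ n)"

lemma fneg_nth: "fneg F $ n = (-1) ^ n * F $ n"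
  by (simp add: fneg_def)

lemma fneg_mult: "fneg (F * G) = fneg F * fneg G"
proof (rule fps_ext)
  fix n
  have "(-1) ^ n * (F $ i * G $ (n - i)) = (-1) ^ i * F $ i * ((-1) ^ (n - i) * G $ (n - i))"
    if "i \<in> {0..n}" for i
  proof -
    have "(-1 :: 'a) ^ n = (-1) ^ i * (-1) ^ (n - i)"
      using that by (simp flip: power_add)
    then show ?thesis
      by (simp only: mult_ac)
  qed
  then show "fneg (F * G) $ n = (fneg F * fneg G) $ n"
    by (simp add: fneg_nth fps_mult_nth sum_distrib_left)
qed

lemma fneg_hfps: "fneg (hfps a k) = hfps (\<lambda>t. - a t) k"
proof (induction k)
  case (Suc k)
  have "fneg (geo v) = geo (- v)" for v :: 'a
    by (rule fps_ext) (simp add: fneg_nth flip: power_mult_distrib)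
  with Suc show ?case
    by (simp add: hfps_Suc fneg_mult)
qed (auto simp: fneg_def fps_eq_iff)

lemma fneg_efps: "fneg (efps a k) = efps (\<lambda>t. - a t) k"
proof (induction k)
  case (Suc k)
  have "fneg (lin v) = lin (- v)" for v :: 'a
    by (rule fps_ext) (simp add: fneg_nth lin_nth)
  with Suc show ?case
    by (simp add: efps_Suc fneg_mult)
qed (auto simp: fneg_def fps_eq_iff)

text \<open>Conjugation by the diagonal matrix of the signs \<open>(-1) ^ u\<close>.\<close>

lemma cf_fneg: "cf F u v = (-1) ^ u * (-1) ^ v * cf (fneg F) u v"
proof (cases "v \<le> u")
  case True
  then have "u + v + (u - v) = 2 * u"
    by simp
  then have "(-1) ^ u * (-1) ^ v * ((-1) ^ (u - v) :: 'a) = 1"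
    by (metis power_add power_minus1_even)
  then show ?thesis
    using True by (simp add: cf_def fneg_nth flip: mult.assoc)
qed (simp add: cf_def)

lemma fdet_scale: "fdet n (\<lambda>i j. s i * t j * f i j) = (\<Prod>i<n. s i * t i) * fdet n f"
proof -
  have "fdet n (\<lambda>i j. s i * t j * f i j) = (\<Sum>\<pi> | \<pi> permutes {0..<n}. (\<Prod>i<n. s i * t i) * (signof \<pi> * (\<Prod>i=0..<n. f i (\<pi> i))))"
    unfolding fdet_leibniz
  proof (intro sum.cong refl)
    fix \<pi> assume "\<pi> \<in> {\<pi>. \<pi> permutes {0..<n}}"
    then have \<pi>: "\<pi> permutes {0..<n}"
      by simp
    have "(\<Prod>i=0..<n. t (\<pi> i)) = (\<Prod>i=0..<n. t i)"
      using prod.permute[OF \<pi>, of t] by (simp add: comp_def)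
    then show "signof \<pi> * (\<Prod>i=0..<n. s i * t (\<pi> i) * f i (\<pi> i)) =
        (\<Prod>i<n. s i * t i) * (signof \<pi> * (\<Prod>i=0..<n. f i (\<pi> i)))"
      by (simp add: prod.distrib lessThan_atLeast0 mult_ac)
  qed
  then show ?thesis
    by (simp add: fdet_leibniz sum_distrib_left)
qed

text \<open>Counted from the other end of the interval, the holes of \<open>p\<close> are the
  particles of its conjugate. This reflection transposes the minor from
  \<open>gdet_complement\<close>; substituting \<open>-t\<close> negates the two sequences, and the
  signs so produced are those of \<open>sign_maya\<close>.\<close>

lemma gdet_conj:
  assumes p: "p \<in> box l m" and q: "q \<in> box l m" and K: "K' * K = 1" "K' $ 0 = 1"
  shows "gdet K a b l p q =
    gdet (fneg K') (\<lambda>t. - b t) (\<lambda>t. - a t) m (conj_part p) (conj_part q)"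
proof -
  define F where "F j k = hfps b (conj_part q j) * efps a j * K' * (hfps a k * efps b (conj_part p k - 1))" for j k
  define s :: 'a where "s = (\<Prod>j<m. (-1) ^ hole l q j * (-1) ^ hole l p j)"
  have "fdet m (\<lambda>j k. cf (F j k) (hole l q j) (hole l p k)) =
      s * fdet m (\<lambda>j k. cf (fneg (F j k)) (hole l q j) (hole l p k))"
    unfolding s_def fdet_scale[symmetric] by (intro fdet_cong) (rule cf_fneg)
  also have "fdet m (\<lambda>j k. cf (fneg (F j k)) (hole l q j) (hole l p k)) =
      fdet m (\<lambda>k j. cf (fneg (F j k)) (hole l q j) (hole l p k))"
    by (rule fdet_transpose[symmetric])
  also have "\<dots> = gdet (fneg K') (\<lambda>t. - b t) (\<lambda>t. - a t) m (conj_part p) (conj_part q)"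
    unfolding gdet_def
  proof (rule fdet_cong)
    fix k j assume kj: "k < m" "j < m"
    have eq: "fneg (F j k) = fneg K' * (hfps (\<lambda>t. - b t) (conj_part q j) * efps (\<lambda>t. - b t) (conj_part p k - 1)) *
        (hfps (\<lambda>t. - a t) k * efps (\<lambda>t. - a t) j)"
      by (simp add: F_def fneg_mult fneg_hfps fneg_efps mult_ac)
    have "hole l q j + pos m (conj_part q) j = l + m - 1" "hole l p k + pos m (conj_part p) k = l + m - 1"
      using hole_plus_conj[OF q, of j] hole_plus_conj[OF p, of k] kj by (auto simp: pos_def)
    then have "cf f (hole l q j) (hole l p k) = cf f (pos m (conj_part p) k) (pos m (conj_part q) j)" for f :: "'a fps"
      unfolding cf_def by (intro if_cong arg_cong[of _ _ "fps_nth f"]) auto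
    then show "cf (fneg (F j k)) (hole l q j) (hole l p k) =
      cf (fneg K' * (hfps (\<lambda>t. - b t) (conj_part q j) * efps (\<lambda>t. - b t) (conj_part p k - 1)) *
        (hfps (\<lambda>t. - a t) k * efps (\<lambda>t. - a t) j)) (pos m (conj_part p) k) (pos m (conj_part q) j)"
      unfolding eq .
  qed
  finally have det: "gdet K a b l p q = of_int (sign (maya l m p)) * of_int (sign (maya l m q)) *
      (s * gdet (fneg K') (\<lambda>t. - b t) (\<lambda>t. - a t) m (conj_part p) (conj_part q))"
    using gdet_complement[OF p q K] by (simp add: F_def)
  have s: "s = (-1) ^ (\<Sum>j<m. conj_part q j) * (-1) ^ (\<Sum>j<m. conj_part p j)"
  proof -
    have "(-1 :: 'a) ^ hole l q j * (-1) ^ hole l p j = (-1) ^ conj_part q j * (-1) ^ conj_part p j" for j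
    proof -
      have "hole l q j + hole l p j + (conj_part q j + conj_part p j) = 2 * (l + j)"
        using hole_plus_conj[OF q, of j] hole_plus_conj[OF p, of j] by simp
      then have "even (hole l q j + hole l p j) \<longleftrightarrow> even (conj_part q j + conj_part p j)"
        by (metis dvd_triv_left even_add)
      then show ?thesis
        unfolding power_add[symmetric] by (simp add: minus_one_power_iff)
    qed
    then show ?thesis
      by (simp add: s_def prod.distrib power_sum)
  qed
  have sq: "(-1 :: 'a) ^ n * ((-1) ^ n * w) = w" for n w
    by (simp add: minus_one_power_iff)
  have sg: "(of_int (sign \<pi>) :: 'a) * (of_int (sign \<pi>) * w) = w" for \<pi> :: "nat \<Rightarrow> nat" and w
    by (simp add: sign_def)
  show ?thesis
    unfolding det s sign_maya[OF p] sign_maya[OF q]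
    by (simp add: mult_ac sq sg)
qed

section \<open>The skew Cauchy identities\<close>

definition psize :: "(nat \<Rightarrow> nat) \<Rightarrow> nat" where
  "psize p = sum p {i. p i \<noteq> 0}"

lemma less_plength:
  assumes "p \<in> partitions"
  shows "i < plength p \<longleftrightarrow> p i \<noteq> 0"
  using less_conj_part[of p i 0] assms by (simp add: partitions_def conj_part_def plength_def)

lemma box_subset_partitions: "box l m \<subseteq> partitions"
  using box_finite_support by (auto simp: box_def partitions_def)

lemma partition_in_box:
  assumes "p \<in> partitions" "plength p \<le> l" "p 0 \<le> m"
  shows "p \<in> box l m"
proof -
  have "p i = 0" if "i \<ge> l" for i
    using less_plength[OF assms(1), of i] assms(2) that by auto
  then show ?thesis
    using assms by (simp add: box_def partitions_def)
qed

lemma psize_box: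
  assumes "p \<in> box l m"
  shows "(\<Sum>i<l. p i) = psize p"
  unfolding psize_def
proof (rule sum.mono_neutral_right)
  show "{i. p i \<noteq> 0} \<subseteq> {..<l}"
  proof
    fix i assume "i \<in> {i. p i \<noteq> 0}"
    then show "i \<in> {..<l}"
      using assms by (cases "i < l") (auto simp: box_def)
  qed
qed auto

lemma le_psize:
  assumes "p \<in> partitions"
  shows "p i \<le> psize p" and "plength p \<le> psize p"
proof -
  have fin: "finite {i. p i \<noteq> 0}"
    using assms by (simp add: partitions_def)
  show "p i \<le> psize p"
  proof (cases "p i = 0")
    case False
    then show ?thesis
      unfolding psize_def using fin by (intro member_le_sum) auto
  qed simp
  have "plength p = (\<Sum>i | p i \<noteq> 0. 1)"
    by (simp add: plength_def)
  also have "\<dots> \<le> psize p"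
    unfolding psize_def by (rule sum_mono) auto
  finally show "plength p \<le> psize p" .
qed

lemma partition_in_box_psize:
  assumes "p \<in> partitions" "psize p \<le> l" "psize p \<le> m"
  shows "p \<in> box l m"
  using assms le_psize(1)[OF assms(1), of 0] le_psize(2)[OF assms(1)] by (intro partition_in_box) auto

lemma sum_pos:
  assumes "p \<in> box l m"
  shows "(\<Sum>i<l. pos l p i) = psize p + (\<Sum>i<l. l - Suc i)"
  unfolding pos_def sum.distrib psize_box[OF assms] ..

text \<open>In a Leibniz term the orders add up to the sum of the \<open>u i - v (\<pi> i)\<close>,
  and truncated subtraction can only enlarge this sum.\<close>

lemma mord_fdet:
  assumes "\<And>i j. i < n \<Longrightarrow> j < n \<Longrightarrow> mord (u i - v j) (f i j)"
  shows "mord ((\<Sum>i<n. u i) - (\<Sum>j<n. v j)) (fdet n f)"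
  unfolding fdet_leibniz
proof (rule mord_sum)
  fix \<pi> assume "\<pi> \<in> {\<pi>. \<pi> permutes {0..<n}}"
  then have \<pi>: "\<pi> permutes {0..<n}"
    by simp
  have "mord (\<Sum>i=0..<n. u i - v (\<pi> i)) (\<Prod>i=0..<n. f i (\<pi> i))"
    using assms permutes_in_image[OF \<pi>] by (intro mord_prod) auto
  from mord_mult[OF mord_0(1) this] have "mord (\<Sum>i=0..<n. u i - v (\<pi> i)) (signof \<pi> * (\<Prod>i=0..<n. f i (\<pi> i)))"
    by simp
  moreover have "(\<Sum>i<n. u i) - (\<Sum>j<n. v j) \<le> (\<Sum>i=0..<n. u i - v (\<pi> i))"
  proof -
    have "(\<Sum>i=0..<n. u i) \<le> (\<Sum>i=0..<n. (u i - v (\<pi> i)) + v (\<pi> i))"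
      by (rule sum_mono) simp
    also have "\<dots> = (\<Sum>i=0..<n. u i - v (\<pi> i)) + (\<Sum>i=0..<n. v i)"
      using sum.permute[OF \<pi>, of v] by (simp add: sum.distrib comp_def)
    finally show ?thesis
      by (simp add: lessThan_atLeast0)
  qed
  ultimately show "mord ((\<Sum>i<n. u i) - (\<Sum>j<n. v j)) (signof \<pi> * (\<Prod>i=0..<n. f i (\<pi> i)))"
    by (rule mord_mono)
qed

text \<open>If every \<open>pos l q (\<pi> i)\<close> were at most \<open>pos l p i\<close>,
  summation would give \<open>psize q \<le> psize p\<close>. So each Leibniz term has a factor above
  the diagonal of a lower triangular matrix.\<close>

lemma gdet_eq_0:
  assumes p: "p \<in> box l m" and q: "q \<in> box l m'" and "psize p < psize q"
  shows "gdet K a b l p q = 0"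
  unfolding gdet_def fdet_leibniz
proof (intro sum.neutral ballI)
  fix \<pi> assume "\<pi> \<in> {\<pi>. \<pi> permutes {0..<l}}"
  then have \<pi>: "\<pi> permutes {0..<l}"
    by simp
  have "\<exists>i<l. pos l p i < pos l q (\<pi> i)"
  proof (rule ccontr)
    assume "\<not> ?thesis"
    then have "pos l q (\<pi> i) \<le> pos l p i" if "i < l" for i
      using that by (meson not_less)
    then have "(\<Sum>i=0..<l. pos l q (\<pi> i)) \<le> (\<Sum>i=0..<l. pos l p i)"
      by (intro sum_mono) auto
    moreover have "(\<Sum>i=0..<l. pos l q (\<pi> i)) = (\<Sum>i=0..<l. pos l q i)"
      using sum.permute[OF \<pi>, of "pos l q"] by (simp add: comp_def)
    ultimately show False
      using sum_pos[OF p] sum_pos[OF q] \<open>psize p < psize q\<close> by (simp add: lessThan_atLeast0)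
  qed
  then obtain i where i: "i < l" "pos l p i < pos l q (\<pi> i)"
    by blast
  have "(\<Prod>i=0..<l. cf (K * (hfps a (q (\<pi> i)) * efps a (p i - 1)) * (hfps b i * efps b (\<pi> i)))
      (pos l p i) (pos l q (\<pi> i))) = 0"
    using i by (intro prod_zero) (auto intro!: bexI[of _ i] simp: cf_def)
  then show "signof \<pi> * (\<Prod>i=0..<l. cf (K * (hfps a (q (\<pi> i)) * efps a (p i - 1)) * (hfps b i * efps b (\<pi> i)))
      (pos l p i) (pos l q (\<pi> i))) = 0"
    by simp
qed

lemma pos_Suc: "i < l \<Longrightarrow> pos (Suc l) p i = Suc (pos l p i)"
  by (simp add: pos_def Suc_diff_Suc)

lemma pos_Suc_last: "p l = 0 \<Longrightarrow> pos (Suc l) p l = 0"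
  by (simp add: pos_def)

text \<open>The new zero part sits at position 0, below all other positions, so the last row is zero
  except for a diagonal 1.\<close>

lemma gdet_Suc:
  assumes p: "p \<in> partitions" "plength p \<le> l" and q: "q \<in> partitions" "plength q \<le> l" and K: "K $ 0 = 1"
  shows "gdet K a b (Suc l) p q = gdet K a b l p q"
proof -
  have z: "p l = 0" "q l = 0"
    using less_plength[OF p(1), of l] less_plength[OF q(1), of l] p q by auto
  define f where "f i j = cf (K * (hfps a (q j) * efps a (p i - 1)) * (hfps b i * efps b j)) (pos (Suc l) p i) (pos (Suc l) q j)" for i j
  have "gdet K a b (Suc l) p q = fdet (Suc l) f"
    unfolding gdet_def f_def ..
  also have "\<dots> = fdet l f * f l l"
  proof (rule fdet_last_row)
    fix j assume "j < l"
    then show "f l j = 0"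
      using z by (simp add: f_def pos_def cf_def)
  qed
  also have "f l l = 1"
    using z K by (simp add: f_def pos_Suc_last cf_diag)
  also have "fdet l f = gdet K a b l p q"
    unfolding gdet_def by (rule fdet_cong) (simp add: f_def pos_Suc cf_def)
  finally show ?thesis
    by simp
qed

lemma gdet_stable:
  assumes p: "p \<in> partitions" and q: "q \<in> partitions" and K: "K $ 0 = 1"
    and "max (plength p) (plength q) \<le> l"
  shows "gdet K a b l p q = gdet K a b (max (plength p) (plength q)) p q"
  using assms(4)
proof (induction l rule: dec_induct)
  case (step l)
  then have "gdet K a b (Suc l) p q = gdet K a b l p q"
    using p q K by (intro gdet_Suc) auto
  with step show ?case
    by simp
qed simp

lemma mcong_gdet: "fcong M K K' \<Longrightarrow> mcong M (gdet K a b l p q) (gdet K' a b l p q)"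
  unfolding gdet_def by (intro mcong_fdet mcong_cf fcong_mult) auto

text \<open>The threshold works for all coefficients at once, hence for determinants of any size and
  for all partitions.\<close>

definition stable_fps :: "(nat \<Rightarrow> ('v, 'a::comm_ring_1) mps fps) \<Rightarrow> bool" where
  "stable_fps K \<longleftrightarrow> (\<forall>n. K n $ 0 = 1) \<and> (\<forall>M. \<exists>n0. \<forall>n\<ge>n0. fcong M (K n) (K n0))"

lemma stable_fps_prod:
  assumes v: "null_seq v" and F: "\<And>k. F (Suc k) = F k * f (v (Suc k))" "\<And>k. F k $ 0 = 1"
    and f: "\<And>M w. mcong M w 0 \<Longrightarrow> fcong M (f w) 1"
  shows "stable_fps F"
  unfolding stable_fps_def
proof (intro conjI allI)
  fix M :: "'a multiset"
  obtain n0 where n0: "\<And>k. k \<ge> n0 \<Longrightarrow> mcong M (v k) 0"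
    using v unfolding null_seq_def by blast
  have "fcong M (F n) (F n0)" if "n \<ge> n0" for n
    using that
  proof (induction n rule: dec_induct)
    case (step k)
    have "fcong M (F (Suc k)) (F k * 1)"
      unfolding F using step by (intro fcong_mult f n0) auto
    then have "fcong M (F (Suc k)) (F k)"
      by simp
    then show ?case
      using step.IH by (rule fcong_trans)
  qed simp
  then show "\<exists>n0. \<forall>n\<ge>n0. fcong M (F n) (F n0)"
    by blast
qed (use F in auto)

lemma stable_hfps: "null_seq v \<Longrightarrow> stable_fps (hfps v)"
  by (rule stable_fps_prod[of v _ geo]) (auto simp: hfps_Suc intro: fcong_geo)

lemma stable_efps: "null_seq v \<Longrightarrow> stable_fps (efps v)"
  by (rule stable_fps_prod[of v _ lin]) (auto simp: efps_Suc intro: fcong_lin)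

lemma lim_gdet:
  assumes K: "stable_fps K" and n0: "\<And>n. n \<ge> n0 \<Longrightarrow> fcong M (K n) (K n0)" and "n \<ge> n0"
  shows "mcong M (lim (\<lambda>n. gdet (K n) a b l p q)) (gdet (K n) a b l p q)"
proof (rule lim_mcong)
  fix M :: "'a multiset"
  obtain n0 where "\<forall>n\<ge>n0. fcong M (K n) (K n0)"
    using K unfolding stable_fps_def by blast
  then show "\<exists>n0. \<forall>n\<ge>n0. mcong M (gdet (K n) a b l p q) (gdet (K n0) a b l p q)"
    using mcong_gdet by blast
qed (use n0 \<open>n \<ge> n0\<close> mcong_gdet in blast)+

text \<open>\<open>represents g K a b\<close>: the function \<open>g\<close> of two partitions is the limit of the determinants
  \<open>gdet\<close>, uniformly in the partitions.\<close>

definition represents where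
  "represents g K a b \<longleftrightarrow> (\<forall>M. \<exists>n0. \<forall>n\<ge>n0. \<forall>p\<in>partitions. \<forall>q\<in>partitions. \<forall>l.
    plength p \<le> l \<longrightarrow> plength q \<le> l \<longrightarrow> mcong M (g p q) (gdet (K n) a b l p q))"

lemma represents_g_fun:
  assumes "null_seq y"
  shows "represents (g_fun y \<alpha> \<beta>) (hfps y) (\<lambda>k. - \<alpha> k) \<beta>"
  unfolding represents_def
proof (rule allI)
  fix M :: "'a multiset"
  have st: "stable_fps (hfps y)"
    using assms by (rule stable_hfps)
  then obtain n0 where n0: "\<And>n. n \<ge> n0 \<Longrightarrow> fcong M (hfps y n) (hfps y n0)"
    unfolding stable_fps_def by blast
  have "mcong M (g_fun y \<alpha> \<beta> p q) (gdet (hfps y n) (\<lambda>k. - \<alpha> k) \<beta> l p q)"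
    if "n \<ge> n0" "p \<in> partitions" "q \<in> partitions" "plength p \<le> l" "plength q \<le> l" for n p q l
  proof -
    have "gdet (hfps y n) (\<lambda>k. - \<alpha> k) \<beta> l p q =
        gdet (hfps y n) (\<lambda>k. - \<alpha> k) \<beta> (max (plength p) (plength q)) p q"
      using that by (intro gdet_stable) auto
    then show ?thesis
      unfolding g_fun_def g_fin_eq_gdet using lim_gdet[OF st n0 that(1)] by simp
  qed
  then show "\<exists>n0. \<forall>n\<ge>n0. \<forall>p\<in>partitions. \<forall>q\<in>partitions. \<forall>l. plength p \<le> l \<longrightarrow> plength q \<le> l \<longrightarrow>
      mcong M (g_fun y \<alpha> \<beta> p q) (gdet (hfps y n) (\<lambda>k. - \<alpha> k) \<beta> l p q)"
    by blast
qed

lemma conj_part_partitions: "p \<in> partitions \<Longrightarrow> conj_part p \<in> partitions"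
  using conj_part_box[OF partition_in_box[OF _ order_refl order_refl]] box_subset_partitions by blast

lemma conj_conj_part: "p \<in> partitions \<Longrightarrow> conj_part (conj_part p) = p"
  using conj_conj_part_box[OF partition_in_box[OF _ order_refl order_refl]] by blast

lemma conj_part_0: "conj_part p 0 = plength p"
  by (simp add: conj_part_def plength_def)

text \<open>By \<open>gdet_conj\<close>, inverting \<open>hfps y\<close> and substituting
  \<open>-t\<close> gives the product of the factors \<open>1 + y t\<close>, and the negated
  sequences return in their original order, undoing the exchange of \<alpha> and \<beta>.\<close>

lemma represents_g_fun_conj:
  assumes "null_seq y"
  shows "represents (\<lambda>p q. g_fun y \<beta> \<alpha> (conj_part p) (conj_part q)) (efps (\<lambda>k. - y k)) (\<lambda>k. - \<alpha> k) \<beta>"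
  unfolding represents_def
proof (rule allI)
  fix M :: "'a multiset"
  have st: "stable_fps (efps (\<lambda>k. - y k))"
    using null_seq_uminus[OF assms] by (rule stable_efps)
  then obtain n0 where n0: "\<And>n. n \<ge> n0 \<Longrightarrow> fcong M (efps (\<lambda>k. - y k) n) (efps (\<lambda>k. - y k) n0)"
    unfolding stable_fps_def by blast
  have "mcong M (g_fun y \<beta> \<alpha> (conj_part p) (conj_part q)) (gdet (efps (\<lambda>k. - y k) n) (\<lambda>k. - \<alpha> k) \<beta> l p q)"
    if n: "n \<ge> n0" and p: "p \<in> partitions" "plength p \<le> l" and q: "q \<in> partitions" "plength q \<le> l" for n p q l
  proof -
    \<comment> \<open>The number of rows that \<open>g_fun\<close> uses for the conjugates; their
      first parts are at most \<open>l\<close> by \<open>conj_part_0\<close>.\<close>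
    define L where "L = max (plength (conj_part p)) (plength (conj_part q))"
    have box: "conj_part p \<in> box L l" "conj_part q \<in> box L l"
      using p q by (auto intro!: partition_in_box conj_part_partitions simp: conj_part_0 L_def)
    have "gdet (hfps y n) (\<lambda>k. - \<beta> k) \<alpha> L (conj_part p) (conj_part q) =
        gdet (efps (\<lambda>k. - y k) n) (\<lambda>k. - \<alpha> k) \<beta> l p q" for n
      using gdet_conj[OF box, of "efps y n" "hfps y n" "\<lambda>k. - \<beta> k" \<alpha>]
      by (simp add: hfps_efps[of y n, unfolded mult.commute[of "hfps y n"]] fneg_efps conj_conj_part p q)
    then show ?thesis
      unfolding g_fun_def g_fin_eq_gdet L_def[symmetric] using lim_gdet[OF st n0 n] by simp
  qed
  then show "\<exists>n0. \<forall>n\<ge>n0. \<forall>p\<in>partitions. \<forall>q\<in>partitions. \<forall>l. plength p \<le> l \<longrightarrow> plength q \<le> l \<longrightarrow>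
      mcong M (g_fun y \<beta> \<alpha> (conj_part p) (conj_part q)) (gdet (efps (\<lambda>k. - y k) n) (\<lambda>k. - \<alpha> k) \<beta> l p q)"
    by blast
qed

lemma dsl_Suc: "dsl H F (Suc p) (Suc q) = dsl H F p q"
  by (simp add: dsl_def)

text \<open>Every term has \<open>b \<ge> q - p > d\<close>, beyond the degree of
  \<open>F\<close>.\<close>

lemma dsl_eq_0:
  assumes "fdeg F d" "d + p < q"
  shows "dsl H F p q = 0"
proof -
  have "F $ b = 0" if "a + q = b + p" for a b
    using that assms by (auto simp: fdeg_def)
  then show ?thesis
    unfolding dsl_def by (intro infsum_0) auto
qed

lemma dsl_one:
  assumes "graded H" "H $ 0 = 1"
  shows "dsl H 1 p p = 1"
proof (rule mcong_eqI)
  fix M :: "'a multiset"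
  have "mcong M (dsl H 1 p p) (\<Sum>b<Suc (size M). cf H (b + p) p * 1 $ b)"
    using assms by (intro dsl_mcong_finite) auto
  also have "(\<Sum>b<Suc (size M). cf H (b + p) p * 1 $ b) = (\<Sum>b<Suc (size M). if b = 0 then 1 else 0)"
    using assms by (intro sum.cong) (auto simp: cf_def)
  finally show "mcong M (dsl H 1 p p) 1"
    by (simp del: sum.lessThan_Suc)
qed

text \<open>The sequences are arbitrary rather than fixed variables, so that \<alpha> and \<beta>
  can be interchanged for the conjugated identities.\<close>

locale grothendieck =
  fixes x \<alpha> \<beta> :: "nat \<Rightarrow> ('v, 'a::comm_ring_1) mps"
  assumes x: "null_seq x" and \<alpha>: "null_seq \<alpha>" and \<beta>: "null_seq \<beta>"
begin

definition A where "A k = - \<alpha> k"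

text \<open>This is \<open>rser\<close> of \<open>q\<close> times \<open>cser\<close> of
  \<open>p\<close>, the source of the matrix factorization.\<close>

definition gser where "gser p q i j = hfps A (p i) * efps A (q j - 1) * (hfps \<beta> j * efps \<beta> i)"

definition pref where "pref l n = (\<Prod>i=1..l. \<Prod>j=1..n. 1 - \<beta> i * x j)"

lemma G_fin_eq': "G_fin l n x \<alpha> \<beta> p q =
    pref l n * fdet l (\<lambda>i j. dsl (hfps x n) (gser p q i j) (pos l p i) (pos l q j))"
  by (simp add: G_fin_eq gser_def A_def[abs_def] pref_def)

lemma mord_letters: "mord 1 (x k)" "mord 1 (A k)" "mord 1 (\<beta> k)"
  using x \<alpha> \<beta> by (auto simp: null_seq_def A_def intro: mord_uminus)

lemma graded_series [simp]:
  "graded (hfps x n)" "graded (hfps A n)" "graded (efps A n)" "graded (hfps \<beta> n)" "graded (efps \<beta> n)"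
  by (intro graded_hfps graded_efps mord_letters)+

lemma graded_gser [simp]: "graded (gser p q i j)"
  unfolding gser_def by (intro graded_mult graded_series)

text \<open>The positions serve as row and column weights in \<open>mord_fdet\<close>. For fixed
  \<open>q\<close>, only finitely many \<open>p\<close> matter modulo a monomial.\<close>

lemma mord_G_fin:
  assumes p: "p \<in> box l m" and q: "q \<in> box l m'"
  shows "mord (psize p - psize q) (G_fin l n x \<alpha> \<beta> p q)"
proof -
  have "mord ((\<Sum>i<l. pos l p i) - (\<Sum>j<l. pos l q j))
      (fdet l (\<lambda>i j. dsl (hfps x n) (gser p q i j) (pos l p i) (pos l q j)))"
    by (intro mord_fdet mord_dsl graded_series graded_gser)
  from mord_mult[OF mord_0(1) this, of "pref l n"] show ?thesis
    by (simp add: G_fin_eq' sum_pos[OF p] sum_pos[OF q])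
qed

text \<open>The entries of the last row outside the diagonal are divisible by \<open>\<beta>\<^sub>l\<close>.\<close>

lemma G_fin_Suc_mcong:
  assumes p: "p \<in> partitions" "plength p \<le> l" and q: "q \<in> partitions" "plength q \<le> l"
    and b: "mcong M (\<beta> l) 0" "mcong M (\<beta> (Suc l)) 0" and "0 < l"
  shows "mcong M (G_fin (Suc l) n x \<alpha> \<beta> p q) (G_fin l n x \<alpha> \<beta> p q)"
proof -
  have z: "p l = 0" "q l = 0"
    using less_plength[OF p(1), of l] less_plength[OF q(1), of l] p q by auto
  define f where "f i j = dsl (hfps x n) (gser p q i j) (pos (Suc l) p i) (pos (Suc l) q j)" for i j
  define g where "g i j = (if i = l then of_bool (j = l) else f i j)" for i j
  have fg: "mcong M (f i j) (g i j)" if "j < Suc l" for i j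
  proof (cases "i = l")
    case True
    show ?thesis
    proof (cases "j = l")
      case True
      have "gser p q l l = 1"
        using z by (simp add: gser_def hfps_efps)
      then show ?thesis
        using \<open>i = l\<close> True z by (simp add: f_def g_def pos_Suc_last dsl_one)
    next
      case False
      then have j: "j < l"
        using that by simp
      \<comment> \<open>This is \<open>gser\<close> without its factor
        \<open>lin (\<beta> l)\<close>, which is 1 modulo \<open>M\<close>. The lost degree is
        decisive for \<open>q j = 0\<close>: with that factor the bound would equal the distance
        \<open>l - j\<close> of the positions.\<close>
      define F where "F = efps A (q j - 1) * (hfps \<beta> j * efps \<beta> (l - 1))"
      have "gser p q l j = F * lin (\<beta> l)"
        using z efps_Suc[of \<beta> "l - 1"] \<open>0 < l\<close> by (simp add: gser_def F_def mult.assoc)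
      moreover have "fcong M (F * lin (\<beta> l)) (F * 1)"
        using b by (intro fcong_mult fcong_lin) auto
      moreover have "graded F"
        unfolding F_def by (intro graded_mult graded_series)
      ultimately have "mcong M (f l j) (dsl (hfps x n) F (pos (Suc l) p l) (pos (Suc l) q j))"
        unfolding f_def using graded_gser[of p q l j] by (intro dsl_mcong) auto
      also have "dsl (hfps x n) F (pos (Suc l) p l) (pos (Suc l) q j) = 0"
      proof (rule dsl_eq_0)
        show "fdeg F ((q j - 1) + (l - 1 - j))"
          unfolding F_def using j by (intro fdeg_mult fdeg_efps fdeg_hfps_efps) auto
        show "(q j - 1) + (l - 1 - j) + pos (Suc l) p l < pos (Suc l) q j"
          using j z by (simp add: pos_def)
      qed
      finally show ?thesis
        using \<open>i = l\<close> False by (simp add: g_def)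
    qed
  qed (simp add: g_def)
  have "mcong M (fdet (Suc l) f) (fdet (Suc l) g)"
    by (intro mcong_fdet fg)
  moreover have "fdet (Suc l) g = fdet l g * g l l"
    by (rule fdet_last_row) (simp add: g_def)
  moreover have "fdet l g = fdet l (\<lambda>i j. dsl (hfps x n) (gser p q i j) (pos l p i) (pos l q j))"
    by (rule fdet_cong) (simp add: g_def f_def pos_Suc dsl_Suc)
  ultimately have 1: "mcong M (fdet (Suc l) f) (fdet l (\<lambda>i j. dsl (hfps x n) (gser p q i j) (pos l p i) (pos l q j)))"
    by (simp add: g_def)
  have "mcong M (1 - \<beta> (Suc l) * x j) (1 - 0)" for j
    using b by (intro mcong_diff mcong_mult_zero) auto
  then have "mcong M (\<Prod>j=1..n. 1 - \<beta> (Suc l) * x j) (\<Prod>j=1..n. 1)"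
    by (intro mcong_prod) auto
  then have "mcong M (pref l n * (\<Prod>j=1..n. 1 - \<beta> (Suc l) * x j)) (pref l n * (\<Prod>j=1..n. 1))"
    by (intro mcong_mult) auto
  then have 2: "mcong M (pref (Suc l) n) (pref l n)"
    by (simp add: pref_def)
  have "(\<lambda>i j. dsl (hfps x n) (gser p q i j) (pos (Suc l) p i) (pos (Suc l) q j)) = f"
    by (intro ext) (simp add: f_def)
  then show ?thesis
    unfolding G_fin_eq' by (simp only: mcong_mult[OF 2 1])
qed

lemma G_fin_n_mcong:
  assumes "\<And>n. n \<ge> n0 \<Longrightarrow> fcong M (hfps x n) (hfps x n0)" "\<And>k. k \<ge> n0 \<Longrightarrow> mcong M (x k) 0" "n \<ge> n0"
  shows "mcong M (G_fin l n x \<alpha> \<beta> p q) (G_fin l n0 x \<alpha> \<beta> p q)"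
proof -
  have "mcong M (\<Prod>j=1..n. 1 - \<beta> i * x j) (\<Prod>j=1..n0. 1 - \<beta> i * x j)" for i
    using \<open>n \<ge> n0\<close>
  proof (induction n rule: dec_induct)
    case (step k)
    have "mcong M (1 - \<beta> i * x (Suc k)) (1 - 0)"
      using assms(2) step by (intro mcong_diff mcong_mult_zero) auto
    from mcong_mult[OF step.IH this] show ?case
      by simp
  qed simp
  then have "mcong M (pref l n) (pref l n0)"
    unfolding pref_def by (intro mcong_prod)
  then show ?thesis
    unfolding G_fin_eq' using assms by (intro mcong_mult mcong_fdet dsl_mcong) auto
qed

text \<open>Apart from the lengths of the partitions the thresholds depend on the monomial alone:
  \<open>k0\<close> is where the \<beta> become negligible, \<open>n0\<close> where the variables
  do. Stabilization in \<open>l\<close> is uniform in \<open>n\<close>, so the outer limit can be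
  compared at one fixed \<open>l\<close>.\<close>

lemma G_fun_mcong:
  "\<exists>k0 n0. \<forall>p\<in>partitions. \<forall>q\<in>partitions. \<forall>l n. plength p + k0 \<le> l \<longrightarrow> plength q + k0 \<le> l \<longrightarrow> n0 \<le> n \<longrightarrow>
    mcong M (G_fun x \<alpha> \<beta> p q) (G_fin l n x \<alpha> \<beta> p q)"
proof -
  have "\<exists>k0>0. \<forall>k\<ge>k0. mcong M (\<beta> k) 0" for M
    using \<beta> unfolding null_seq_def by (metis less_Suc_eq_0_disj Suc_leD)
  then obtain k0 where k0: "\<And>M. k0 M > 0" "\<And>M k. k \<ge> k0 M \<Longrightarrow> mcong M (\<beta> k) 0"
    by metis
  have "\<exists>n0. (\<forall>n\<ge>n0. fcong M (hfps x n) (hfps x n0)) \<and> (\<forall>k\<ge>n0. mcong M (x k) 0)" for M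
  proof -
    obtain a b where a: "\<And>n. n \<ge> a \<Longrightarrow> fcong M (hfps x n) (hfps x a)" and b: "\<And>k. k \<ge> b \<Longrightarrow> mcong M (x k) 0"
      using stable_hfps[OF x] x unfolding stable_fps_def null_seq_def by metis
    have "fcong M (hfps x n) (hfps x (max a b))" if "n \<ge> max a b" for n
      using a[of n] a[of "max a b"] that by (auto intro: fcong_trans fcong_sym)
    then show ?thesis
      using b by (intro exI[of _ "max a b"]) auto
  qed
  then obtain n0 where n0: "\<And>M n. n \<ge> n0 M \<Longrightarrow> fcong M (hfps x n) (hfps x (n0 M))"
      "\<And>M k. k \<ge> n0 M \<Longrightarrow> mcong M (x k) 0"
    by metis
  have "mcong M (G_fun x \<alpha> \<beta> p q) (G_fin l n x \<alpha> \<beta> p q)"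
    if p: "p \<in> partitions" "plength p + k0 M \<le> l" and q: "q \<in> partitions" "plength q + k0 M \<le> l" and n: "n0 M \<le> n" for p q l n
  proof -
    define c where "c = max (plength p) (plength q)"
    have stab: "mcong M (G_fin l n x \<alpha> \<beta> p q) (G_fin (c + k0 M) n x \<alpha> \<beta> p q)" if "c + k0 M \<le> l" for M l n
      using that
    proof (induction l rule: dec_induct)
      case (step l)
      have "mcong M (G_fin (Suc l) n x \<alpha> \<beta> p q) (G_fin l n x \<alpha> \<beta> p q)"
        using p q step k0(1)[of M] by (intro G_fin_Suc_mcong k0(2)) (auto simp: c_def)
      then show ?case
        using step.IH by (rule mcong_trans)
    qed simp
    have inner: "mcong M (lim (\<lambda>l. G_fin l n x \<alpha> \<beta> p q)) (G_fin l n x \<alpha> \<beta> p q)" if "c + k0 M \<le> l" for M l n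
      by (rule lim_mcong[OF _ _ that]) (use stab in blast)+
    have outer: "mcong M (lim (\<lambda>l. G_fin l n x \<alpha> \<beta> p q)) (lim (\<lambda>l. G_fin l (n0 M) x \<alpha> \<beta> p q))" if "n \<ge> n0 M" for M n
    proof -
      let ?l = "c + k0 M"
      have "mcong M (G_fin ?l n x \<alpha> \<beta> p q) (G_fin ?l (n0 M) x \<alpha> \<beta> p q)"
        using n0 that by (intro G_fin_n_mcong) auto
      then show ?thesis
        using inner[of M ?l n] inner[of M ?l "n0 M"] by (meson mcong_sym mcong_trans order_refl)
    qed
    have "mcong M (G_fun x \<alpha> \<beta> p q) (lim (\<lambda>l. G_fin l n x \<alpha> \<beta> p q))"
      unfolding G_fun_def
      by (rule lim_mcong[where n = n and n0 = "n0 M"]) (use outer n in blast)+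
    moreover have "mcong M (lim (\<lambda>l. G_fin l n x \<alpha> \<beta> p q)) (G_fin l n x \<alpha> \<beta> p q)"
      using p q by (intro inner) (auto simp: c_def)
    ultimately show ?thesis
      by (rule mcong_trans)
  qed
  then show ?thesis
    by blast
qed

section \<open>Matrix form of the primal functions, the finite identity and the passage to the
  limit\<close>

definition Lt where "Lt n = (\<lambda>p q. cf (hfps x n) q p)"

definition Gmat where "Gmat l n N p q = fdet l (mprod N (rmat A \<beta> l q) (mprod N (Lt n) (cmat A \<beta> l p)))"

text \<open>The transposed Toeplitz matrix is upper triangular, so the cut-off is harmless only if
  each particle of \<open>p\<close> has \<open>size M\<close> positions of room above it. Rows now
  belong to \<open>q\<close> and columns to \<open>p\<close>, whence the transposition at the
  end.\<close>

lemma G_fin_mcong_Gmat: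
  assumes q: "q \<in> box l m" and p: "\<And>i. i < l \<Longrightarrow> pos l p i + size M < l + m"
  shows "mcong M (G_fin l n x \<alpha> \<beta> p q) (pref l n * Gmat l n (l + m) p q)"
proof -
  have ent: "mcong M (dsl (hfps x n) (gser p q i j) (pos l p i) (pos l q j))
      (mprod (l + m) (rmat A \<beta> l q) (mprod (l + m) (Lt n) (cmat A \<beta> l p)) j i)" if "i < l" "j < l" for i j
  proof -
    have "graded (rser A \<beta> l q j)" "graded (cser A \<beta> l p i)"
      unfolding rser_def cser_def by (intro graded_mult graded_series)+
    then have "mcong M (dsl (hfps x n) (rser A \<beta> l q j * cser A \<beta> l p i) (pos l p i) (pos l q j))
      (\<Sum>e<l + m. \<Sum>f<l + m. cf (rser A \<beta> l q j) (pos l q j) e * cf (hfps x n) f e * cf (cser A \<beta> l p i) f (pos l p i))"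
      using that p fdeg_rser[OF that(2), of A \<beta> q] pos_less[OF q that(2)]
      by (intro dsl_mcong_matrix) (auto simp: fdeg_def)
    also have "(\<Sum>e<l + m. \<Sum>f<l + m. cf (rser A \<beta> l q j) (pos l q j) e * cf (hfps x n) f e * cf (cser A \<beta> l p i) f (pos l p i)) =
        mprod (l + m) (rmat A \<beta> l q) (mprod (l + m) (Lt n) (cmat A \<beta> l p)) j i"
      by (simp add: mprod_def Lt_def rmat_def cmat_def sum_distrib_left mult.assoc)
    finally show ?thesis
      by (simp add: rser_cser gser_def)
  qed
  have "mcong M (fdet l (\<lambda>i j. dsl (hfps x n) (gser p q i j) (pos l p i) (pos l q j)))
      (fdet l (\<lambda>i j. mprod (l + m) (rmat A \<beta> l q) (mprod (l + m) (Lt n) (cmat A \<beta> l p)) j i))"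
    by (intro mcong_fdet ent)
  also have "fdet l (\<lambda>i j. mprod (l + m) (rmat A \<beta> l q) (mprod (l + m) (Lt n) (cmat A \<beta> l p)) j i) = Gmat l n (l + m) p q"
    unfolding Gmat_def by (rule fdet_transpose)
  finally show ?thesis
    unfolding G_fin_eq' by (intro mcong_mult) auto
qed

text \<open>Counterpart of \<open>mord_G_fin\<close>: for partitions too large for the comparison
  above, both functions are negligible.\<close>

lemma mord_Gmat:
  assumes p: "p \<in> box l m" and q: "q \<in> box l m'"
  shows "mord (psize p - psize q) (Gmat l n N p q)"
proof -
  have "mord ((\<Sum>i<l. pos l p i) - (\<Sum>j<l. pos l q j))
      (fdet l (\<lambda>i j. mprod N (rmat A \<beta> l q) (mprod N (Lt n) (cmat A \<beta> l p)) j i))"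
  proof (rule mord_fdet)
    fix i j assume "i < l" "j < l"
    have g: "graded (rser A \<beta> l q j)" "graded (cser A \<beta> l p i)"
      unfolding rser_def cser_def by (intro graded_mult graded_series)+
    have "mord (pos l p i - pos l q j) (rmat A \<beta> l q j e * (Lt n e f * cmat A \<beta> l p f i))" for e f
    proof (cases "e \<le> pos l q j \<and> pos l p i \<le> f")
      case True
      have "mord ((pos l q j - e) + ((f - e) + (f - pos l p i))) (rmat A \<beta> l q j e * (Lt n e f * cmat A \<beta> l p f i))"
        unfolding rmat_def Lt_def cmat_def by (intro mord_mult mord_cf g graded_series)
      then show ?thesis
        by (rule mord_mono) (use True in auto)
    next
      case False
      then show ?thesis
        by (auto simp: rmat_def cmat_def cf_def)
    qed
    then show "mord (pos l p i - pos l q j) (mprod N (rmat A \<beta> l q) (mprod N (Lt n) (cmat A \<beta> l p)) j i)"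
      unfolding mprod_def sum_distrib_left by (intro mord_sum)
  qed
  then show ?thesis
    by (simp add: Gmat_def sum_pos[OF p] sum_pos[OF q] fdet_transpose[of l "mprod N _ _"])
qed

text \<open>Common interface of the Cauchy and the dual Cauchy case: moving the Toeplitz matrix of
  \<open>K n\<close> across that of \<open>x\<close> costs the scalar \<open>c n\<close>.\<close>

definition exchanges where
  "exchanges K c \<longleftrightarrow> (\<forall>n l N B M Q V. ut_low n l Q \<longrightarrow> n \<le> N \<longrightarrow> (\<forall>i<l. \<forall>e>B. Q i e = 0) \<longrightarrow> B + size M < N \<longrightarrow>
    mcong M (fdet l (mprod N Q (mprod N (Lt n) (mprod N (cf (K n)) V))))
      (c n * fdet l (mprod N Q (mprod N (cf (K n)) (mprod N (Lt n) V)))))"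

lemma finite_skew_cauchy:
  assumes ex: "exchanges K c"
    and \<mu>: "\<mu> \<in> box l s" "plength \<mu> + n \<le> l" and \<nu>: "\<nu> \<in> box l s" and s: "psize \<mu> + size M \<le> s"
    and m: "s + size M < m"
  shows "mcong M (\<Sum>p\<in>box l m. G_fin l n x \<alpha> \<beta> p \<mu> * gdet (K n) A \<beta> l p \<nu>)
    (c n * (\<Sum>\<eta>\<in>box l m. G_fin l n x \<alpha> \<beta> \<nu> \<eta> * gdet (K n) A \<beta> l \<mu> \<eta>))"
proof -
  define N where "N = l + m"
  have box: "\<mu> \<in> box l m" "\<nu> \<in> box l m"
    using \<mu> \<nu> m by (auto simp: box_def)
  let ?R = "rmat A \<beta> l" and ?C = "cmat A \<beta> l" and ?T = "cf (K n)"
  \<comment> \<open>Small partitions stay away from the edge of the box; for large ones both sides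
    have order above \<open>size M\<close>.\<close>
  have G1: "mcong M (G_fin l n x \<alpha> \<beta> p \<mu>) (pref l n * Gmat l n N p \<mu>)" if p: "p \<in> box l m" for p
  proof (cases "psize p \<le> s")
    case True
    have ps: "p i \<le> s" for i
      using le_psize(1)[of p i] True p box_subset_partitions by (meson le_trans subsetD)
    have "pos l p i + size M < l + m" if "i < l" for i
      using m ps[of i] diff_le_self[of l "Suc i"] unfolding pos_def by linarith
    then show ?thesis
      unfolding N_def using box by (intro G_fin_mcong_Gmat)
  next
    case False
    then have *: "size M < psize p - psize \<mu>"
      using s by simp
    have "mcong M (G_fin l n x \<alpha> \<beta> p \<mu>) 0"
      by (rule mcong_zero_of_mord[OF mord_G_fin[OF p box(1)] *])
    moreover have "mcong M (pref l n * Gmat l n N p \<mu>) 0"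
      by (rule mcong_mult_zero(2)[OF mcong_zero_of_mord[OF mord_Gmat[OF p box(1)] *]])
    ultimately show ?thesis
      by (meson mcong_sym mcong_trans)
  qed
  have G2: "mcong M (G_fin l n x \<alpha> \<beta> \<nu> \<eta>) (pref l n * Gmat l n N \<nu> \<eta>)" if "\<eta> \<in> box l m" for \<eta>
  proof -
    have "pos l \<nu> i + size M < l + m" if "i < l" for i
      using box_le[OF \<nu>, of i] m diff_le_self[of l "Suc i"] unfolding pos_def by linarith
    then show ?thesis
      unfolding N_def using that by (intro G_fin_mcong_Gmat)
  qed
  have L: "(\<Sum>p\<in>box l m. Gmat l n N p \<mu> * gdet (K n) A \<beta> l p \<nu>) =
      fdet l (mprod N (?R \<mu>) (mprod N (Lt n) (mprod N ?T (?C \<nu>))))"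
  proof -
    have "(\<Sum>p\<in>box l m. Gmat l n N p \<mu> * gdet (K n) A \<beta> l p \<nu>) =
        (\<Sum>p\<in>box l m. fdet l (mprod N (mprod N (?R \<mu>) (Lt n)) (?C p)) * fdet l (mprod N (?R p) (mprod N ?T (?C \<nu>))))"
      by (intro sum.cong refl) (simp add: Gmat_def gdet_eq_mprod N_def mprod_assoc)
    also have "\<dots> = fdet l (mprod N (mprod N (?R \<mu>) (Lt n)) (mprod N ?T (?C \<nu>)))"
      unfolding N_def by (rule completeness)
    finally show ?thesis
      by (simp only: mprod_assoc[of N N "?R \<mu>"])
  qed
  have R: "(\<Sum>\<eta>\<in>box l m. Gmat l n N \<nu> \<eta> * gdet (K n) A \<beta> l \<mu> \<eta>) =
      fdet l (mprod N (?R \<mu>) (mprod N ?T (mprod N (Lt n) (?C \<nu>))))"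
  proof -
    have "(\<Sum>\<eta>\<in>box l m. Gmat l n N \<nu> \<eta> * gdet (K n) A \<beta> l \<mu> \<eta>) =
        (\<Sum>\<eta>\<in>box l m. fdet l (mprod N (mprod N (?R \<mu>) ?T) (?C \<eta>)) * fdet l (mprod N (?R \<eta>) (mprod N (Lt n) (?C \<nu>))))"
      by (intro sum.cong refl) (simp add: Gmat_def gdet_eq_mprod[OF box(1)] N_def mprod_assoc mult.commute)
    also have "\<dots> = fdet l (mprod N (mprod N (?R \<mu>) ?T) (mprod N (Lt n) (?C \<nu>)))"
      unfolding N_def by (rule completeness)
    finally show ?thesis
      by (simp only: mprod_assoc[of N N "?R \<mu>"])
  qed
  \<comment> \<open>The reserve of \<open>n\<close> rows beyond the length of \<open>\<mu>\<close>
    supplies the zero parts that \<open>ut_low_rmat\<close> asks for.\<close>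
  have "\<mu> i = 0" if "i \<ge> l - n" for i
  proof -
    have "\<not> i < plength \<mu>"
      using \<mu>(2) that by linarith
    then show ?thesis
      using less_plength[OF subsetD[OF box_subset_partitions \<mu>(1)], of i] by simp
  qed
  then have low: "ut_low n l (?R \<mu>)"
    using \<mu> by (intro ut_low_rmat) auto
  have EX: "mcong M (fdet l (mprod N (?R \<mu>) (mprod N (Lt n) (mprod N ?T (?C \<nu>)))))
      (c n * fdet l (mprod N (?R \<mu>) (mprod N ?T (mprod N (Lt n) (?C \<nu>)))))"
  proof (rule ex[unfolded exchanges_def, rule_format, OF low])
    show "n \<le> N" "l + s + size M < N"
      using \<mu>(2) m by (simp_all add: N_def)
  qed (rule rmat_low[OF \<mu>(1)])
  have 1: "mcong M (\<Sum>p\<in>box l m. G_fin l n x \<alpha> \<beta> p \<mu> * gdet (K n) A \<beta> l p \<nu>)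
      (\<Sum>p\<in>box l m. pref l n * Gmat l n N p \<mu> * gdet (K n) A \<beta> l p \<nu>)"
    by (intro mcong_sum mcong_mult G1 mcong_refl)
  have 2: "mcong M (\<Sum>\<eta>\<in>box l m. G_fin l n x \<alpha> \<beta> \<nu> \<eta> * gdet (K n) A \<beta> l \<mu> \<eta>)
      (\<Sum>\<eta>\<in>box l m. pref l n * Gmat l n N \<nu> \<eta> * gdet (K n) A \<beta> l \<mu> \<eta>)"
    by (intro mcong_sum mcong_mult G2 mcong_refl)
  \<comment> \<open>The factor \<open>pref l n\<close> is common to both sides and is carried along
    instead of being cancelled.\<close>
  have 3: "mcong M (\<Sum>p\<in>box l m. pref l n * Gmat l n N p \<mu> * gdet (K n) A \<beta> l p \<nu>)
      (c n * (\<Sum>\<eta>\<in>box l m. pref l n * Gmat l n N \<nu> \<eta> * gdet (K n) A \<beta> l \<mu> \<eta>))"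
    using mcong_mult[OF mcong_refl[of M "pref l n"] EX]
    unfolding L[symmetric] R[symmetric] by (simp add: sum_distrib_left mult_ac)
  show ?thesis
    using 1 3 mcong_mult[OF mcong_refl[of M "c n"] 2] by (meson mcong_sym mcong_trans)
qed

text \<open>Everything is compared modulo one monomial: beyond weight \<open>s\<close> the terms on
  the left vanish modulo \<open>M\<close> and those on the right exactly, and on the remaining
  finite set \<open>F\<close> all limits are replaced by determinants with common \<open>l\<close>
  and \<open>n\<close>.\<close>

lemma skew_cauchy:
  assumes g: "represents g K A \<beta>" and ex: "exchanges K c"
    and \<kappa>: "\<And>M. \<exists>n0. \<forall>n\<ge>n0. mcong M \<kappa> (c n)"
    and \<mu>: "\<mu> \<in> partitions" and \<nu>: "\<nu> \<in> partitions"
  shows "((\<lambda>p. G_fun x \<alpha> \<beta> p \<mu> * g p \<nu>) has_sum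
    \<kappa> * (\<Sum>\<^sub>\<infinity>\<eta>\<in>partitions. G_fun x \<alpha> \<beta> \<nu> \<eta> * g \<mu> \<eta>)) partitions"
proof (rule has_sum_mcongI)
  fix M :: "'v multiset"
  \<comment> \<open>Beyond this weight, \<open>G\<close> of \<open>p\<close> and
    \<open>\<mu>\<close> has order above \<open>size M\<close>; the summand
    \<open>psize \<nu>\<close> puts \<open>\<nu>\<close> into \<open>F\<close>.\<close>
  define s where "s = psize \<mu> + psize \<nu> + size M"
  define F where "F = {p \<in> partitions. psize p \<le> s}"
  have F_box: "F \<subseteq> box l m" if "s \<le> l" "s \<le> m" for l m
    using that by (auto simp: F_def intro!: partition_in_box_psize)
  have fin: "finite F"
    using F_box[of s s] finite_box by (auto intro: finite_subset)
  have F_sub: "F \<subseteq> partitions"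
    by (auto simp: F_def)
  have \<mu>F: "\<mu> \<in> F" and \<nu>F: "\<nu> \<in> F"
    using \<mu> \<nu> by (auto simp: F_def s_def)
  obtain k0 n1 where G: "\<And>p q l n. p \<in> partitions \<Longrightarrow> q \<in> partitions \<Longrightarrow> plength p + k0 \<le> l \<Longrightarrow>
      plength q + k0 \<le> l \<Longrightarrow> n1 \<le> n \<Longrightarrow> mcong M (G_fun x \<alpha> \<beta> p q) (G_fin l n x \<alpha> \<beta> p q)"
    using G_fun_mcong[of M] by blast
  obtain n2 where n2: "\<And>n p q l. n \<ge> n2 \<Longrightarrow> p \<in> partitions \<Longrightarrow> q \<in> partitions \<Longrightarrow> plength p \<le> l \<Longrightarrow> plength q \<le> l \<Longrightarrow>
      mcong M (g p q) (gdet (K n) A \<beta> l p q)"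
    using g unfolding represents_def by meson
  obtain n3 where n3: "\<And>n. n \<ge> n3 \<Longrightarrow> mcong M \<kappa> (c n)"
    using \<kappa> by meson
  define n where "n = n1 + n2 + n3"
  \<comment> \<open>\<open>s\<close> bounds the lengths in \<open>F\<close>, \<open>k0\<close> makes
    \<open>G\<close> stable, and \<open>n\<close> is the reserve of zero parts for the
    exchange.\<close>
  define l where "l = s + k0 + n"
  define m where "m = s + size M + 1"
  have plen: "plength p \<le> s" if "p \<in> F" for p
    using that le_psize(2)[of p] by (auto simp: F_def)
  have Gl: "mcong M (G_fun x \<alpha> \<beta> p q) (G_fin l n x \<alpha> \<beta> p q)" if "p \<in> F" "q \<in> F" for p q
    using that plen F_sub by (intro G) (auto simp: l_def n_def add_mono trans_le_add1)
  have gl: "mcong M (g p q) (gdet (K n) A \<beta> l p q)" if "p \<in> F" "q \<in> F" for p q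
    using that plen[OF that(1)] plen[OF that(2)] F_sub by (intro n2) (auto simp: l_def n_def)
  have sub: "F \<subseteq> box l m"
    by (rule F_box) (auto simp: l_def m_def)
  have G_small: "mcong M (G_fun x \<alpha> \<beta> p \<mu>) 0" if "p \<in> partitions - F" for p
  proof -
    \<comment> \<open>A separate number of rows, since \<open>l\<close> is large enough only for
      partitions in \<open>F\<close>.\<close>
    define l' where "l' = psize p + s + k0"
    have pp: "p \<in> partitions" "s < psize p"
      using that by (auto simp: F_def)
    have "p \<in> box l' (psize p)" "\<mu> \<in> box l' s"
      using pp \<mu> \<mu>F by (auto intro!: partition_in_box_psize simp: l'_def F_def)
    then have "mcong M (G_fin l' n x \<alpha> \<beta> p \<mu>) 0"
      using pp(2) by (intro mcong_zero_of_mord[OF mord_G_fin]) (auto simp: s_def)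
    moreover have "mcong M (G_fun x \<alpha> \<beta> p \<mu>) (G_fin l' n x \<alpha> \<beta> p \<mu>)"
      using pp \<mu> le_psize(2)[OF pp(1)] plen[OF \<mu>F] by (intro G) (auto simp: l'_def n_def)
    ultimately show ?thesis
      by (meson mcong_trans)
  qed
  \<comment> \<open>The determinants vanish exactly, so this holds modulo every monomial and the
    infinite sum on the right collapses to a finite one.\<close>
  have g_zero: "g \<mu> \<eta> = 0" if "\<eta> \<in> partitions - F" for \<eta>
  proof (rule mcong_eqI)
    fix M
    have \<eta>: "\<eta> \<in> partitions" "psize \<mu> < psize \<eta>"
      using that by (auto simp: F_def s_def)
    obtain n0 where "mcong M (g \<mu> \<eta>) (gdet (K n0) A \<beta> (psize \<eta>) \<mu> \<eta>)"
      using g \<mu> \<eta> le_psize(2)[OF \<mu>] le_psize(2)[OF \<eta>(1)] unfolding represents_def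
      by (meson le_refl le_trans less_imp_le)
    moreover have "gdet (K n0) A \<beta> (psize \<eta>) \<mu> \<eta> = 0"
      using \<eta> \<mu> by (intro gdet_eq_0[where m = "psize \<mu>" and m' = "psize \<eta>"]) (auto intro!: partition_in_box_psize)
    ultimately show "mcong M (g \<mu> \<eta>) 0"
      by simp
  qed
  have rhs: "(\<Sum>\<^sub>\<infinity>\<eta>\<in>partitions. G_fun x \<alpha> \<beta> \<nu> \<eta> * g \<mu> \<eta>) = (\<Sum>\<eta>\<in>F. G_fun x \<alpha> \<beta> \<nu> \<eta> * g \<mu> \<eta>)"
  proof -
    have "(\<Sum>\<^sub>\<infinity>\<eta>\<in>partitions. G_fun x \<alpha> \<beta> \<nu> \<eta> * g \<mu> \<eta>) = (\<Sum>\<^sub>\<infinity>\<eta>\<in>F. G_fun x \<alpha> \<beta> \<nu> \<eta> * g \<mu> \<eta>)"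
      using g_zero F_sub by (intro infsum_cong_neutral) auto
    then show ?thesis
      using fin by simp
  qed
  show "\<exists>F. finite F \<and> F \<subseteq> partitions \<and> (\<forall>p\<in>partitions - F. mcong M (G_fun x \<alpha> \<beta> p \<mu> * g p \<nu>) 0) \<and>
      mcong M (\<Sum>p\<in>F. G_fun x \<alpha> \<beta> p \<mu> * g p \<nu>) (\<kappa> * (\<Sum>\<^sub>\<infinity>\<eta>\<in>partitions. G_fun x \<alpha> \<beta> \<nu> \<eta> * g \<mu> \<eta>))"
  proof (intro exI[of _ F] conjI ballI)
    show "mcong M (G_fun x \<alpha> \<beta> p \<mu> * g p \<nu>) 0" if "p \<in> partitions - F" for p
      using G_small[OF that] by (rule mcong_mult_zero)
    have \<mu>s: "\<mu> \<in> box l s" and \<nu>s: "\<nu> \<in> box l s"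
      using F_box[of l s] \<mu>F \<nu>F by (auto simp: l_def)
    have s1: "mcong M (\<Sum>p\<in>F. G_fun x \<alpha> \<beta> p \<mu> * g p \<nu>) (\<Sum>p\<in>F. G_fin l n x \<alpha> \<beta> p \<mu> * gdet (K n) A \<beta> l p \<nu>)"
      using \<mu>F \<nu>F by (intro mcong_sum mcong_mult Gl gl)
    have s2: "mcong M (\<Sum>p\<in>box l m. G_fin l n x \<alpha> \<beta> p \<mu> * gdet (K n) A \<beta> l p \<nu>)
        (\<Sum>p\<in>F. G_fin l n x \<alpha> \<beta> p \<mu> * gdet (K n) A \<beta> l p \<nu>)"
    proof (rule mcong_sum_mono_neutral[OF finite_box sub])
      fix p assume "p \<in> box l m - F"
      then have p: "p \<in> box l m" "s < psize p"
        using box_subset_partitions by (auto simp: F_def)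
      have "mcong M (G_fin l n x \<alpha> \<beta> p \<mu>) 0"
        using p by (intro mcong_zero_of_mord[OF mord_G_fin[OF p(1) \<mu>s]]) (auto simp: s_def)
      then show "mcong M (G_fin l n x \<alpha> \<beta> p \<mu> * gdet (K n) A \<beta> l p \<nu>) 0"
        by (rule mcong_mult_zero)
    qed
    have s3: "mcong M (\<Sum>p\<in>box l m. G_fin l n x \<alpha> \<beta> p \<mu> * gdet (K n) A \<beta> l p \<nu>)
        (c n * (\<Sum>\<eta>\<in>box l m. G_fin l n x \<alpha> \<beta> \<nu> \<eta> * gdet (K n) A \<beta> l \<mu> \<eta>))"
      using plen[OF \<mu>F] by (intro finite_skew_cauchy[OF ex \<mu>s _ \<nu>s]) (auto simp: l_def m_def s_def)
    have s4: "(\<Sum>\<eta>\<in>box l m. G_fin l n x \<alpha> \<beta> \<nu> \<eta> * gdet (K n) A \<beta> l \<mu> \<eta>) =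
        (\<Sum>\<eta>\<in>F. G_fin l n x \<alpha> \<beta> \<nu> \<eta> * gdet (K n) A \<beta> l \<mu> \<eta>)"
    proof (rule sum.mono_neutral_right[OF finite_box sub], rule ballI)
      fix \<eta> assume "\<eta> \<in> box l m - F"
      then have \<eta>: "\<eta> \<in> box l m" "psize \<mu> < psize \<eta>"
        using box_subset_partitions by (auto simp: F_def s_def)
      show "G_fin l n x \<alpha> \<beta> \<nu> \<eta> * gdet (K n) A \<beta> l \<mu> \<eta> = 0"
        by (simp add: gdet_eq_0[OF \<mu>s \<eta>])
    qed
    have s5: "mcong M (\<kappa> * (\<Sum>\<eta>\<in>F. G_fun x \<alpha> \<beta> \<nu> \<eta> * g \<mu> \<eta>))
        (c n * (\<Sum>\<eta>\<in>F. G_fin l n x \<alpha> \<beta> \<nu> \<eta> * gdet (K n) A \<beta> l \<mu> \<eta>))"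
      using \<mu>F \<nu>F by (intro mcong_mult mcong_sum Gl gl n3) (auto simp: n_def)
    show "mcong M (\<Sum>p\<in>F. G_fun x \<alpha> \<beta> p \<mu> * g p \<nu>)
        (\<kappa> * (\<Sum>\<^sub>\<infinity>\<eta>\<in>partitions. G_fun x \<alpha> \<beta> \<nu> \<eta> * g \<mu> \<eta>))"
      unfolding rhs
      by (rule mcong_trans[OF s1 mcong_trans[OF mcong_sym[OF s2]
            mcong_trans[OF s3[unfolded s4] mcong_sym[OF s5]]]])
  qed (use fin F_sub in auto)
qed

lemma exchanges_efps:
  "exchanges (efps (\<lambda>k. - y k)) (\<lambda>n. \<Prod>i=1..n. \<Prod>j=1..n. 1 + x i * y j)"
  unfolding exchanges_def
proof (intro allI impI)
  fix n l N B :: nat and M :: "'v multiset" and Q V :: "nat \<Rightarrow> nat \<Rightarrow> ('v, 'a) mps"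
  assume "ut_low n l Q" "n \<le> N" "\<forall>i<l. \<forall>e>B. Q i e = 0" "B + size M < N"
  then have "mcong M (fdet l (mprod N Q (mprod N (Lt n) (mprod N (cf (efps (\<lambda>k. - y k) n)) V))))
      ((\<Prod>t=1..n. \<Prod>s=1..n. 1 - x t * - y s) * fdet l (mprod N Q (mprod N (cf (efps (\<lambda>k. - y k) n)) (mprod N (Lt n) V))))"
    unfolding Lt_def by (intro exchange_efps[where A = B and y = "\<lambda>k. - y k"] graded_series) auto
  then show "mcong M (fdet l (mprod N Q (mprod N (Lt n) (mprod N (cf (efps (\<lambda>k. - y k) n)) V))))
      ((\<Prod>i=1..n. \<Prod>j=1..n. 1 + x i * y j) * fdet l (mprod N Q (mprod N (cf (efps (\<lambda>k. - y k) n)) (mprod N (Lt n) V))))"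
    by simp
qed

text \<open>The scalar of \<open>exchange_hfps\<close> is moved to the other side; each
  \<open>1 - x i * y j\<close> is invertible because \<open>x i * y j\<close> has no constant
  term.\<close>

lemma exchanges_hfps:
  assumes y: "null_seq y"
  shows "exchanges (hfps y) (\<lambda>n. \<Prod>i=1..n. \<Prod>j=1..n. ring_inv (1 - x i * y j))"
  unfolding exchanges_def
proof (intro allI impI)
  fix n l N B :: nat and M :: "'v multiset" and Q V :: "nat \<Rightarrow> nat \<Rightarrow> ('v, 'a) mps"
  let ?c = "\<Prod>t=1..n. \<Prod>s=1..n. 1 - x t * y s"
    and ?k = "\<Prod>i=1..n. \<Prod>j=1..n. ring_inv (1 - x i * y j)"
  let ?L = "fdet l (mprod N Q (mprod N (Lt n) (mprod N (cf (hfps y n)) V)))"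
    and ?R = "fdet l (mprod N Q (mprod N (cf (hfps y n)) (mprod N (Lt n) V)))"
  assume "ut_low n l Q" "n \<le> N" "\<forall>i<l. \<forall>e>B. Q i e = 0" "B + size M < N"
  then have "mcong M (?c * ?L) ?R"
    unfolding Lt_def by (intro exchange_hfps[where A = B] graded_series) auto
  then have *: "mcong M (?k * (?c * ?L)) (?k * ?R)"
    by (intro mcong_mult mcong_refl)
  have "mord 1 (x i * y j)" for i j
    using mord_mult[OF mord_letters(1)[of i] mord_0(1)[of "y j"]] by simp
  then have "?c * ?k = 1"
    by (simp add: prod.distrib[symmetric] mult_ring_inv)
  moreover have "?k * (?c * ?L) = ?c * ?k * ?L"
    by (simp only: mult.assoc mult.left_commute[of ?k ?c])
  ultimately have "?k * (?c * ?L) = ?L"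
    by simp
  with * show "mcong M ?L (?k * ?R)"
    by (simp only:)
qed

end

text \<open>Outside a large enough square every factor contains a letter that is zero modulo
  \<open>M\<close>.\<close>

lemma prod_square_mcong:
  assumes v: "null_seq v" "null_seq w" and f: "\<And>M z. mcong M z 0 \<Longrightarrow> mcong M (f z) 1"
  shows "\<exists>n0. \<forall>n\<ge>n0. mcong M (lim (\<lambda>n. \<Prod>i=1..n. \<Prod>j=1..n. f (v i * w j)))
    (\<Prod>i=1..n. \<Prod>j=1..n. f (v i * w j))"
proof -
  let ?P = "\<lambda>n. \<Prod>i=1..n. \<Prod>j=1..n. f (v i * w j)"
  have stab: "\<exists>n0. \<forall>n\<ge>n0. mcong M (?P n) (?P n0)" for M
  proof -
    obtain a b where a: "\<And>k. k \<ge> a \<Longrightarrow> mcong M (v k) 0" and b: "\<And>k. k \<ge> b \<Longrightarrow> mcong M (w k) 0"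
      using v unfolding null_seq_def by metis
    define n0 where "n0 = max a b"
    have P: "?P n = (\<Prod>(i, j)\<in>{1..n} \<times> {1..n}. f (v i * w j))" for n
      by (rule prod.cartesian_product)
    have "mcong M (?P n) (?P n0)" if "n \<ge> n0" for n
    proof -
      have "?P n = (\<Prod>(i, j)\<in>{1..n} \<times> {1..n} - {1..n0} \<times> {1..n0}. f (v i * w j)) * ?P n0"
        unfolding P using that by (intro prod.subset_diff) auto
      moreover have "mcong M (\<Prod>(i, j)\<in>{1..n} \<times> {1..n} - {1..n0} \<times> {1..n0}. f (v i * w j))
          (\<Prod>z\<in>{1..n} \<times> {1..n} - {1..n0} \<times> {1..n0}. 1)"
      proof (rule mcong_prod)
        fix z assume z: "z \<in> {1..n} \<times> {1..n} - {1..n0} \<times> {1..n0}"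
        obtain i j where ij: "z = (i, j)"
          by (cases z)
        with z have "i \<ge> a \<or> j \<ge> b"
          by (auto simp: n0_def)
        then have "mcong M (v i * w j) 0"
          using a[of i] b[of j] by (auto intro: mcong_mult_zero)
        then show "mcong M (case z of (i, j) \<Rightarrow> f (v i * w j)) 1"
          using ij by (simp add: f)
      qed
      ultimately show ?thesis
        using mcong_mult[OF _ mcong_refl[of M "?P n0"]] by fastforce
    qed
    then show ?thesis
      by blast
  qed
  obtain n0 where "\<And>n. n \<ge> n0 \<Longrightarrow> mcong M (?P n) (?P n0)"
    using stab by blast
  then have "mcong M (lim ?P) (?P n)" if "n \<ge> n0" for n
    using that by (intro lim_mcong[OF stab])
  then show ?thesis
    by blast
qed

lemma cauchy_kernel_mcong:
  assumes "null_seq x" "null_seq y"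
  shows "\<exists>n0. \<forall>n\<ge>n0. mcong M (cauchy_kernel x y) (\<Prod>i=1..n. \<Prod>j=1..n. ring_inv (1 - x i * y j))"
proof -
  have mord: "mord 1 (x i * y j)" for i j
    using assms mord_mult[of 1 "x i" 0 "y j"] by (simp add: null_seq_def)
  \<comment> \<open>The inverse is under control only for \<open>z\<close> without constant term;
    the default 1 makes the required congruence hold for every \<open>z\<close>.\<close>
  define f where "f z = (if mord 1 z then ring_inv (1 - z) else 1)" for z :: "('a, 'b) mps"
  have f: "mcong M (f z) 1" if "mcong M z 0" for M z
  proof (cases "mord 1 z")
    case True
    have "mcong M ((1 - z) * ring_inv (1 - z)) ((1 - 0) * ring_inv (1 - z))"
      using that by (intro mcong_mult mcong_diff) auto
    then show ?thesis
      using True by (simp add: f_def mult_ring_inv mcong_sym)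
  qed (simp add: f_def)
  show ?thesis
    using prod_square_mcong[OF assms, of f M, OF f] by (simp add: f_def mord[unfolded One_nat_def] cauchy_kernel_def)
qed

lemma dual_cauchy_kernel_mcong:
  assumes "null_seq x" "null_seq y"
  shows "\<exists>n0. \<forall>n\<ge>n0. mcong M (dual_cauchy_kernel x y) (\<Prod>i=1..n. \<Prod>j=1..n. 1 + x i * y j)"
  unfolding dual_cauchy_kernel_def
proof (rule prod_square_mcong[OF assms])
  show "mcong M (1 + z) 1" if "mcong M z 0" for M and z :: "('a, 'b) mps"
    using mcong_add[OF mcong_refl[of M 1] that] by simp
qed

lemma bij_betw_conj_part: "bij_betw conj_part partitions partitions"
  by (rule bij_betw_byWitness[of _ conj_part]) (auto simp: conj_conj_part conj_part_partitions)

lemma has_sum_conj_part: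
  "((\<lambda>p. f (conj_part p)) has_sum s) partitions \<longleftrightarrow> (f has_sum s) partitions"
  by (rule has_sum_reindex_bij_betw[OF bij_betw_conj_part])

lemma infsum_conj_part:
  "(\<Sum>\<^sub>\<infinity>p\<in>partitions. f (conj_part p)) = (\<Sum>\<^sub>\<infinity>p\<in>partitions. f p)"
  by (rule infsum_reindex_bij_betw[OF bij_betw_conj_part])

lemma skew_cauchy_identity:
  assumes "null_seq x" "null_seq y" "null_seq \<alpha>" "null_seq \<beta>" "\<mu> \<in> partitions" "\<nu> \<in> partitions"
  shows "((\<lambda>p. G_fun x \<alpha> \<beta> p \<mu> * g_fun y \<alpha> \<beta> p \<nu>) has_sum
    cauchy_kernel x y * (\<Sum>\<^sub>\<infinity>\<eta>\<in>partitions. G_fun x \<alpha> \<beta> \<nu> \<eta> * g_fun y \<alpha> \<beta> \<mu> \<eta>)) partitions"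
proof -
  interpret grothendieck x \<alpha> \<beta>
    by standard fact+
  have "represents (g_fun y \<alpha> \<beta>) (hfps y) A \<beta>"
    using represents_g_fun[OF assms(2)] by (simp add: A_def[abs_def])
  then show ?thesis
    by (rule skew_cauchy[OF _ exchanges_hfps[OF assms(2)] cauchy_kernel_mcong[OF assms(1,2)] assms(5,6)])
qed

lemma dual_skew_cauchy_identity:
  assumes "null_seq x" "null_seq y" "null_seq \<alpha>" "null_seq \<beta>" "\<mu> \<in> partitions" "\<nu> \<in> partitions"
  shows "((\<lambda>p. G_fun x \<alpha> \<beta> p \<mu> * g_fun y \<beta> \<alpha> (conj_part p) (conj_part \<nu>)) has_sum
    dual_cauchy_kernel x y * (\<Sum>\<^sub>\<infinity>\<eta>\<in>partitions. G_fun x \<alpha> \<beta> \<nu> \<eta> * g_fun y \<beta> \<alpha> (conj_part \<mu>) (conj_part \<eta>))) partitions"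
proof -
  interpret grothendieck x \<alpha> \<beta>
    by standard fact+
  have "represents (\<lambda>p q. g_fun y \<beta> \<alpha> (conj_part p) (conj_part q)) (efps (\<lambda>k. - y k)) A \<beta>"
    using represents_g_fun_conj[OF assms(2)] by (simp add: A_def[abs_def])
  then show ?thesis
    by (rule skew_cauchy[OF _ exchanges_efps dual_cauchy_kernel_mcong[OF assms(1,2)] assms(5,6)])
qed

theorem theorem4p7:
  fixes x y \<alpha> \<beta> :: "nat \<Rightarrow> (gvar, 'a::comm_ring_1) mps"
    and \<mu> \<nu> :: "nat \<Rightarrow> nat"
  assumes "x = (\<lambda>i. mps_var (X i))" and "y = (\<lambda>i. mps_var (Y i))"
    and "\<alpha> = (\<lambda>i. mps_var (Alpha i))" and "\<beta> = (\<lambda>i. mps_var (Beta i))"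
    and "\<mu> \<in> partitions" and "\<nu> \<in> partitions"
  shows "((\<lambda>lam. G_fun x \<alpha> \<beta> lam \<mu> * g_fun y \<alpha> \<beta> lam \<nu>) has_sum
        cauchy_kernel x y * (\<Sum>\<^sub>\<infinity>\<eta>\<in>partitions. G_fun x \<alpha> \<beta> \<nu> \<eta> * g_fun y \<alpha> \<beta> \<mu> \<eta>))
        partitions \<and>
    ((\<lambda>lam. G_fun x \<beta> \<alpha> (conj_part lam) (conj_part \<mu>) * g_fun y \<alpha> \<beta> lam \<nu>) has_sum
        dual_cauchy_kernel x y *
          (\<Sum>\<^sub>\<infinity>\<eta>\<in>partitions. G_fun x \<beta> \<alpha> (conj_part \<nu>) (conj_part \<eta>) * g_fun y \<alpha> \<beta> \<mu> \<eta>))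
        partitions \<and>
    ((\<lambda>lam. G_fun x \<alpha> \<beta> lam \<mu> * g_fun y \<beta> \<alpha> (conj_part lam) (conj_part \<nu>)) has_sum
        dual_cauchy_kernel x y *
          (\<Sum>\<^sub>\<infinity>\<eta>\<in>partitions. G_fun x \<alpha> \<beta> \<nu> \<eta> * g_fun y \<beta> \<alpha> (conj_part \<mu>) (conj_part \<eta>)))
        partitions \<and>
    ((\<lambda>lam. G_fun x \<beta> \<alpha> (conj_part lam) (conj_part \<mu>) *
            g_fun y \<beta> \<alpha> (conj_part lam) (conj_part \<nu>)) has_sum
        cauchy_kernel x y *
          (\<Sum>\<^sub>\<infinity>\<eta>\<in>partitions. G_fun x \<beta> \<alpha> (conj_part \<nu>) (conj_part \<eta>) *
            g_fun y \<beta> \<alpha> (conj_part \<mu>) (conj_part \<eta>)))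
        partitions"
proof -
  have null: "null_seq x" "null_seq y" "null_seq \<alpha>" "null_seq \<beta>"
    unfolding assms by (auto intro!: null_seq_mps_var injI)
  note conj = conj_part_partitions[OF assms(5)] conj_part_partitions[OF assms(6)]
  \<comment> \<open>The third identity with \<alpha> and \<beta> interchanged and
    \<open>\<mu>\<close>, \<open>\<nu>\<close> conjugated; both sums are then reindexed by
    conjugation.\<close>
  have "((\<lambda>lam. G_fun x \<beta> \<alpha> (conj_part lam) (conj_part \<mu>) * g_fun y \<alpha> \<beta> lam \<nu>) has_sum
        dual_cauchy_kernel x y *
          (\<Sum>\<^sub>\<infinity>\<eta>\<in>partitions. G_fun x \<beta> \<alpha> (conj_part \<nu>) (conj_part \<eta>) * g_fun y \<alpha> \<beta> \<mu> \<eta>))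
        partitions"
  proof -
    let ?f = "\<lambda>p. G_fun x \<beta> \<alpha> p (conj_part \<mu>) * g_fun y \<alpha> \<beta> (conj_part p) \<nu>"
    let ?h = "\<lambda>\<eta>. G_fun x \<beta> \<alpha> (conj_part \<nu>) \<eta> * g_fun y \<alpha> \<beta> \<mu> (conj_part \<eta>)"
    have "(?f has_sum dual_cauchy_kernel x y * (\<Sum>\<^sub>\<infinity>\<eta>\<in>partitions. ?h \<eta>)) partitions"
      using dual_skew_cauchy_identity[OF null(1,2,4,3) conj] assms(5,6) by (simp add: conj_conj_part)
    then have "((\<lambda>p. ?f (conj_part p)) has_sum dual_cauchy_kernel x y * (\<Sum>\<^sub>\<infinity>\<eta>\<in>partitions. ?h (conj_part \<eta>))) partitions"
      by (simp only: has_sum_conj_part[of ?f] infsum_conj_part[of ?h])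
    also have "(\<Sum>\<^sub>\<infinity>\<eta>\<in>partitions. ?h (conj_part \<eta>)) =
        (\<Sum>\<^sub>\<infinity>\<eta>\<in>partitions. G_fun x \<beta> \<alpha> (conj_part \<nu>) (conj_part \<eta>) * g_fun y \<alpha> \<beta> \<mu> \<eta>)"
      by (rule infsum_cong) (simp add: conj_conj_part)
    finally show ?thesis
      by (rule iffD1[OF has_sum_cong, rotated]) (simp add: conj_conj_part)
  qed
  \<comment> \<open>The first identity, interchanged and reindexed in the same way.\<close>
  moreover have "((\<lambda>lam. G_fun x \<beta> \<alpha> (conj_part lam) (conj_part \<mu>) *
            g_fun y \<beta> \<alpha> (conj_part lam) (conj_part \<nu>)) has_sum
        cauchy_kernel x y *
          (\<Sum>\<^sub>\<infinity>\<eta>\<in>partitions. G_fun x \<beta> \<alpha> (conj_part \<nu>) (conj_part \<eta>) *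
            g_fun y \<beta> \<alpha> (conj_part \<mu>) (conj_part \<eta>)))
        partitions"
    using skew_cauchy_identity[OF null(1,2,4,3) conj]
    unfolding has_sum_conj_part[of "\<lambda>p. G_fun x \<beta> \<alpha> p (conj_part \<mu>) * g_fun y \<beta> \<alpha> p (conj_part \<nu>)"]
      infsum_conj_part[of "\<lambda>\<eta>. G_fun x \<beta> \<alpha> (conj_part \<nu>) \<eta> * g_fun y \<beta> \<alpha> (conj_part \<mu>) \<eta>"] .
  ultimately show ?thesis
    using skew_cauchy_identity[OF null(1-4) assms(5,6)] dual_skew_cauchy_identity[OF null(1-4) assms(5,6)]
    by blast
qed

end
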